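(* Let $K$ be a virtual link and let $n_v$ be the minimum, over all diagrams of $K$, of the number of virtual crossings of the diagram. Let $\alpha^{e_{\max}}$ and $\alpha^{e_{\min}}$ be, respectively, the highest and lowest powers of $\alpha$ appearing in the $\alpha$-Sawollek polynomial of $K$ (or, alternatively, in the $\alpha$-Generalized Link Parity Alexander polynomial of $K$). Then $\max(|e_{\max}|,|e_{\min}|)\le n_v$. (The assertion holds for each of the two polynomials.)
   Context: Virtual links. A virtual link diagram is a collection of oriented closed curves (components, labeled $1,\dots,k$) immersed in the plane whose double points are transverse and each is either a classical (real) crossing, with over/under information, or a virtual crossing. A virtual link is an equivalence class of such diagrams under planar isotopy, the classical Reidemeister moves I, II, III, and the virtual moves (virtual Reidemeister I, II, III, and the mixed move passing a strand with two consecutive virtual crossings across a classical crossing). Each classical crossing has the usual sign. Crossing types. A classical crossing is a self-crossing if both its strands lie in the same component, and a link crossing (between $i$ and $j$) if they lie in distinct components $i\ne j$. For component $i$, traverse it once and record only the passages through its classical self-crossings; in this cyclic word each self-crossing of $i$ occurs twice. A self-crossing is even if the number of letters between its two occurrences is even, and odd otherwise. Relations. Here the arcs of a diagram are the segments between consecutive passages through crossings, classical or virtual; a component meeting no crossings contributes one arc $x$ with the trivial relation $x=x$. At each classical crossing let $o_{in},o_{out}$ be the incoming and outgoing arcs of the over-strand and $u_{in},u_{out}$ those of the under-strand. Define the relations: (B) positive crossing: $o_{out}=s\,o_{in}$, $u_{out}=t\,u_{in}+(1-st)\,o_{in}$; negative crossing: $o_{out}=s^{-1}o_{in}$, $u_{out}=t^{-1}u_{in}+(1-s^{-1}t^{-1})\,o_{in}$.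 (C$_y$), for an invertible variable $y$: positive crossing: $o_{out}=y\,o_{in}$, $u_{out}=y^{-1}u_{in}$; negative crossing: $o_{out}=y^{-1}o_{in}$, $u_{out}=y\,u_{in}$. (V) virtual crossing: rotate the picture so that both strands are directed downward; the strand going from upper right to lower left satisfies $\text{out}=\alpha\cdot\text{in}$, and the strand going from upper left to lower right satisfies $\text{out}=\alpha^{-1}\cdot\text{in}$. The $\alpha$-Sawollek polynomial uses (B) at all classical crossings and (V) at all virtual crossings, over $\mathbb{Z}[s^{\pm1},t^{\pm1},\alpha^{\pm1}]$. The $\alpha$-Generalized Link Parity Alexander polynomial uses (B) at even self-crossings, (C$_{z_i}$) at odd self-crossings of component $i$, (C$_{w_{\{i,j\}}}$) at link crossings between components $i$ and $j$, and (V) at virtual crossings, over the Laurent polynomial ring over $\mathbb{Z}$ in $s,t,\alpha$, all $z_i$ and all $w_{\{i,j\}}$. In either case each arc is the outgoing arc of exactly one relation, so the relations can be written as $Mx=x$ with $x$ the vector of arcs and $M$ a square matrix; the polynomial is $\det(M-I)$, regarded up to multiplication by $\pm s^at^b$, $a,b\in\mathbb{Z}$. Up to this ambiguity it is an invariant of $K$. If the polynomial is $0$, set $e_{\max}=e_{\min}=0$. *)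

theory Defs
  imports
    "Jordan_Normal_Form.Determinant"
    "HOL-Library.Poly_Mapping"
    "HOL-Combinatorics.Orbits"
begin

section \<open>Virtual link diagrams\<close>

text \<open>
  A diagram is recorded by its underlying 4-valent oriented plane graph.  Rotate each crossing,
  classical or virtual, so that both strands are directed downward.  The strand that runs from
  upper right to lower left is called \<open>SW\<close>, the one that runs from upper left to
  lower right is called \<open>SE\<close>.  The four ends at a crossing are then, in counterclockwise
  order: \<open>SW\<close> in (upper right), \<open>SE\<close> in (upper left),
  \<open>SW\<close> out (lower left), \<open>SE\<close> out (lower right).
  At a positive crossing the over-strand is \<open>SW\<close>, at a negative one it is
  \<open>SE\<close>; so sign and over/under information determine each other.

  A passage is one of the two strands of a crossing, and a component is the cyclic word
  of the passages met along it (the empty word is a circle that meets no crossing).  The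
  component labelled \<open>i + 1\<close> is \<open>comps D ! i\<close>.
\<close>

datatype kind = Pos | Neg | Virt

datatype strand = SW | SE

type_synonym passage = "nat \<times> strand"

record diagram =
  comps :: "passage list list"
  kind_of :: "nat \<Rightarrow> kind"

fun opp :: "passage \<Rightarrow> passage" where
  "opp (c, SW) = (c, SE)"
| "opp (c, SE) = (c, SW)"

definition passages :: "diagram \<Rightarrow> passage set" where
  "passages D = set (concat (comps D))"

definition crossings :: "diagram \<Rightarrow> nat set" where
  "crossings D = fst ` passages D"

definition num_virtual :: "diagram \<Rightarrow> nat" where
  "num_virtual D = card {c \<in> crossings D. kind_of D c = Virt}"

definition is_virt :: "diagram \<Rightarrow> passage \<Rightarrow> bool" where
  "is_virt D p \<longleftrightarrow> kind_of D (fst p) = Virt"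

definition is_over :: "diagram \<Rightarrow> passage \<Rightarrow> bool" where
  "is_over D p \<longleftrightarrow>
     kind_of D (fst p) = Pos \<and> snd p = SW \<or> kind_of D (fst p) = Neg \<and> snd p = SE"

definition succ_table :: "diagram \<Rightarrow> (passage \<times> passage) list" where
  "succ_table D = concat (map (\<lambda>w. zip w (rotate1 w)) (comps D))"

definition nxt :: "diagram \<Rightarrow> passage \<Rightarrow> passage" where
  "nxt D p = the (map_of (succ_table D) p)"

definition prv :: "diagram \<Rightarrow> passage \<Rightarrow> passage" where
  "prv D p = the (map_of (map prod.swap (succ_table D)) p)"

text \<open>
  A dart \<open>(p, f)\<close> is the arc that leaves passage \<open>p\<close> (and arrives at
  \<open>nxt D p\<close>), traversed along (\<open>f\<close>) or against (\<open>\<not> f\<close>) its orientation.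
  The map below goes to the next dart of the face on the left: arriving at a crossing,
  one leaves it by the end that follows clockwise.  Hence its orbits are the boundary walks of
  the faces.
\<close>

type_synonym dart = "passage \<times> bool"

definition darts :: "diagram \<Rightarrow> dart set" where
  "darts D = passages D \<times> UNIV"

fun face_step :: "diagram \<Rightarrow> dart \<Rightarrow> dart" where
  "face_step D (p, True) =
     (case nxt D p of (c, SW) \<Rightarrow> ((c, SE), True) | (c, SE) \<Rightarrow> (prv D (c, SW), False))"
| "face_step D ((c, SW), False) = (prv D (c, SE), False)"
| "face_step D ((c, SE), False) = ((c, SW), True)"

definition faces :: "diagram \<Rightarrow> dart set set" where
  "faces D = orbit (face_step D) ` darts D"

definition adjacent :: "diagram \<Rightarrow> (nat \<times> nat) set" where
  "adjacent D = {(fst p, fst (nxt D p)) |p. p \<in> passages D}"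

definition pieces :: "diagram \<Rightarrow> nat set set" where
  "pieces D = (\<lambda>c. ((adjacent D \<union> (adjacent D)\<inverse>)\<^sup>*) `` {c}) ` crossings D"

text \<open>
  With \<open>V\<close> crossings the graph has \<open>2 V\<close> edges, so Euler's formula
  \<open>V - E + F = 2\<close>, summed over the connected pieces, reads
  \<open>F = V + 2 * pieces\<close>.  (\<open>F\<close> counts the faces of each piece separately.)  It says
  that each piece is drawn in the plane and not on a surface of positive genus.  The relative
  position of different pieces and the choice of the outer face are not
  recorded: they can be changed by virtual moves, and affect neither the number of
  virtual crossings nor the polynomials.
\<close>

definition planar :: "diagram \<Rightarrow> bool" where
  "planar D \<longleftrightarrow> card (faces D) = card (crossings D) + 2 * card (pieces D)"

definition virtual_diagram :: "diagram \<Rightarrow> bool" where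
  "virtual_diagram D \<longleftrightarrow>
     distinct (concat (comps D)) \<and> (\<forall>p \<in> passages D. opp p \<in> passages D) \<and> planar D"


section \<open>Virtual links\<close>

definition isotopic :: "diagram \<Rightarrow> diagram \<Rightarrow> bool" where
  "isotopic D D' \<longleftrightarrow> length (comps D') = length (comps D) \<and>
     (\<exists>f. inj_on f (crossings D) \<and>
        (\<forall>c \<in> crossings D. kind_of D' (f c) = kind_of D c) \<and>
        (\<forall>i < length (comps D). \<exists>n.
           comps D' ! i = rotate n (map (map_prod f id) (comps D ! i))))"

definition delete_crossings :: "nat set \<Rightarrow> diagram \<Rightarrow> diagram" where
  "delete_crossings C D = D\<lparr>comps := map (filter (\<lambda>p. fst p \<notin> C)) (comps D)\<rparr>"

text \<open>Reverse, along each arc leaving a passage in \<open>P\<close>, the order of its two ends.\<close>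

definition swap_along :: "passage set \<Rightarrow> diagram \<Rightarrow> diagram" where
  "swap_along P D = D\<lparr>comps := map (map (\<lambda>p.
     if p \<in> P then nxt D p else if p \<in> nxt D ` P then prv D p else p)) (comps D)\<rparr>"

text \<open>
  Moves I and II, classical and virtual, are given in the reducing direction: a monogon face or
  a bigon face is removed.  In \<open>bigon\<close> the condition on kinds says that either both crossings
  are virtual, or both are classical and the same strand is over at both.

  A move III passes one strand across the opposite crossing of a triangle face; this reverses the
  order of the two crossings along each of the three strands.  It is allowed if all three
  crossings are classical and one strand is over at both of its crossings (equivalently, the strands
  are a top, a middle and a bottom one), or if one strand meets the other two in virtual
  crossings; the third crossing may then be virtual (virtual move III) or classical
  (mixed move).
\<close>

inductive reidemeister :: "diagram \<Rightarrow> diagram \<Rightarrow> bool" where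
  monogon:
    "\<lbrakk>d \<in> darts D; face_step D d = d\<rbrakk>
     \<Longrightarrow> reidemeister D (delete_crossings {fst (fst d)} D)"
| bigon:
    "\<lbrakk>d \<in> darts D; face_step D (face_step D d) = d;
      p = fst d; q = nxt D p; fst p \<noteq> fst q;
      is_virt D p \<longleftrightarrow> is_virt D q; is_over D p \<longleftrightarrow> is_over D q\<rbrakk>
     \<Longrightarrow> reidemeister D (delete_crossings {fst p, fst q} D)"
| triangle:
    "\<lbrakk>d \<in> darts D; face_step D (face_step D (face_step D d)) = d;
      P = {fst d, fst (face_step D d), fst (face_step D (face_step D d))};
      card (fst ` (P \<union> nxt D ` P)) = 3;
      (\<forall>p \<in> P \<union> nxt D ` P. \<not> is_virt D p) \<and> (\<exists>p \<in> P. is_over D p \<and> is_over D (nxt D p))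
      \<or> (\<exists>p \<in> P. is_virt D p \<and> is_virt D (nxt D p))\<rbrakk>
     \<Longrightarrow> reidemeister D (swap_along P D)"

definition moves :: "(diagram \<times> diagram) set" where
  "moves = {(D, D'). virtual_diagram D \<and> virtual_diagram D' \<and>
     (isotopic D D' \<or> reidemeister D D')}"

definition virtual_equiv :: "(diagram \<times> diagram) set" where
  "virtual_equiv = (moves \<union> moves\<inverse>)\<^sup>*"

definition virtual_links :: "diagram set set" where
  "virtual_links = {D. virtual_diagram D} // virtual_equiv"

definition virtual_number :: "diagram set \<Rightarrow> nat" where
  "virtual_number K = (LEAST n. \<exists>D \<in> K. num_virtual D = n)"


section \<open>Laurent polynomials\<close>

text \<open>\<open>Vz i\<close> belongs to component \<open>i + 1\<close>, and \<open>Vw {i, j}\<close> to components \<open>i + 1\<close> and \<open>j + 1\<close>.\<close>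

datatype lvar = Vs | Vt | Valpha | Vz nat | Vw "nat set"

text \<open>The group ring over the integers of the free abelian group of Laurent monomials.\<close>

type_synonym laurent = "(lvar \<Rightarrow>\<^sub>0 int) \<Rightarrow>\<^sub>0 int"

definition vpow :: "lvar \<Rightarrow> int \<Rightarrow> laurent" where
  "vpow v a = Poly_Mapping.single (Poly_Mapping.single v a) 1"

definition alpha_exponents :: "laurent \<Rightarrow> int set" where
  "alpha_exponents f = (\<lambda>m. Poly_Mapping.lookup m Valpha) ` Poly_Mapping.keys f"

definition e_max :: "laurent \<Rightarrow> int" where
  "e_max f = (if f = 0 then 0 else Max (alpha_exponents f))"

definition e_min :: "laurent \<Rightarrow> int" where
  "e_min f = (if f = 0 then 0 else Min (alpha_exponents f))"


section \<open>The polynomials\<close>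

text \<open>
  A relation at a passage is given by a pair \<open>(a, b)\<close>: the arc leaving it equals
  \<open>a\<close> times the incoming arc of the same strand plus \<open>b\<close> times the incoming arc
  of the other strand of the crossing.
\<close>

type_synonym relation = "laurent \<times> laurent"

definition sign_of :: "diagram \<Rightarrow> passage \<Rightarrow> int" where
  "sign_of D p = (case kind_of D (fst p) of Pos \<Rightarrow> 1 | Neg \<Rightarrow> -1 | Virt \<Rightarrow> 0)"

definition rel_B :: "diagram \<Rightarrow> passage \<Rightarrow> relation" where
  "rel_B D p = (let e = sign_of D p in
     if is_over D p then (vpow Vs e, 0) else (vpow Vt e, 1 - vpow Vs e * vpow Vt e))"

definition rel_C :: "lvar \<Rightarrow> diagram \<Rightarrow> passage \<Rightarrow> relation" where
  "rel_C y D p = (let e = sign_of D p in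
     if is_over D p then (vpow y e, 0) else (vpow y (- e), 0))"

definition rel_V :: "passage \<Rightarrow> relation" where
  "rel_V p = (case snd p of SW \<Rightarrow> (vpow Valpha 1, 0) | SE \<Rightarrow> (vpow Valpha (- 1), 0))"

definition comp_of :: "diagram \<Rightarrow> passage \<Rightarrow> nat" where
  "comp_of D p = (THE i. i < length (comps D) \<and> p \<in> set (comps D ! i))"

definition self_word :: "diagram \<Rightarrow> nat \<Rightarrow> passage list" where
  "self_word D i =
     filter (\<lambda>p. \<not> is_virt D p \<and> opp p \<in> set (comps D ! i)) (comps D ! i)"

text \<open>The base point of the word is irrelevant here because a self-word has even length.\<close>

definition even_self_crossing :: "diagram \<Rightarrow> nat \<Rightarrow> nat \<Rightarrow> bool" where
  "even_self_crossing D i c \<longleftrightarrow>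
     (\<exists>xs p ys zs. fst p = c \<and> self_word D i = xs @ p # ys @ opp p # zs \<and> even (length ys))"

definition sawollek_rel :: "diagram \<Rightarrow> passage \<Rightarrow> relation" where
  "sawollek_rel D p = (if is_virt D p then rel_V p else rel_B D p)"

definition parity_rel :: "diagram \<Rightarrow> passage \<Rightarrow> relation" where
  "parity_rel D p = (let i = comp_of D p; j = comp_of D (opp p) in
     if is_virt D p then rel_V p
     else if i \<noteq> j then rel_C (Vw {i, j}) D p
     else if even_self_crossing D i (fst p) then rel_B D p
     else rel_C (Vz i) D p)"

text \<open>\<open>Out p\<close> is the arc that leaves passage \<open>p\<close>; \<open>Loop i\<close> is the arc of a component without crossings.\<close>

datatype arc = Out passage | Loop nat

definition arcs :: "diagram \<Rightarrow> arc list" where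
  "arcs D = concat (map (\<lambda>i. if comps D ! i = [] then [Loop i] else map Out (comps D ! i))
                        [0..<length (comps D)])"

text \<open>The coefficient of arc \<open>x\<close> in the right-hand side of the relation with the given left-hand side.\<close>

fun coeff_at :: "(diagram \<Rightarrow> passage \<Rightarrow> relation) \<Rightarrow> diagram \<Rightarrow> arc \<Rightarrow> arc \<Rightarrow> laurent" where
  "coeff_at rel D (Out p) x =
     (if x = Out (prv D p) then fst (rel D p) else 0) +
     (if x = Out (prv D (opp p)) then snd (rel D p) else 0)"
| "coeff_at rel D (Loop i) x = (if x = Loop i then 1 else 0)"

definition rel_matrix :: "(diagram \<Rightarrow> passage \<Rightarrow> relation) \<Rightarrow> diagram \<Rightarrow> laurent mat" where
  "rel_matrix rel D = (let n = length (arcs D) in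
     mat n n (\<lambda>(i, j). coeff_at rel D (arcs D ! i) (arcs D ! j)))"

definition diagram_poly :: "(diagram \<Rightarrow> passage \<Rightarrow> relation) \<Rightarrow> diagram \<Rightarrow> laurent" where
  "diagram_poly rel D = det (rel_matrix rel D - 1\<^sub>m (length (arcs D)))"

text \<open>
  The polynomial of a link is defined only up to multiplication by \<open>\<plusminus> s^a t^b\<close>; the
  following set consists of all its representatives, computed from all diagrams of the link.
\<close>

definition link_poly :: "(diagram \<Rightarrow> passage \<Rightarrow> relation) \<Rightarrow> diagram set \<Rightarrow> laurent set" where
  "link_poly rel K =
     {u * vpow Vs a * vpow Vt b * diagram_poly rel D |u a b D. u \<in> {1, - 1} \<and> D \<in> K}"

definition alpha_sawollek :: "diagram set \<Rightarrow> laurent set" where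
  "alpha_sawollek = link_poly sawollek_rel"

definition alpha_parity_alexander :: "diagram set \<Rightarrow> laurent set" where
  "alpha_parity_alexander = link_poly parity_rel"

end

theory Submission
  imports Defs
begin

text \<open>
  In the matrix of a diagram with \<open>n\<close> virtual crossings, only \<open>n\<close> rows contain \<open>\<alpha>\<close> and
  only \<open>n\<close> rows contain \<open>\<alpha>\<^sup>-\<^sup>1\<close>, so the exponents of \<open>\<alpha>\<close> in the determinant lie in
  \<open>[-n, n]\<close>.  Multiplication by \<open>\<plusminus> s^a t^b\<close> does not change them, hence it suffices that the
  determinant is invariant up to such a factor, and to compare with a diagram that has the minimal number of
  virtual crossings.  For the invariance, every move is reduced to linear algebra by eliminating the arcs
  inside the monogon, bigon or triangle.  The relation (C) for \<open>y\<close> does not depend on which strand is over: it is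
  (V) with \<open>\<alpha>\<close> replaced by \<open>y\<close>.  Both polynomials are therefore instances of
  one construction, in which each crossing carries (B) or (V) with some variable.  For parities, the point is that a
  triangle whose three crossings are self-crossings of the same component has an even number of odd ones.
\<close>

section \<open>Determinants indexed by finite sets\<close>

text \<open>Deletions and renamings of passages change the index set of the matrix, so determinants
  are indexed by sets. Removing a crossing is split in two. In the unchanged diagram its relations
  are replaced by the identity \<open>(1, 0)\<close>: both systems reduce to the same one once the
  inner arcs are eliminated. Then passages with an identity relation are taken out one at a time,
  each at the cost of a sign. A component that loses its last passage becomes a circle; its
  determinant is \<open>0\<close> before and after. A triangle move is seen as a renaming of
  passages that keeps the arcs. In the system reduced by the inner arcs it only negates three flags,
  which say which crossing each strand meets first. Move III thus becomes three polynomial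
  identities, under a constraint on the signs that comes from the turning rule for faces. Parity is
  a global property of a cyclic word. A two-colouring makes it local: it is enough to recolour the
  passages near the face of the move.\<close>

definition ldet :: "'a list \<Rightarrow> ('a \<Rightarrow> 'a \<Rightarrow> 'b::comm_ring_1) \<Rightarrow> 'b" where
  "ldet xs A = det (mat (length xs) (length xs) (\<lambda>(i, j). A (xs ! i) (xs ! j)))"

definition sdet :: "'a set \<Rightarrow> ('a \<Rightarrow> 'a \<Rightarrow> 'b::comm_ring_1) \<Rightarrow> 'b" where
  "sdet S A = ldet (SOME xs. distinct xs \<and> set xs = S) A"

lemma ldet_cong:
  assumes "\<And>x y. x \<in> set xs \<Longrightarrow> y \<in> set xs \<Longrightarrow> A x y = B x y"
  shows "ldet xs A = ldet xs B"
  unfolding ldet_def by (rule arg_cong[where f = det], rule eq_matI) (auto simp: assms)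

lemma ldet_map: "ldet (map f xs) A = ldet xs (\<lambda>x y. A (f x) (f y))"
  unfolding ldet_def by (rule arg_cong[where f = det], rule eq_matI) auto

text \<open>Rows and columns are permuted by the same \<open>p\<close>, so the two signs cancel.
  Hence \<open>sdet\<close> does not depend on the enumeration picked by
  \<open>SOME\<close>.\<close>

lemma ldet_permute:
  assumes "distinct xs" "distinct ys" "set xs = set ys"
  shows "ldet xs A = ldet ys A"
proof -
  define n where "n = length ys"
  have m: "mset xs = mset ys" using assms by (simp add: set_eq_iff_mset_eq_distinct)
  then obtain p where p: "p permutes {..<length ys}" "permute_list p ys = xs"
    by (rule mset_eq_permutation)
  have len: "length xs = n" using mset_eq_length[OF m] n_def by simp
  have p': "p permutes {0..<n}" using p(1) n_def by (simp add: atLeast0LessThan)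
  have nth: "xs ! i = ys ! p i" if "i < n" for i
    using p that by (metis n_def permute_list_nth)
  have pn: "p i < n" if "i < n" for i using permutes_in_image[OF p', of i] that by simp
  define Y where "Y = mat n n (\<lambda>(i, j). A (ys ! i) (ys ! j))"
  define Z where "Z = mat n n (\<lambda>(i, j). Y $$ (p i, j))"
  have Y: "Y \<in> carrier_mat n n" and Z: "Z \<in> carrier_mat n n" by (auto simp: Y_def Z_def)
  have ZT: "transpose_mat Z \<in> carrier_mat n n" using Z by simp
  \<comment> \<open>The columns are permuted as the rows of a transpose.\<close>
  have "mat n n (\<lambda>(i, j). A (xs ! i) (xs ! j))
      = transpose_mat (mat n n (\<lambda>(i, j). transpose_mat Z $$ (p i, j)))"
    by (rule eq_matI) (auto simp: Z_def Y_def nth pn)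
  then have "ldet xs A = det (transpose_mat (mat n n (\<lambda>(i, j). transpose_mat Z $$ (p i, j))))"
    by (simp add: ldet_def len)
  also have "\<dots> = det (mat n n (\<lambda>(i, j). transpose_mat Z $$ (p i, j)))"
    by (rule det_transpose) auto
  also have "\<dots> = signof p * det (transpose_mat Z)" by (rule det_permute_rows[OF ZT p'])
  also have "\<dots> = signof p * det Z" by (simp add: det_transpose[OF Z])
  also have "det Z = signof p * det Y" unfolding Z_def by (rule det_permute_rows[OF Y p'])
  also have "signof p * (signof p * det Y) = det Y"
    by (simp add: sign_def)
  finally show ?thesis by (simp add: Y_def ldet_def n_def)
qed

lemma sdet_list:
  assumes "distinct xs"
  shows "sdet (set xs) A = ldet xs A"
proof -
  let ?ys = "SOME ys. distinct ys \<and> set ys = set xs"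
  have "distinct ?ys \<and> set ?ys = set xs" by (rule someI[of _ xs]) (simp add: assms)
  with assms show ?thesis unfolding sdet_def by (intro ldet_permute) auto
qed

lemma sdet_cong:
  assumes "finite S" "\<And>x y. x \<in> S \<Longrightarrow> y \<in> S \<Longrightarrow> A x y = B x y"
  shows "sdet S A = sdet S B"
proof -
  obtain xs where xs: "distinct xs" "set xs = S" using finite_distinct_list[OF assms(1)] by blast
  have "ldet xs A = ldet xs B" by (rule ldet_cong) (auto simp: assms xs)
  then show ?thesis using sdet_list[OF xs(1), of A] sdet_list[OF xs(1), of B] by (simp add: xs)
qed

lemma sdet_image:
  assumes "finite S" "inj_on f S"
  shows "sdet (f ` S) A = sdet S (\<lambda>x y. A (f x) (f y))"
proof -
  obtain xs where xs: "distinct xs" "set xs = S" using finite_distinct_list[OF assms(1)] by blast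
  have "distinct (map f xs)" using xs assms(2) by (simp add: distinct_map)
  from sdet_list[OF this, of A] sdet_list[OF xs(1), of "\<lambda>x y. A (f x) (f y)"] show ?thesis
    by (simp add: xs ldet_map)
qed

lemma ldet_zero_row:
  assumes "e \<in> set xs" "\<And>y. y \<in> set xs \<Longrightarrow> A e y = 0"
  shows "ldet xs A = 0"
proof -
  obtain k where k: "k < length xs" "xs ! k = e" using assms(1) by (metis in_set_conv_nth)
  let ?n = "length xs"
  let ?B = "mat ?n ?n (\<lambda>(i, j). A (xs ! i) (xs ! j))"
  have z: "(\<Prod>i = 0..<?n. ?B $$ (i, p i)) = 0" if p: "p permutes {0..<?n}" for p
  proof (rule prod_zero)
    have "p k < ?n" using permutes_in_image[OF p, of k] k by simp
    then show "\<exists>i\<in>{0..<?n}. ?B $$ (i, p i) = 0" using k assms(2) by (intro bexI[of _ k]) auto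
  qed simp
  show ?thesis unfolding ldet_def
    by (subst det_def'[of _ ?n], simp, rule sum.neutral) (use z in auto)
qed

lemma sdet_zero_row:
  assumes "finite S" "e \<in> S" "\<And>y. y \<in> S \<Longrightarrow> A e y = 0"
  shows "sdet S A = 0"
proof -
  obtain xs where xs: "distinct xs" "set xs = S" using finite_distinct_list[OF assms(1)] by blast
  show ?thesis using sdet_list[OF xs(1), of A] ldet_zero_row[of e xs A] assms xs by simp
qed

text \<open>Solving relation \<open>e\<close> for the variable \<open>e\<close> and substituting it
  elsewhere: the pivot factors out and the Schur complement remains. The inverse \<open>v\<close> of
  the pivot is passed explicitly because the ring is not a field.\<close>

lemma ldet_schur:
  assumes d: "distinct (e # xs)" and v: "A e e * v = 1"
  shows "ldet (e # xs) A = A e e * ldet xs (\<lambda>x y. A x y - A x e * v * A e y)"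
proof -
  let ?xs = "e # xs"
  let ?n = "length ?xs"
  let ?X = "\<lambda>i. ?xs ! i"
  define M where "M = mat ?n ?n (\<lambda>(i, j). A (?X i) (?X j))"
  \<comment> \<open>Left multiplication by the unitriangular \<open>L\<close> subtracts from each
    later row the multiple of row \<open>0\<close> that clears its first entry.\<close>
  define L where "L = mat ?n ?n (\<lambda>(i, j). if i = j then 1 else if j = 0 then - A (?X i) e * v else 0)"
  define B where "B = mat ?n ?n (\<lambda>(i, j). if i = 0 then A e (?X j)
    else A (?X i) (?X j) - A (?X i) e * v * A e (?X j))"
  have M: "M \<in> carrier_mat ?n ?n" and L: "L \<in> carrier_mat ?n ?n" and B: "B \<in> carrier_mat ?n ?n"
    by (auto simp: M_def L_def B_def)
  have dL: "det L = 1"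
  proof -
    have "det L = prod_list (diag_mat L)"
      by (rule det_lower_triangular[OF _ L]) (auto simp: L_def)
    also have "diag_mat L = replicate ?n 1"
      by (rule nth_equalityI) (auto simp: diag_mat_def L_def simp del: replicate_Suc upt_Suc)
    also have "prod_list (replicate k 1) = (1::'b)" for k
      by (induction k) auto
    finally show ?thesis .
  qed
  have "L * M = B"
  proof (rule eq_matI)
    fix i j assume "i < dim_row B" "j < dim_col B"
    then have i: "i < ?n" and j: "j < ?n" by (auto simp: B_def)
    have "(L * M) $$ (i, j) = (\<Sum>k = 0..<?n. L $$ (i, k) * M $$ (k, j))"
      using i j L M by (simp add: scalar_prod_def)
    also have "\<dots> = (\<Sum>k\<in>{0, i}. L $$ (i, k) * M $$ (k, j))"
      by (rule sum.mono_neutral_right) (use i in \<open>auto simp: L_def\<close>)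
    also have "\<dots> = B $$ (i, j)"
      using i j by (cases "i = 0") (auto simp: L_def M_def B_def)
    finally show "(L * M) $$ (i, j) = B $$ (i, j)" .
  qed (use L M B in auto)
  then have "det M = det B" using det_mult[OF L M] dL by simp
  also have "det B = (\<Sum>i<?n. B $$ (i, 0) * cofactor B i 0)"
    by (rule laplace_expansion_column[OF B]) simp
  also have "\<dots> = (\<Sum>i\<in>{0}. B $$ (i, 0) * cofactor B i 0)"
  proof (rule sum.mono_neutral_right; (simp; fail)?; intro ballI)
    fix i assume "i \<in> {..<?n} - {0}"
    then have "B $$ (i, 0) = A (?X i) e - A (?X i) e * (A e e * v)" by (simp add: B_def ac_simps)
    then show "B $$ (i, 0) * cofactor B i 0 = 0" by (simp add: v)
  qed
  also have "\<dots> = A e e * det (mat_delete B 0 0)"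
    by (simp add: B_def cofactor_def)
  also have "mat_delete B 0 0
      = mat (length xs) (length xs) (\<lambda>(i, j). A (xs ! i) (xs ! j) - A (xs ! i) e * v * A e (xs ! j))"
    by (rule eq_matI) (auto simp: mat_delete_def B_def)
  finally show ?thesis by (simp add: ldet_def M_def)
qed

lemma sdet_schur:
  assumes "finite S" "e \<in> S" and v: "A e e * v = 1"
  shows "sdet S A = A e e * sdet (S - {e}) (\<lambda>x y. A x y - A x e * v * A e y)"
proof -
  obtain xs where xs: "distinct xs" "set xs = S - {e}"
    using finite_distinct_list[of "S - {e}"] assms(1) by blast
  have d: "distinct (e # xs)" and s: "set (e # xs) = S" using xs assms(2) by auto
  show ?thesis using ldet_schur[OF d, of A, OF v] sdet_list[OF d, of A]
      sdet_list[OF xs(1), of "\<lambda>x y. A x y - A x e * v * A e y"]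
    by (simp only: s xs(2))
qed

text \<open>
  \<open>G e\<close> is the row of the inner variable \<open>e\<close> after substituting the inner variables into each
  other; the order of the list makes this substitution terminate.
\<close>

lemma sdet_eliminate:
  fixes M :: "'a \<Rightarrow> 'a \<Rightarrow> 'b::comm_ring_1"
  assumes "finite S" "distinct es" "set es \<subseteq> S"
    and "sorted_wrt (\<lambda>e e'. M e e' = 0) es" "\<forall>e \<in> set es. M e e = 0"
    and "\<And>e y. e \<in> set es \<Longrightarrow> y \<in> S - set es \<Longrightarrow> G e y = M e y + (\<Sum>i\<leftarrow>es. M e i * G i y)"
  shows "sdet S (\<lambda>x y. M x y - of_bool (x = y))
    = (-1) ^ length es *
      sdet (S - set es) (\<lambda>x y. M x y + (\<Sum>i\<leftarrow>es. M x i * G i y) - of_bool (x = y))"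
  using assms
proof (induction es arbitrary: S M)
  case Nil
  then show ?case by simp
next
  case (Cons e es)
  \<comment> \<open>The pivot is \<open>M e e - 1 = -1\<close>, so this elimination costs a sign and
    simply substitutes row \<open>e\<close>. Row \<open>e\<close> vanishes on the remaining inner
    variables, hence their columns are the same in \<open>M'\<close> and \<open>M\<close>.\<close>
  define M' where "M' = (\<lambda>x y. M x y + M x e * M e y)"
  have fin: "finite (S - {e})" using Cons.prems(1) by simp
  have eS: "e \<in> S" and ee: "M e e = 0" using Cons.prems by auto
  have e0: "M e i = 0" if "i \<in> set es" for i using Cons.prems(4) that by simp
  have z: "(\<Sum>i\<leftarrow>es. M e i * G i y) = 0" for y
    using e0 by (induction es) auto
  have Ge: "G e y = M e y" if "y \<in> S - set (e # es)" for y
    using Cons.prems(6)[of e y] that ee z by simp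
  have s: "(\<Sum>i\<leftarrow>es. M' x i * G i y) = (\<Sum>i\<leftarrow>es. M x i * G i y)" for x y
    using e0 by (intro arg_cong[where f = sum_list] map_cong) (auto simp: M'_def)
  have ee': "(M e e - of_bool (e = e)) * (-1) = 1" by (simp add: ee)
  have "sdet S (\<lambda>x y. M x y - of_bool (x = y))
      = - sdet (S - {e}) (\<lambda>x y. M x y - of_bool (x = y)
          - (M x e - of_bool (x = e)) * (-1) * (M e y - of_bool (e = y)))"
    by (subst sdet_schur[where e = e and v = "-1"]) (use Cons.prems(1) eS ee in auto)
  also have "\<dots> = - sdet (S - {e}) (\<lambda>x y. M' x y - of_bool (x = y))"
    by (intro arg_cong[where f = uminus] sdet_cong fin) (auto simp: M'_def)
  also have "sdet (S - {e}) (\<lambda>x y. M' x y - of_bool (x = y)) = (-1) ^ length es *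
      sdet (S - {e} - set es) (\<lambda>x y. M' x y + (\<Sum>i\<leftarrow>es. M' x i * G i y) - of_bool (x = y))"
  proof (rule Cons.IH[OF fin])
    show "sorted_wrt (\<lambda>e e'. M' e e' = 0) es"
      by (rule sorted_wrt_mono_rel[of es "\<lambda>e e'. M e e' = 0"]) (use Cons.prems(4) in \<open>simp_all add: M'_def e0\<close>)
    show "\<forall>e\<in>set es. M' e e = 0" using Cons.prems(5) e0 by (auto simp: M'_def)
    show "G e' y = M' e' y + (\<Sum>i\<leftarrow>es. M' e' i * G i y)"
      if "e' \<in> set es" "y \<in> S - {e} - set es" for e' y
      unfolding s using Cons.prems(6)[of e' y] Ge[of y] that by (simp add: M'_def)
  qed (use Cons.prems in auto)
  also have "S - {e} - set es = S - set (e # es)" by auto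
  also have "sdet (S - set (e # es)) (\<lambda>x y. M' x y + (\<Sum>i\<leftarrow>es. M' x i * G i y) - of_bool (x = y))
      = sdet (S - set (e # es)) (\<lambda>x y. M x y + (\<Sum>i\<leftarrow>e # es. M x i * G i y) - of_bool (x = y))"
  proof (rule sdet_cong)
    fix x y assume "x \<in> S - set (e # es)" "y \<in> S - set (e # es)"
    then show "M' x y + (\<Sum>i\<leftarrow>es. M' x i * G i y) - of_bool (x = y)
        = M x y + (\<Sum>i\<leftarrow>e # es. M x i * G i y) - of_bool (x = y)"
      unfolding s by (simp add: M'_def Ge)
  qed (use Cons.prems(1) in simp)
  finally show ?case by simp
qed

section \<open>The successor relation of a diagram\<close>

text \<open>As a set of pairs, the cyclic successor relation has no base point: rotations leave it
  fixed, and renaming or deleting a letter acts on it directly. A one-letter word gives the pair of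
  that letter with itself.\<close>

definition cpairs :: "'a list \<Rightarrow> ('a \<times> 'a) set" where
  "cpairs w = set (zip w (rotate1 w))"

lemma cpairs_Nil [simp]: "cpairs [] = {}"
  by (simp add: cpairs_def)

lemma cpairs_map: "cpairs (map f w) = map_prod f f ` cpairs w"
  by (simp add: cpairs_def rotate1_map zip_map_map map_prod_def)

lemma zip_tl_snoc:
  "zs \<noteq> [] \<Longrightarrow> set (zip zs (tl zs @ [z])) = insert (last zs, z) (set (zip zs (tl zs)))"
proof (induction zs)
  case (Cons a zs)
  then show ?case by (cases zs) auto
qed simp

lemma cpairs_Cons:
  "zs \<noteq> [] \<Longrightarrow> cpairs (e # zs) = {(e, hd zs), (last zs, e)} \<union> set (zip zs (tl zs))"
  using zip_tl_snoc[of zs e] by (cases zs) (auto simp: cpairs_def)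

lemma cpairs_conv:
  "zs \<noteq> [] \<Longrightarrow> cpairs zs = insert (last zs, hd zs) (set (zip zs (tl zs)))"
  using zip_tl_snoc[of zs "hd zs"] by (cases zs) (auto simp: cpairs_def)

lemma cpairs_rotate1: "cpairs (rotate1 w) = cpairs w"
proof (cases w)
  case (Cons x zs)
  have "zs \<noteq> [] \<Longrightarrow> set (zip (zs @ [x]) (tl zs @ [x])) = insert (last zs, x) (set (zip zs (tl zs)))"
  proof (induction zs)
    case (Cons a zs)
    then show ?case by (cases zs) auto
  qed simp
  then show ?thesis using Cons cpairs_Cons[of zs x] cpairs_conv[of "zs @ [x]"]
    by (cases "zs = []") auto
qed simp

lemma cpairs_rotate: "cpairs (rotate n w) = cpairs w"
  by (induction n) (simp_all add: cpairs_rotate1)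

lemma cpairs_append_commute: "cpairs (us @ vs) = cpairs (vs @ us)"
  using cpairs_rotate[of "length us" "us @ vs"] by (simp add: rotate_append)

lemma cpairs_sets:
  assumes "(x, y) \<in> cpairs w"
  shows "x \<in> set w" "y \<in> set w"
  using assms unfolding cpairs_def by (auto dest: set_zip_leftD set_zip_rightD)

text \<open>After rotating \<open>e\<close> to the front, the rest is a linear word
  \<open>zs\<close> joined to \<open>e\<close> by a pair at each end; deleting \<open>e\<close>
  replaces these two pairs by the single pair from the last to the first letter of
  \<open>zs\<close>.\<close>

lemma cpairs_remove:
  assumes "distinct w" "e \<in> set w"
  shows "(x, y) \<in> cpairs (filter (\<lambda>p. p \<noteq> e) w) \<longleftrightarrow>
    x \<noteq> e \<and> y \<noteq> e \<and> ((x, y) \<in> cpairs w \<or> (x, e) \<in> cpairs w \<and> (e, y) \<in> cpairs w)"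
proof -
  obtain us vs where w: "w = us @ e # vs" using assms(2) by (meson split_list)
  define zs where "zs = vs @ us"
  have e: "e \<notin> set zs" using assms(1) by (auto simp: w zs_def)
  have "filter (\<lambda>p. p \<noteq> e) w = us @ vs"
    using assms(1) unfolding w by (auto simp: filter_id_conv intro!: arg_cong2[where f = append])
  then have 1: "cpairs (filter (\<lambda>p. p \<noteq> e) w) = cpairs zs"
    by (simp add: zs_def cpairs_append_commute)
  have 2: "cpairs w = cpairs (e # zs)"
    unfolding w zs_def by (subst cpairs_append_commute) simp
  show ?thesis
  proof (cases "zs = []")
    case True
    then show ?thesis unfolding 1 2 by (auto simp: cpairs_def)
  next
    case False
    have "hd zs \<noteq> e" "last zs \<noteq> e" using e False by (auto dest: hd_in_set last_in_set)
    moreover have "a \<noteq> e \<and> b \<noteq> e" if "(a, b) \<in> set (zip zs (tl zs))" for a b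
      using set_zip_leftD[OF that] set_zip_rightD[OF that] e False by (metis list.set_sel(2))
    ultimately show ?thesis
      unfolding 1 2 cpairs_Cons[OF False] cpairs_conv[OF False] by auto
  qed
qed

definition succs :: "diagram \<Rightarrow> (passage \<times> passage) set" where
  "succs D = (\<Union>w \<in> set (comps D). cpairs w)"

lemma set_succ_table: "set (succ_table D) = succs D"
  by (simp add: succ_table_def succs_def cpairs_def)

lemma map_fst_succ_table: "map fst (succ_table D) = concat (comps D)"
proof -
  have "map fst (zip w (rotate1 w)) = w" for w :: "passage list" by simp
  then show ?thesis by (simp add: succ_table_def map_concat comp_def)
qed

lemma map_snd_succ_table: "map snd (succ_table D) = concat (map rotate1 (comps D))"
proof -
  have "map snd (zip w (rotate1 w)) = rotate1 w" for w :: "passage list" by simp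
  then show ?thesis by (simp add: succ_table_def map_concat comp_def)
qed

lemma distinct_concat_rotate1:
  "distinct (concat ws) \<Longrightarrow> distinct (concat (map rotate1 ws))"
  by (induction ws) auto

definition simple :: "diagram \<Rightarrow> bool" where
  "simple D \<longleftrightarrow> distinct (concat (comps D))"

lemma passages_UN: "passages D = (\<Union>w \<in> set (comps D). set w)"
  by (simp add: passages_def)

lemma finite_passages [simp]: "finite (passages D)"
  by (simp add: passages_def)

lemma nxt_eqI: "simple D \<Longrightarrow> (x, y) \<in> succs D \<Longrightarrow> nxt D x = y"
  unfolding nxt_def simple_def
  by (subst map_of_is_SomeI[of "succ_table D" x y]) (simp_all add: map_fst_succ_table set_succ_table)

lemma prv_eqI:
  assumes "simple D" "(x, y) \<in> succs D"
  shows "prv D y = x"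
proof -
  have "distinct (map fst (map prod.swap (succ_table D)))"
    using distinct_concat_rotate1[of "comps D"] assms(1)
    by (simp add: simple_def comp_def map_snd_succ_table[symmetric])
  moreover have "(y, x) \<in> set (map prod.swap (succ_table D))"
    using assms(2) by (force simp: set_succ_table)
  ultimately show ?thesis unfolding prv_def by (subst map_of_is_SomeI) auto
qed

lemma cpairs_total:
  assumes "x \<in> set w"
  shows "\<exists>y. (x, y) \<in> cpairs w" "\<exists>y. (y, x) \<in> cpairs w"
proof -
  have "fst ` cpairs w = set w"
    unfolding cpairs_def set_map[symmetric] by simp
  then show "\<exists>y. (x, y) \<in> cpairs w" using assms by force
  have "snd ` cpairs w = set w"
    unfolding cpairs_def set_map[symmetric] by simp
  then show "\<exists>y. (y, x) \<in> cpairs w" using assms by force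
qed

lemma succs_nxt: "simple D \<Longrightarrow> x \<in> passages D \<Longrightarrow> (x, nxt D x) \<in> succs D"
  using cpairs_total(1)[of x] nxt_eqI[of D] unfolding passages_UN succs_def by blast

lemma succs_prv: "simple D \<Longrightarrow> x \<in> passages D \<Longrightarrow> (prv D x, x) \<in> succs D"
  using cpairs_total(2)[of x] prv_eqI[of D] unfolding passages_UN succs_def by blast

lemma succs_passages:
  "(x, y) \<in> succs D \<Longrightarrow> x \<in> passages D"
  "(x, y) \<in> succs D \<Longrightarrow> y \<in> passages D"
  by (auto simp: succs_def passages_UN dest: cpairs_sets)

lemma nxt_passages: "simple D \<Longrightarrow> x \<in> passages D \<Longrightarrow> nxt D x \<in> passages D"
  using succs_nxt succs_passages by blast

lemma prv_passages: "simple D \<Longrightarrow> x \<in> passages D \<Longrightarrow> prv D x \<in> passages D"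
  using succs_prv succs_passages by blast

lemma nxt_prv: "simple D \<Longrightarrow> x \<in> passages D \<Longrightarrow> nxt D (prv D x) = x"
  by (rule nxt_eqI[OF _ succs_prv])

lemma prv_nxt: "simple D \<Longrightarrow> x \<in> passages D \<Longrightarrow> prv D (nxt D x) = x"
  by (rule prv_eqI[OF _ succs_nxt])

lemma succs_iff: "simple D \<Longrightarrow> (x, y) \<in> succs D \<longleftrightarrow> x \<in> passages D \<and> nxt D x = y"
  using succs_nxt succs_passages nxt_eqI by blast

lemma nxt_inj: "simple D \<Longrightarrow> x \<in> passages D \<Longrightarrow> y \<in> passages D \<Longrightarrow> nxt D x = nxt D y \<longleftrightarrow> x = y"
  by (metis prv_nxt)

lemma simple_word: "simple D \<Longrightarrow> w \<in> set (comps D) \<Longrightarrow> distinct w"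
  by (auto simp: simple_def distinct_concat_iff)

lemma simple_words_disjoint:
  assumes "simple D" "i < length (comps D)" "j < length (comps D)"
    "x \<in> set (comps D ! i)" "x \<in> set (comps D ! j)"
  shows "i = j"
proof (rule ccontr)
  assume "i \<noteq> j"
  moreover have "distinct (concat ws) \<Longrightarrow> i < j \<Longrightarrow> j < length ws \<Longrightarrow> set (ws ! i) \<inter> set (ws ! j) = {}"
    for ws :: "passage list list" and i j
  proof (induction ws arbitrary: i j)
    case (Cons w ws)
    then show ?case by (cases i; cases j) (auto, blast dest: nth_mem)
  qed simp
  ultimately show False using assms unfolding simple_def by (metis disjoint_iff linorder_neqE_nat)
qed

lemma comp_of_eqI:
  "simple D \<Longrightarrow> i < length (comps D) \<Longrightarrow> x \<in> set (comps D ! i) \<Longrightarrow> comp_of D x = i"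
  unfolding comp_of_def by (rule the_equality) (auto intro: simple_words_disjoint)

lemma comp_of:
  assumes "simple D" "x \<in> passages D"
  shows "comp_of D x < length (comps D)" "x \<in> set (comps D ! comp_of D x)"
proof -
  obtain i where i: "i < length (comps D)" "x \<in> set (comps D ! i)"
    using assms(2) by (metis UN_E in_set_conv_nth passages_UN)
  then have "comp_of D x = i" by (rule comp_of_eqI[OF assms(1)])
  with i show "comp_of D x < length (comps D)" "x \<in> set (comps D ! comp_of D x)" by simp_all
qed

lemma comp_of_iff:
  "simple D \<Longrightarrow> x \<in> passages D \<Longrightarrow> i < length (comps D) \<Longrightarrow> x \<in> set (comps D ! i) \<longleftrightarrow> comp_of D x = i"
  using comp_of comp_of_eqI by blast

lemma comp_of_succs:
  assumes "simple D" "(x, y) \<in> succs D"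
  shows "comp_of D x = comp_of D y"
proof -
  obtain i where "i < length (comps D)" "(x, y) \<in> cpairs (comps D ! i)"
    using assms(2) by (auto simp: succs_def in_set_conv_nth)
  then show ?thesis using comp_of_eqI[OF assms(1)] cpairs_sets by metis
qed

section \<open>Determinants over passages, and removal of passages with an identity relation\<close>

definition arcmat :: "(passage \<Rightarrow> relation) \<Rightarrow> diagram \<Rightarrow> passage \<Rightarrow> passage \<Rightarrow> laurent" where
  "arcmat r D x y =
     fst (r x) * of_bool (y = prv D x) + snd (r x) * of_bool (y = prv D (opp x))"

text \<open>The value \<open>0\<close> accounts for a loop, whose relation \<open>x = x\<close> is a zero row.\<close>

definition arc_det :: "(passage \<Rightarrow> relation) \<Rightarrow> diagram \<Rightarrow> laurent" where
  "arc_det r D = (if [] \<in> set (comps D) then 0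
     else sdet (passages D) (\<lambda>x y. arcmat r D x y - of_bool (x = y)))"

lemma distinct_arcs:
  assumes "simple D"
  shows "distinct (arcs D)"
proof -
  let ?g = "\<lambda>w i. if w = [] then [Loop i] else map Out w"
  have "distinct (concat ws) \<Longrightarrow> distinct (concat (map (\<lambda>i. ?g (ws ! (i - k)) i) [k..<k + length ws]))"
    for ws :: "passage list list" and k
  proof (induction ws arbitrary: k)
    case (Cons w ws)
    have upt: "[k..<k + length (w # ws)] = k # [Suc k..<Suc k + length ws]"
      by (subst upt_conv_Cons) simp_all
    have m: "map (\<lambda>i. ?g ((w # ws) ! (i - k)) i) [Suc k..<Suc k + length ws]
      = map (\<lambda>i. ?g (ws ! (i - Suc k)) i) [Suc k..<Suc k + length ws]"
      by (rule map_cong) (auto simp: nth_Cons')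
    have ws: "ws ! (i - Suc k) \<in> set ws" if "Suc k \<le> i" "i < Suc k + length ws" for i
      by (rule nth_mem) (use that in auto)
    have "set (?g w k) \<inter> set (concat (map (\<lambda>i. ?g (ws ! (i - Suc k)) i) [Suc k..<Suc k + length ws])) = {}"
      using Cons.prems ws by (fastforce split: if_splits)
    moreover have "distinct (?g w k)"
      using Cons.prems by (auto simp: distinct_map inj_on_def)
    moreover have "distinct (concat (map (\<lambda>i. ?g (ws ! (i - Suc k)) i) [Suc k..<Suc k + length ws]))"
      by (rule Cons.IH) (use Cons.prems in simp)
    moreover have "map (\<lambda>i. ?g ((w # ws) ! (i - k)) i) [k..<k + length (w # ws)]
        = ?g w k # map (\<lambda>i. ?g (ws ! (i - Suc k)) i) [Suc k..<Suc k + length ws]"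
      unfolding upt list.map m by simp
    ultimately show ?case by (simp only: concat.simps distinct_append)
  qed simp
  from this[of "comps D" 0] show ?thesis
    using assms by (simp add: arcs_def simple_def cong: if_cong)
qed

lemma diagram_poly_arc_det:
  assumes "simple D"
  shows "diagram_poly rel D = arc_det (rel D) D"
proof -
  let ?A = "\<lambda>x y. coeff_at rel D x y - of_bool (x = y)"
  have "diagram_poly rel D = ldet (arcs D) ?A"
    unfolding diagram_poly_def ldet_def rel_matrix_def Let_def
    by (rule arg_cong[where f = det], rule eq_matI)
       (use distinct_arcs[OF assms] in \<open>auto simp: nth_eq_iff_index_eq\<close>)
  also have "\<dots> = arc_det (rel D) D"
  proof (cases "[] \<in> set (comps D)")
    case True
    then obtain i where i: "i < length (comps D)" "comps D ! i = []" by (auto simp: in_set_conv_nth)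
    then have "Loop i \<in> set (arcs D)" by (force simp: arcs_def)
    then have "ldet (arcs D) ?A = 0" by (rule ldet_zero_row) auto
    with True show ?thesis by (simp add: arc_det_def)
  next
    case False
    have "arcs D = concat (map (\<lambda>i. map Out (comps D ! i)) [0..<length (comps D)])"
      unfolding arcs_def using False
      by (intro arg_cong[where f = concat] map_cong) (auto dest: nth_mem)
    also have "\<dots> = map Out (concat (map (\<lambda>i. comps D ! i) [0..<length (comps D)]))"
      by (simp add: map_concat comp_def)
    finally have "arcs D = map Out (concat (comps D))" by (simp add: map_nth)
    then have "ldet (arcs D) ?A = sdet (passages D) (\<lambda>x y. coeff_at rel D (Out x) (Out y) - of_bool (x = y))"
      using sdet_list[of "concat (comps D)" "\<lambda>x y. coeff_at rel D (Out x) (Out y) - of_bool (x = y)"]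
        assms unfolding simple_def passages_def
      by (simp add: ldet_map)
    also have "\<dots> = arc_det (rel D) D"
      using False unfolding arc_det_def by (auto simp: arcmat_def intro!: sdet_cong)
    finally show ?thesis .
  qed
  finally show ?thesis .
qed

text \<open>Arcs are eliminated one at a time, so half of a crossing may be gone in between. Hence
  the lemmas on deletion assume only \<open>simple\<close>, and not that passages come in
  pairs.\<close>

definition delete_passages :: "passage set \<Rightarrow> diagram \<Rightarrow> diagram" where
  "delete_passages E D = D\<lparr>comps := map (filter (\<lambda>p. p \<notin> E)) (comps D)\<rparr>"

lemma delete_passages_simps [simp]:
  "comps (delete_passages E D) = map (filter (\<lambda>p. p \<notin> E)) (comps D)"
  "kind_of (delete_passages E D) = kind_of D"
  by (simp_all add: delete_passages_def)

lemma passages_delete_passages [simp]: "passages (delete_passages E D) = passages D - E"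
  by (auto simp: passages_UN)

lemma simple_delete_passages: "simple D \<Longrightarrow> simple (delete_passages E D)"
  by (simp add: simple_def filter_concat[symmetric])

lemma delete_passages_empty: "delete_passages {} D = D"
  by (cases D) (simp add: delete_passages_def map_idI)

lemma delete_passages_insert: "delete_passages (insert e E) D = delete_passages E (delete_passages {e} D)"
  by (auto simp: delete_passages_def filter_filter intro!: filter_cong)

lemma delete_passages_Int: "delete_passages (E \<inter> passages D) D = delete_passages E D"
proof -
  have "map (filter (\<lambda>p. p \<notin> E \<inter> passages D)) (comps D) = map (filter (\<lambda>p. p \<notin> E)) (comps D)"
    by (rule map_cong) (auto simp: passages_UN intro!: filter_cong)
  then show ?thesis by (simp add: delete_passages_def)
qed

lemma delete_crossings_delete_passages: "delete_crossings C D = delete_passages {p \<in> passages D. fst p \<in> C} D"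
proof -
  have "{p \<in> passages D. fst p \<in> C} = {p. fst p \<in> C} \<inter> passages D" by auto
  then show ?thesis by (simp only: delete_passages_Int) (simp add: delete_passages_def delete_crossings_def)
qed

lemma succs_delete_passages1:
  assumes "simple D" "e \<in> passages D"
  shows "(x, y) \<in> succs (delete_passages {e} D) \<longleftrightarrow>
    x \<noteq> e \<and> y \<noteq> e \<and> ((x, y) \<in> succs D \<or> (x, e) \<in> succs D \<and> (e, y) \<in> succs D)"
proof -
  obtain w where w: "w \<in> set (comps D)" "e \<in> set w" using assms(2) by (auto simp: passages_UN)
  have uniq: "v = w" if v: "v \<in> set (comps D)" "e \<in> set v" for v
    using w v simple_words_disjoint[OF assms(1)] by (metis in_set_conv_nth)
  have other: "filter (\<lambda>p. p \<notin> {e}) v = v" if "v \<in> set (comps D)" "v \<noteq> w" for v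
    using uniq that by (auto simp: filter_id_conv)
  have e_pairs: "(x, e) \<in> succs D \<longleftrightarrow> (x, e) \<in> cpairs w" "(e, y) \<in> succs D \<longleftrightarrow> (e, y) \<in> cpairs w"
    unfolding succs_def using w(1) uniq by (blast dest: cpairs_sets)+
  let ?R = "\<exists>v \<in> set (comps D). v \<noteq> w \<and> (x, y) \<in> cpairs v"
  have "(x, y) \<in> succs (delete_passages {e} D) \<longleftrightarrow>
      (\<exists>v \<in> set (comps D). (x, y) \<in> cpairs (filter (\<lambda>p. p \<notin> {e}) v))"
    by (simp add: succs_def)
  also have "\<dots> \<longleftrightarrow> (x, y) \<in> cpairs (filter (\<lambda>p. p \<noteq> e) w) \<or> ?R"
  proof
    assume "\<exists>v \<in> set (comps D). (x, y) \<in> cpairs (filter (\<lambda>p. p \<notin> {e}) v)"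
    then obtain v where v: "v \<in> set (comps D)" "(x, y) \<in> cpairs (filter (\<lambda>p. p \<notin> {e}) v)" ..
    then show "(x, y) \<in> cpairs (filter (\<lambda>p. p \<noteq> e) w) \<or> ?R"
      using other[OF v(1)] by (cases "v = w") auto
  next
    assume "(x, y) \<in> cpairs (filter (\<lambda>p. p \<noteq> e) w) \<or> ?R"
    then show "\<exists>v \<in> set (comps D). (x, y) \<in> cpairs (filter (\<lambda>p. p \<notin> {e}) v)"
    proof
      assume "(x, y) \<in> cpairs (filter (\<lambda>p. p \<noteq> e) w)"
      then show ?thesis using w(1) by (intro bexI[of _ w]) simp_all
    next
      assume ?R
      then obtain v where v: "v \<in> set (comps D)" "v \<noteq> w" "(x, y) \<in> cpairs v" by blast
      show ?thesis by (rule bexI[OF _ v(1)]) (simp only: other[OF v(1,2)] v(3))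
    qed
  qed
  also have "\<dots> \<longleftrightarrow> x \<noteq> e \<and> y \<noteq> e \<and> ((x, y) \<in> succs D \<or> (x, e) \<in> succs D \<and> (e, y) \<in> succs D)"
  proof -
    have "(x, y) \<in> succs D \<longleftrightarrow> (x, y) \<in> cpairs w \<or> ?R"
      unfolding succs_def using w(1) by auto
    moreover have "x \<noteq> e \<and> y \<noteq> e" if ?R
      using that uniq cpairs_sets[of x y] by metis
    ultimately show ?thesis
      unfolding cpairs_remove[OF simple_word[OF assms(1) w(1)] w(2)] e_pairs by argo
  qed
  finally show ?thesis .
qed

lemma prv_delete_passages1:
  assumes "simple D" "e \<in> passages D" "x \<in> passages D" "x \<noteq> e" "prv D e \<noteq> e"
  shows "prv (delete_passages {e} D) x = (if prv D x = e then prv D e else prv D x)"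
proof (rule prv_eqI[OF simple_delete_passages[OF assms(1)]])
  show "(if prv D x = e then prv D e else prv D x, x) \<in> succs (delete_passages {e} D)"
    using assms succs_prv[OF assms(1,2)] succs_prv[OF assms(1,3)]
    by (auto simp: succs_delete_passages1[OF assms(1,2)])
qed

text \<open>Singles out the case in which deleting \<open>e\<close> turns its component into a
  circle without crossings.\<close>

lemma prv_self_singleton:
  assumes "simple D" "e \<in> passages D"
  shows "prv D e = e \<longleftrightarrow> [e] \<in> set (comps D)"
proof
  assume "[e] \<in> set (comps D)"
  moreover have "(e, e) \<in> cpairs [e]" by (simp add: cpairs_def)
  ultimately have "(e, e) \<in> succs D" unfolding succs_def by blast
  then show "prv D e = e" by (rule prv_eqI[OF assms(1)])
next
  assume e: "prv D e = e"
  then have "(e, e) \<in> succs D" using succs_prv[OF assms] by simp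
  then obtain w where w: "w \<in> set (comps D)" "(e, e) \<in> cpairs w" by (auto simp: succs_def)
  have d: "distinct w" by (rule simple_word[OF assms(1) w(1)])
  obtain us vs where "w = us @ e # vs" using w(2) cpairs_sets(1) by (metis split_list)
  then have "(e, e) \<in> cpairs (e # vs @ us)"
    using w(2) cpairs_append_commute[of us "e # vs"] by simp
  moreover have n: "e \<notin> set (vs @ us)" using d \<open>w = us @ e # vs\<close> by auto
  ultimately have "vs @ us = []"
    using cpairs_Cons[of "vs @ us" e]
    by (metis (no_types, lifting) UnE hd_in_set insertE last_in_set prod.inject set_zip_leftD singletonD)
  then show "[e] \<in> set (comps D)" using w(1) \<open>w = us @ e # vs\<close> by simp
qed

text \<open>The relation at \<open>e\<close> identifies the arc \<open>e\<close> with the one before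
  it; eliminating it has pivot \<open>-1\<close> and reroutes \<open>prv\<close> exactly as the
  deletion does. Where the second coefficient is nonzero, the relation also uses the arc entering
  \<open>opp x\<close>, so \<open>opp x\<close> must survive.\<close>

lemma arc_det_delete_passages1:
  assumes D: "simple D" and e: "e \<in> passages D" "r e = (1, 0)"
    and o: "\<And>x. x \<in> passages D \<Longrightarrow> snd (r x) = 0 \<or> opp x \<in> passages D - {e}"
  shows "arc_det r (delete_passages {e} D) = - arc_det r D"
proof (cases "[] \<in> set (comps D)")
  case True
  then have "[] \<in> set (comps (delete_passages {e} D))" by force
  with True show ?thesis by (simp add: arc_det_def)
next
  case ne: False
  show ?thesis
  proof (cases "prv D e = e")
    case True
    then have "[e] \<in> set (comps D)" using prv_self_singleton[OF D e(1)] by simp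
    then have 1: "[] \<in> set (comps (delete_passages {e} D))" by force
    \<comment> \<open>The relation of a component \<open>[e]\<close> reads \<open>e = e\<close>, a
      zero row; after the deletion it is a circle, for which \<open>arc_det\<close> is
      \<open>0\<close> by definition.\<close>
    have "sdet (passages D) (\<lambda>x y. arcmat r D x y - of_bool (x = y)) = 0"
      by (rule sdet_zero_row[of _ e]) (use e True in \<open>auto simp: arcmat_def\<close>)
    then show ?thesis using ne 1 by (simp only: arc_det_def) simp
  next
    case False
    have ne': "[] \<notin> set (comps (delete_passages {e} D))"
    proof
      assume "[] \<in> set (comps (delete_passages {e} D))"
      then obtain w where w: "w \<in> set (comps D)" "filter (\<lambda>p. p \<notin> {e}) w = []" by force
      then have w': "set w \<subseteq> {e}" "w \<noteq> []" using ne by (auto simp: filter_empty_conv)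
      moreover have "distinct w" by (rule simple_word[OF D w(1)])
      ultimately have "w = [e]" using w' by (cases w; cases "tl w") auto
      then show False using w prv_self_singleton[OF D e(1)] False by simp
    qed
    let ?A = "\<lambda>x y. arcmat r D x y - of_bool (x = y)"
    have ee: "?A e e = - 1" using e False by (simp add: arcmat_def)
    have "sdet (passages D) ?A
        = - sdet (passages D - {e}) (\<lambda>x y. ?A x y - ?A x e * (-1) * ?A e y)"
      by (subst sdet_schur[of _ e _ "-1"]) (use e(1) ee in auto)
    also have "sdet (passages D - {e}) (\<lambda>x y. ?A x y - ?A x e * (-1) * ?A e y)
        = sdet (passages D - {e}) (\<lambda>x y. arcmat r (delete_passages {e} D) x y - of_bool (x = y))"
    proof (rule sdet_cong)
      fix x y assume xy: "x \<in> passages D - {e}" "y \<in> passages D - {e}"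
      show "?A x y - ?A x e * (-1) * ?A e y = arcmat r (delete_passages {e} D) x y - of_bool (x = y)"
      proof (cases "snd (r x) = 0")
        case True
        then show ?thesis using xy e(2) prv_delete_passages1[OF D e(1) _ _ False, of x] False
          by (auto simp: arcmat_def)
      next
        case nz: False
        then have "opp x \<in> passages D - {e}" using o[of x] xy by auto
        then show ?thesis using xy e(2) prv_delete_passages1[OF D e(1) _ _ False, of x]
            prv_delete_passages1[OF D e(1) _ _ False, of "opp x"] False
          by (auto simp: arcmat_def)
      qed
    qed simp
    finally show ?thesis using ne ne' by (simp add: arc_det_def)
  qed
qed

lemma arc_det_delete_passages:
  assumes "finite E" "simple D" "E \<subseteq> passages D" "\<And>e. e \<in> E \<Longrightarrow> r e = (1, 0)"
    and "\<And>x. x \<in> passages D \<Longrightarrow> snd (r x) = 0 \<or> opp x \<in> passages D - E"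
  shows "\<exists>u \<in> {1, - 1}. arc_det r D = u * arc_det r (delete_passages E D)"
  using assms
proof (induction E arbitrary: D rule: finite_induct)
  case empty
  then show ?case by (simp add: delete_passages_empty)
next
  case (insert e E)
  have 1: "arc_det r (delete_passages {e} D) = - arc_det r D"
    by (rule arc_det_delete_passages1) (use insert.prems in auto)
  have "\<exists>u \<in> {1, - 1}. arc_det r (delete_passages {e} D) = u * arc_det r (delete_passages E (delete_passages {e} D))"
    by (rule insert.IH) (use insert.prems insert.hyps in \<open>auto simp: simple_delete_passages\<close>)
  then obtain u where u: "u \<in> {1, - 1}" "arc_det r (delete_passages {e} D) = u * arc_det r (delete_passages E (delete_passages {e} D))" by blast
  from u(2) 1 have "arc_det r D = - u * arc_det r (delete_passages E (delete_passages {e} D))"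
    by (metis minus_minus mult_minus_left)
  with u(1) show ?case unfolding delete_passages_insert[of e E] by (intro bexI[of _ "- u"]) auto
qed

section \<open>Powers of a variable, and the units +-s^a t^b\<close>

lemma vpow_add: "vpow v a * vpow v b = vpow v (a + b)"
  by (simp add: vpow_def mult_single single_add)

lemma vpow_0 [simp]: "vpow v 0 = 1"
  by (simp add: vpow_def)

lemma vpow_inverse [simp]:
  "vpow v a * vpow v (- a) = 1" "vpow v (- a) * vpow v a = 1"
  "vpow v a * (vpow v (- a) * x) = x" "vpow v (- a) * (vpow v a * x) = x"
  by (simp_all add: vpow_add mult.assoc[symmetric])

definition st_units :: "laurent set" where
  "st_units = {u * vpow Vs a * vpow Vt b |u a b. u \<in> {1, - 1}}"

lemma st_unitsI: "u \<in> {1, - 1} \<Longrightarrow> u * vpow Vs a * vpow Vt b \<in> st_units"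
  unfolding st_units_def by blast

lemma st_units_basic:
  "1 \<in> st_units" "- 1 \<in> st_units" "vpow Vs a * vpow Vt b \<in> st_units"
  using st_unitsI[of 1 0 0] st_unitsI[of "- 1" 0 0] st_unitsI[of 1 a b] by simp_all

lemma st_units_mult:
  assumes "x \<in> st_units" "y \<in> st_units"
  shows "x * y \<in> st_units"
proof -
  obtain u a b u' a' b' where
    x: "x = u * vpow Vs a * vpow Vt b" "u \<in> {1, - 1}" and
    y: "y = u' * vpow Vs a' * vpow Vt b'" "u' \<in> {1, - 1}"
    using assms unfolding st_units_def by blast
  have "x * y = (u * u') * (vpow Vs a * vpow Vs a') * (vpow Vt b * vpow Vt b')"
    unfolding x y by (simp only: ac_simps)
  then have "x * y = (u * u') * vpow Vs (a + a') * vpow Vt (b + b')"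
    by (simp only: vpow_add)
  moreover have "u * u' \<in> {1, - 1}" using x y by auto
  ultimately show ?thesis using st_unitsI by metis
qed

lemma st_units_inverse:
  assumes "x \<in> st_units"
  obtains y where "y \<in> st_units" "x * y = 1"
proof -
  obtain u a b where x: "x = u * vpow Vs a * vpow Vt b" "u \<in> {1, - 1}"
    using assms unfolding st_units_def by blast
  define y where "y = u * vpow Vs (- a) * vpow Vt (- b)"
  have "x * y = (u * u) * (vpow Vs a * vpow Vs (- a)) * (vpow Vt b * vpow Vt (- b))"
    unfolding x y_def by (simp only: ac_simps)
  also have "\<dots> = 1" using x(2) by auto
  finally show ?thesis using that st_unitsI[OF x(2)] unfolding y_def by blast
qed

text \<open>
  The strand \<open>p \<rightarrow> q\<close> passes over \<open>p' \<rightarrow> q'\<close> twice; \<open>c\<close> says whether the two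
  strands are parallel.
\<close>

lemma bigon_core:
  fixes a b :: "'a \<Rightarrow> 'b::comm_ring_1"
  assumes "finite S" and in_S: "{p, q, p', q'} \<subseteq> S" and d: "distinct [p, q, p', q']"
    and pr: "pr q = p" "pr q' = p'" "\<And>x. x \<in> S \<Longrightarrow> pr x \<in> S"
      "\<And>x. x \<in> S \<Longrightarrow> pr x = p \<Longrightarrow> x = q" "\<And>x. x \<in> S \<Longrightarrow> pr x = p' \<Longrightarrow> x = q'"
    and o: "if c then op p' = p \<and> op q' = q else op p' = q \<and> op q' = p"
    and other: "\<And>x. x \<in> S - {p, q, p', q'} \<Longrightarrow> b x = 0 \<or> op x \<in> S - {p, q, p', q'}"
    and over: "b p = 0" "b q = 0"
  defines "M \<equiv> \<lambda>x y. a x * of_bool (y = pr x) + b x * of_bool (y = pr (op x))"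
  shows "sdet S (\<lambda>x y. M x y - of_bool (x = y)) = sdet (S - {p, p'}) (\<lambda>x y.
    (if x = q then a p * a q * of_bool (y = pr p)
     else if x = q' then a p' * a q' * of_bool (y = pr p') +
       (if c then b p' * a q' + b q' * a p else b p' * a p * a q' + b q') * of_bool (y = pr p)
     else M x y) - of_bool (x = y))"
proof -
  let ?V = "{p, q, p', q'}"
  \<comment> \<open>Parallel strands both enter the bigon at the crossing of \<open>p\<close> and
    \<open>p'\<close>. Otherwise \<open>p'\<close> crosses \<open>q\<close>, whose incoming arc
    \<open>p\<close> has to be replaced by \<open>a p\<close> times the arc
    \<open>pr p\<close>.\<close>
  define G where "G = (\<lambda>e y. if e = p then a p * of_bool (y = pr p)
    else a p' * of_bool (y = pr p') + b p' * (if c then 1 else a p) * of_bool (y = pr p))"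
  have ne: "p \<noteq> q" "p \<noteq> p'" "p \<noteq> q'" "q \<noteq> p'" "q \<noteq> q'" "p' \<noteq> q'" using d by auto
  \<comment> \<open>Only \<open>q\<close> and \<open>q'\<close> are entered by the arcs
    \<open>p\<close> and \<open>p'\<close>, so the arcs \<open>pr p\<close> and \<open>pr p'\<close>
    that lead into the bigon survive the elimination.\<close>
  have pr_p: "pr p \<noteq> p" "pr p \<noteq> p'" "pr p' \<noteq> p" "pr p' \<noteq> p'"
    using pr(4,5)[of p] pr(4,5)[of p'] in_S ne by auto
  note facts = ne ne[symmetric] pr_p pr_p[symmetric] over pr(1,2) o
  have z: "M x p = 0" "M x p' = 0" if "x \<in> S - ?V" for x
    using that pr(4,5)[of x] pr(4,5)[of "op x"] other[OF that] unfolding M_def by auto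
  have "sdet S (\<lambda>x y. M x y - of_bool (x = y)) = (-1) ^ length [p, p'] *
      sdet (S - set [p, p']) (\<lambda>x y. M x y + (\<Sum>i\<leftarrow>[p, p']. M x i * G i y) - of_bool (x = y))"
  proof (rule sdet_eliminate)
    show "sorted_wrt (\<lambda>e e'. M e e' = 0) [p, p']" "\<forall>e\<in>set [p, p']. M e e = 0"
      using facts by (auto simp: M_def split: if_splits)
    show "G e y = M e y + (\<Sum>i\<leftarrow>[p, p']. M e i * G i y)"
      if "e \<in> set [p, p']" "y \<in> S - set [p, p']" for e y
      by (cases "e = p"; cases c) (use that facts in \<open>simp_all add: M_def G_def\<close>)
  qed (use assms(1) in_S ne in auto)
  also have "\<dots> = sdet (S - {p, p'}) (\<lambda>x y. M x y + (M x p * G p y + M x p' * G p' y) - of_bool (x = y))"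
    by simp
  also have "\<dots> = sdet (S - {p, p'}) (\<lambda>x y.
    (if x = q then a p * a q * of_bool (y = pr p)
     else if x = q' then a p' * a q' * of_bool (y = pr p') +
       (if c then b p' * a q' + b q' * a p else b p' * a p * a q' + b q') * of_bool (y = pr p)
     else M x y) - of_bool (x = y))"
  proof (rule sdet_cong)
    fix x y assume xy: "x \<in> S - {p, p'}" "y \<in> S - {p, p'}"
    have x: "x = q \<or> x = q' \<or> x \<in> S - ?V" using xy by blast
    have "M x y + (M x p * G p y + M x p' * G p' y) =
     (if x = q then a p * a q * of_bool (y = pr p)
     else if x = q' then a p' * a q' * of_bool (y = pr p') +
       (if c then b p' * a q' + b q' * a p else b p' * a p * a q' + b q') * of_bool (y = pr p)
     else M x y)"
    proof (cases "x \<in> S - ?V")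
      case True
      then show ?thesis using z[OF True] by auto
    next
      case False
      with x show ?thesis
        by (cases "x = q"; cases c) (use facts xy in \<open>simp_all add: M_def G_def algebra_simps\<close>)
    qed
    then show "M x y + (M x p * G p y + M x p' * G p' y) - of_bool (x = y) =
     (if x = q then a p * a q * of_bool (y = pr p)
     else if x = q' then a p' * a q' * of_bool (y = pr p') +
       (if c then b p' * a q' + b q' * a p else b p' * a p * a q' + b q') * of_bool (y = pr p)
     else M x y) - of_bool (x = y)" by simp
  qed (use assms(1) in simp)
  finally show ?thesis .
qed

text \<open>
  Strands \<open>p \<rightarrow> q\<close> (top), \<open>p' \<rightarrow> q'\<close> (middle) and \<open>p'' \<rightarrow> q''\<close> (bottom).  The flags tell
  which of its two crossings a strand meets first: \<open>f\<close> (\<open>f'\<close>, \<open>f''\<close>) says that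
  it is the one between top and middle (top and middle, top and bottom).
\<close>

lemma triangle_core:
  fixes a b :: "'a \<Rightarrow> 'b::comm_ring_1"
  assumes "finite S" and in_S: "{p, q, p', q', p'', q''} \<subseteq> S"
    and d: "distinct [p, q, p', q', p'', q'']"
    and pr: "pr q = p" "pr q' = p'" "pr q'' = p''"
      "\<And>x. x \<in> S \<Longrightarrow> pr x = p \<Longrightarrow> x = q" "\<And>x. x \<in> S \<Longrightarrow> pr x = p' \<Longrightarrow> x = q'"
      "\<And>x. x \<in> S \<Longrightarrow> pr x = p'' \<Longrightarrow> x = q''"
    and o: "op (if f' then p' else q') = (if f then p else q)"
      "op (if f'' then p'' else q'') = (if f then q else p)"
      "op (if f'' then q'' else p'') = (if f' then q' else p')"
    and other: "\<And>x. x \<in> S - {p, q, p', q', p'', q''} \<Longrightarrow>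
      b x = 0 \<or> op x \<in> S - {p, q, p', q', p'', q''}"
    and over: "b p = 0" "b q = 0" "b (if f' then q' else p') = 0"
    and coeffs: "a (if f then p else q) = o1" "a (if f' then p' else q') = u1"
      "b (if f' then p' else q') = k1"
      "a (if f then q else p) = o2" "a (if f'' then p'' else q'') = u2"
      "b (if f'' then p'' else q'') = k2"
      "a (if f' then q' else p') = o3" "a (if f'' then q'' else p'') = u3"
      "b (if f'' then q'' else p'') = k3"
  defines "M \<equiv> \<lambda>x y. a x * of_bool (y = pr x) + b x * of_bool (y = pr (op x))"
  shows "sdet S (\<lambda>x y. M x y - of_bool (x = y)) = - sdet (S - {p, p', p''}) (\<lambda>x y.
    (if x = q then o1 * o2 * of_bool (y = pr p)
     else if x = q' then u1 * o3 * of_bool (y = pr p') +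
       k1 * (if f then 1 else o2) * (if f' then o3 else 1) * of_bool (y = pr p)
     else if x = q'' then u2 * u3 * of_bool (y = pr p'') +
       k3 * (if f' then u1 else 1) * (if f'' then 1 else u2) * of_bool (y = pr p') +
       (k2 * (if f then o1 else 1) * (if f'' then u3 else 1) +
        k3 * (if f' then k1 * (if f then 1 else o2) else 0) * (if f'' then 1 else u2))
         * of_bool (y = pr p)
     else M x y) - of_bool (x = y))"
proof -
  let ?V = "{p, q, p', q', p'', q''}"
  define R where "R = (\<lambda>x y.
    if x = q then o1 * o2 * of_bool (y = pr p)
     else if x = q' then u1 * o3 * of_bool (y = pr p') +
       k1 * (if f then 1 else o2) * (if f' then o3 else 1) * of_bool (y = pr p)
     else if x = q'' then u2 * u3 * of_bool (y = pr p'') +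
       k3 * (if f' then u1 else 1) * (if f'' then 1 else u2) * of_bool (y = pr p') +
       (k2 * (if f then o1 else 1) * (if f'' then u3 else 1) +
        k3 * (if f' then k1 * (if f then 1 else o2) else 0) * (if f'' then 1 else u2))
         * of_bool (y = pr p)
     else M x y)"
  \<comment> \<open>The inner arcs are solved from top to bottom: inside the triangle a nonzero
    second coefficient refers to a higher strand only. So the order \<open>p\<close>,
    \<open>p'\<close>, \<open>p''\<close> is triangular as \<open>sdet_eliminate\<close>
    demands.\<close>
  define Gt where "Gt = (\<lambda>y. (if f then o1 else o2) * of_bool (y = pr p))"
  define Gm where "Gm = (\<lambda>y. if f' then u1 * of_bool (y = pr p') +
      k1 * (if f then of_bool (y = pr p) else Gt y) else o3 * of_bool (y = pr p'))"
  define Gb where "Gb = (\<lambda>y. if f'' then u2 * of_bool (y = pr p'') +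
      k2 * (if f then Gt y else of_bool (y = pr p))
      else u3 * of_bool (y = pr p'') + k3 * (if f' then Gm y else of_bool (y = pr p')))"
  define G where "G = (\<lambda>e. if e = p then Gt else if e = p' then Gm else Gb)"
  have ne: "p \<noteq> q" "p \<noteq> p'" "p \<noteq> q'" "q \<noteq> p'" "q \<noteq> q'" "p' \<noteq> q'" "p'' \<noteq> q''"
    "p'' \<noteq> p" "p'' \<noteq> q" "p'' \<noteq> p'" "p'' \<noteq> q'" "q'' \<noteq> p" "q'' \<noteq> q" "q'' \<noteq> p'" "q'' \<noteq> q'"
    using d by auto
  have pr_p: "pr p \<noteq> p" "pr p \<noteq> p'" "pr p \<noteq> p''" "pr p' \<noteq> p" "pr p' \<noteq> p'" "pr p' \<noteq> p''"
    "pr p'' \<noteq> p" "pr p'' \<noteq> p'" "pr p'' \<noteq> p''"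
    using pr(4-6)[of p] pr(4-6)[of p'] pr(4-6)[of p''] in_S ne by auto
  note facts = ne ne[symmetric] pr_p pr_p[symmetric] over pr(1-3) o coeffs
  have z: "M x p = 0" "M x p' = 0" "M x p'' = 0" if "x \<in> S - ?V" for x
    using that pr(4-6)[of x] pr(4-6)[of "op x"] other[OF that] unfolding M_def by auto
  have "sdet S (\<lambda>x y. M x y - of_bool (x = y)) = (-1) ^ length [p, p', p''] *
      sdet (S - set [p, p', p'']) (\<lambda>x y. M x y + (\<Sum>i\<leftarrow>[p, p', p'']. M x i * G i y) - of_bool (x = y))"
  proof (rule sdet_eliminate)
    show "sorted_wrt (\<lambda>e e'. M e e' = 0) [p, p', p'']"
      by (cases f; cases f'; cases f'') (use facts in \<open>simp_all add: M_def\<close>)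
    show "\<forall>e\<in>set [p, p', p'']. M e e = 0"
      by (cases f; cases f'; cases f'') (use facts in \<open>simp_all add: M_def\<close>)
    show "G e y = M e y + (\<Sum>i\<leftarrow>[p, p', p'']. M e i * G i y)"
      if "e \<in> set [p, p', p'']" "y \<in> S - set [p, p', p'']" for e y
      by (cases "e = p"; cases "e = p'"; cases f; cases f'; cases f'')
         (use that facts in \<open>simp_all add: M_def G_def Gt_def Gm_def Gb_def\<close>)
  qed (use assms(1) in_S ne in auto)
  also have "\<dots> = - sdet (S - {p, p', p''})
      (\<lambda>x y. M x y + (M x p * G p y + (M x p' * G p' y + M x p'' * G p'' y)) - of_bool (x = y))"
    by simp
  also have "sdet (S - {p, p', p''})
      (\<lambda>x y. M x y + (M x p * G p y + (M x p' * G p' y + M x p'' * G p'' y)) - of_bool (x = y))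
      = sdet (S - {p, p', p''}) (\<lambda>x y. R x y - of_bool (x = y))"
  proof (rule sdet_cong)
    fix x y assume xy: "x \<in> S - {p, p', p''}" "y \<in> S - {p, p', p''}"
    have x: "x = q \<or> x = q' \<or> x = q'' \<or> x \<in> S - ?V" using xy by blast
    have "M x y + (M x p * G p y + (M x p' * G p' y + M x p'' * G p'' y)) = R x y"
    proof (cases "x \<in> S - ?V")
      case True
      then show ?thesis using z[OF True] by (auto simp: R_def)
    next
      case False
      with x show ?thesis
        by (cases "x = q"; cases "x = q'"; cases f; cases f'; cases f'')
           (use facts xy in \<open>simp_all add: M_def G_def Gt_def Gm_def Gb_def R_def algebra_simps\<close>)
    qed
    then show "M x y + (M x p * G p y + (M x p' * G p' y + M x p'' * G p'' y)) - of_bool (x = y) =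
      R x y - of_bool (x = y)" by simp
  qed (use assms(1) in simp)
  finally show ?thesis unfolding R_def .
qed

section \<open>Labelled crossings\<close>

lemma opp_opp [simp]: "opp (opp p) = p"
  by (cases p; cases "snd p") auto

lemma opp_neq [simp]: "opp p \<noteq> p" "p \<noteq> opp p"
  by (cases p; cases "snd p"; auto)+

lemma fst_opp [simp]: "fst (opp p) = fst p"
  by (cases p; cases "snd p") auto

lemma snd_opp [simp]: "snd (opp p) = SW \<longleftrightarrow> snd p = SE" "snd (opp p) = SE \<longleftrightarrow> snd p = SW"
  by (cases p; cases "snd p"; auto)+

lemma opp_inject [simp]: "opp p = opp q \<longleftrightarrow> p = q"
  by (metis opp_opp)

lemma opp_eq_iff: "opp p = q \<longleftrightarrow> p = opp q"
  by auto

lemma strand_neq [simp]: "s \<noteq> SW \<longleftrightarrow> s = SE" "s \<noteq> SE \<longleftrightarrow> s = SW"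
  by (cases s; simp)+

lemma same_crossing: "fst p = fst q \<longleftrightarrow> p = q \<or> p = opp q"
  by (cases p; cases q; cases "snd p"; cases "snd q") auto

lemma is_virt_opp [simp]: "is_virt D (opp p) \<longleftrightarrow> is_virt D p"
  by (simp add: is_virt_def)

lemma is_over_opp: "\<not> is_virt D p \<Longrightarrow> is_over D (opp p) \<longleftrightarrow> \<not> is_over D p"
  by (cases "kind_of D (fst p)"; cases "snd p") (auto simp: is_over_def is_virt_def)

definition well_formed :: "diagram \<Rightarrow> bool" where
  "well_formed D \<longleftrightarrow> simple D \<and> (\<forall>p \<in> passages D. opp p \<in> passages D)"

lemma well_formedD: "well_formed D \<Longrightarrow> simple D" "well_formed D \<Longrightarrow> p \<in> passages D \<Longrightarrow> opp p \<in> passages D"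
  by (auto simp: well_formed_def)

lemma virtual_diagram_well_formed: "virtual_diagram D \<Longrightarrow> well_formed D"
  by (simp add: virtual_diagram_def well_formed_def simple_def)

lemma arc_det_cong:
  assumes "\<And>x. x \<in> passages D \<Longrightarrow> r x = r' x"
  shows "arc_det r D = arc_det r' D"
proof -
  have "sdet (passages D) (\<lambda>x y. arcmat r D x y - of_bool (x = y))
    = sdet (passages D) (\<lambda>x y. arcmat r' D x y - of_bool (x = y))"
    by (rule sdet_cong) (simp_all add: arcmat_def assms)
  then show ?thesis by (simp add: arc_det_def)
qed

text \<open>Covers isotopies and triangle moves alike. Compatibility with \<open>opp\<close> is left
  out on purpose: a triangle move violates it.\<close>

definition transports :: "(passage \<Rightarrow> passage) \<Rightarrow> diagram \<Rightarrow> diagram \<Rightarrow> bool" where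
  "transports f D D' \<longleftrightarrow> simple D \<and> simple D' \<and> inj_on f (passages D) \<and>
     succs D' = map_prod f f ` succs D \<and> ([] \<in> set (comps D') \<longleftrightarrow> [] \<in> set (comps D))"

lemma fst_cpairs: "fst ` cpairs w = set w"
  unfolding cpairs_def set_map[symmetric] by simp

lemma fst_succs: "fst ` succs D = passages D"
  by (simp add: succs_def image_UN fst_cpairs passages_UN)

lemma transports_passages: "transports f D D' \<Longrightarrow> passages D' = f ` passages D"
  unfolding transports_def fst_succs[symmetric] by (simp add: image_image)

lemma transports_prv:
  assumes "transports f D D'" "x \<in> passages D"
  shows "prv D' (f x) = f (prv D x)"
proof (rule prv_eqI)
  show "simple D'" using assms by (simp add: transports_def)
  have "(prv D x, x) \<in> succs D" using assms succs_prv by (auto simp: transports_def)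
  then have "map_prod f f (prv D x, x) \<in> succs D'"
    using assms(1) unfolding transports_def by blast
  then show "(f (prv D x), f x) \<in> succs D'" by simp
qed

text \<open>Pulled back to the passages of \<open>D\<close>, the determinant of \<open>D'\<close>
  uses the arcs of \<open>D\<close>; what changes is the pairing of strands, which becomes the
  conjugate \<open>o'\<close> of \<open>opp\<close>.\<close>

lemma transports_arc_det:
  assumes t: "transports f D D'"
    and o: "\<And>x. x \<in> passages D \<Longrightarrow> o' x \<in> passages D \<and> f (o' x) = opp (f x)"
  shows "arc_det r D' = (if [] \<in> set (comps D) then 0 else sdet (passages D)
    (\<lambda>x y. fst (r (f x)) * of_bool (y = prv D x) + snd (r (f x)) * of_bool (y = prv D (o' x))
      - of_bool (x = y)))"
proof -
  have inj: "inj_on f (passages D)" and s: "simple D" using t by (simp_all add: transports_def)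
  have "sdet (f ` passages D) (\<lambda>x y. arcmat r D' x y - of_bool (x = y)) = sdet (passages D)
    (\<lambda>x y. fst (r (f x)) * of_bool (y = prv D x) + snd (r (f x)) * of_bool (y = prv D (o' x))
      - of_bool (x = y))"
    unfolding sdet_image[OF finite_passages inj]
  proof (rule sdet_cong)
    fix x y assume xy: "x \<in> passages D" "y \<in> passages D"
    note fe = inj_on_eq_iff[OF inj]
    have "f y = prv D' (f x) \<longleftrightarrow> y = prv D x"
      using transports_prv[OF t xy(1)] fe[OF xy(2) prv_passages[OF s xy(1)]] by simp
    moreover have "f y = prv D' (opp (f x)) \<longleftrightarrow> y = prv D (o' x)"
      using transports_prv[OF t, of "o' x"] o[OF xy(1)] fe[OF xy(2) prv_passages[OF s, of "o' x"]] by simp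
    ultimately show "arcmat r D' (f x) (f y) - of_bool (f x = f y) =
      fst (r (f x)) * of_bool (y = prv D x) + snd (r (f x)) * of_bool (y = prv D (o' x)) - of_bool (x = y)"
      using fe[OF xy] by (simp add: arcmat_def)
  qed simp
  then show ?thesis using t transports_passages[OF t] by (simp add: arc_det_def transports_def)
qed

text \<open>At an over-passage this is the sign of the crossing; at a virtual crossing it is the
  exponent of \<alpha> in (V).\<close>

definition strand_sign :: "passage \<Rightarrow> int" where
  "strand_sign p = (if snd p = SW then 1 else - 1)"

lemma strand_sign_opp [simp]: "strand_sign (opp p) = - strand_sign p"
  by (cases "snd p") (auto simp: strand_sign_def)

text \<open>
  The relation (B) for the label \<open>None\<close>, and (V) with the variable \<open>y\<close> in place of \<open>\<alpha>\<close> for the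
  label \<open>Some y\<close>; the latter coincides with (C) at classical crossings.
\<close>

definition label_rel :: "(passage \<Rightarrow> lvar option) \<Rightarrow> diagram \<Rightarrow> passage \<Rightarrow> relation" where
  "label_rel l D p = (case l p of None \<Rightarrow> rel_B D p | Some y \<Rightarrow> (vpow y (strand_sign p), 0))"

lemma label_rel_Some: "l p = Some y \<Longrightarrow> label_rel l D p = (vpow y (strand_sign p), 0)"
  by (simp add: label_rel_def)

lemma label_rel_over:
  assumes "l p = None" "is_over D p"
  shows "label_rel l D p = (vpow Vs (strand_sign p), 0)"
  using assms by (auto simp: label_rel_def rel_B_def Let_def sign_of_def is_over_def strand_sign_def)

lemma label_rel_under:
  assumes "l (opp p) = None" "is_over D p"
  shows "label_rel l D (opp p) = (vpow Vt (strand_sign p), 1 - vpow Vs (strand_sign p) * vpow Vt (strand_sign p))"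
proof -
  have "\<not> is_virt D p" using assms(2) by (auto simp: is_over_def is_virt_def)
  then have "\<not> is_over D (opp p)" using is_over_opp assms(2) by blast
  then show ?thesis using assms
    by (auto simp: label_rel_def rel_B_def Let_def sign_of_def is_over_def strand_sign_def)
qed

text \<open>The over-passage is \<open>SW\<close> exactly at a positive crossing, so in all four
  cases sign and height combine to the exponent \<open>1\<close> on \<open>SW\<close> and
  \<open>-1\<close> on \<open>SE\<close>.\<close>

lemma rel_C_vpow:
  assumes "\<not> is_virt D p"
  shows "rel_C y D p = (vpow y (strand_sign p), 0)"
  using assms by (cases "kind_of D (fst p)"; cases "snd p")
    (auto simp: rel_C_def Let_def sign_of_def is_over_def is_virt_def strand_sign_def)

lemma rel_V_vpow: "rel_V p = (vpow Valpha (strand_sign p), 0)"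
  by (cases "snd p") (auto simp: rel_V_def strand_sign_def)

section \<open>Moves I and II: eliminating the arcs of a monogon or a bigon\<close>

lemma vpow_inverse_pair: "(vpow v a * vpow w b) * (vpow v (- a) * vpow w (- b)) = 1"
proof -
  have "(vpow v a * vpow w b) * (vpow v (- a) * vpow w (- b))
      = (vpow v a * vpow v (- a)) * (vpow w b * vpow w (- b))"
    by (simp only: ac_simps)
  then show ?thesis by simp
qed

text \<open>The loop arc \<open>e\<close> enters the crossing that it leaves, so its own relation
  contains it with coefficient \<open>b e\<close>, and the pivot is \<open>b e - 1\<close>.
  Condition \<open>one\<close> says that after the elimination the strand runs through
  unchanged.\<close>

lemma monogon_core:
  fixes a b :: "'a \<Rightarrow> 'b::comm_ring_1"
  assumes "finite S" and in_S: "e \<in> S" "e' \<in> S" and ne: "e \<noteq> e'"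
    and pr: "pr e' = e" "\<And>x. x \<in> S \<Longrightarrow> pr x = e \<Longrightarrow> x = e'"
    and o: "op e = e'" "op e' = e"
    and other: "\<And>x. x \<in> S - {e, e'} \<Longrightarrow> b x = 0 \<or> op x \<in> S - {e, e'}"
    and v: "(b e - 1) * v = 1" and one: "b e' - a e' * v * a e = 1"
  defines "M \<equiv> \<lambda>x y. a x * of_bool (y = pr x) + b x * of_bool (y = pr (op x))"
  shows "sdet S (\<lambda>x y. M x y - of_bool (x = y)) = (b e - 1) *
    sdet (S - {e}) (\<lambda>x y. (if x = e' then of_bool (y = pr e) else M x y) - of_bool (x = y))"
proof -
  let ?A = "\<lambda>x y. M x y - of_bool (x = y)"
  have pe: "pr e \<noteq> e" "e \<noteq> pr e" using pr(2)[of e] in_S ne by auto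
  have ee: "?A e e = b e - 1" using pe pr o by (simp add: M_def)
  have "sdet S ?A = ?A e e * sdet (S - {e}) (\<lambda>x y. ?A x y - ?A x e * v * ?A e y)"
    by (rule sdet_schur) (use assms(1) in_S v ee in auto)
  also have "sdet (S - {e}) (\<lambda>x y. ?A x y - ?A x e * v * ?A e y) =
      sdet (S - {e}) (\<lambda>x y. (if x = e' then of_bool (y = pr e) else M x y) - of_bool (x = y))"
  proof (rule sdet_cong)
    fix x y assume xy: "x \<in> S - {e}" "y \<in> S - {e}"
    show "?A x y - ?A x e * v * ?A e y = (if x = e' then of_bool (y = pr e) else M x y) - of_bool (x = y)"
    proof (cases "x = e'")
      case True
      have "M e' y = b e' * of_bool (y = pr e)" "M e' e = a e'" "M e y = a e * of_bool (y = pr e)"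
        using pe pr o xy by (auto simp: M_def)
      moreover have "b e' * of_bool (y = pr e) - a e' * v * (a e * of_bool (y = pr e)) = of_bool (y = pr e)"
        using one by simp
      ultimately show ?thesis using True xy ne by auto
    next
      case False
      then have "M x e = 0" using pr(2)[of x] pr(2)[of "op x"] other[of x] xy by (auto simp: M_def)
      then show ?thesis using False xy by auto
    qed
  qed (use assms(1) in simp)
  finally show ?thesis unfolding ee .
qed

lemma arc_det_monogon:
  assumes D: "well_formed D" and e: "e \<in> passages D" "nxt D e = opp e"
    and l: "l (opp e) = l e" "l e = None \<Longrightarrow> \<not> is_virt D e"
    and r': "\<And>x. r' x = (if fst x = fst e then (1, 0) else label_rel l D x)"
  shows "\<exists>u \<in> st_units. arc_det (label_rel l D) D = u * arc_det r' D"
proof (cases "[] \<in> set (comps D)")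
  case True
  then show ?thesis using st_units_basic by (auto simp: arc_det_def)
next
  case False
  let ?S = "passages D" and ?e' = "opp e"
  define r where "r = label_rel l D"
  have s: "simple D" by (rule well_formedD(1)[OF D])
  have e': "?e' \<in> ?S" by (rule well_formedD(2)[OF D e(1)])
  have pr: "prv D ?e' = e" using prv_nxt[OF s e(1)] e(2) by simp
  have pr': "x = ?e'" if "x \<in> ?S" "prv D x = e" for x
    using nxt_prv[OF s that(1)] that(2) e(2) by simp
  have oth: "opp x \<in> ?S - {e, ?e'}" if "x \<in> ?S - {e, ?e'}" for x
    using that well_formedD(2)[OF D, of x] by (auto simp: opp_eq_iff)
  \<comment> \<open>Used for the given relations and for the identity relations of
    \<open>r'\<close>; both lead to the same reduced determinant.\<close>
  have key: "sdet ?S (\<lambda>x y. arcmat \<rho> D x y - of_bool (x = y)) = (snd (\<rho> e) - 1) *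
      sdet (?S - {e}) (\<lambda>x y. (if x = ?e' then of_bool (y = prv D e) else arcmat \<rho> D x y) - of_bool (x = y))"
    if "(snd (\<rho> e) - 1) * v = 1" "snd (\<rho> ?e') - fst (\<rho> ?e') * v * fst (\<rho> e) = 1" for \<rho> v
    unfolding arcmat_def
    by (rule monogon_core[where op = opp and v = v and a = "\<lambda>x. fst (\<rho> x)" and b = "\<lambda>x. snd (\<rho> x)"
          and pr = "prv D" and e = e and e' = "opp e" and S = "passages D"])
       (fact finite_passages e(1) e' opp_neq(2) pr pr' refl opp_opp that disjI2[OF oth])+
  have "\<exists>v. (snd (r e) - 1) * v = 1 \<and> snd (r ?e') - fst (r ?e') * v * fst (r e) = 1
      \<and> - (snd (r e) - 1) \<in> st_units"
  proof (cases "l e")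
    case (Some y)
    then show ?thesis unfolding r_def using l(1) st_units_basic
      by (intro exI[of _ "-1"]) (simp add: label_rel_Some)
  next
    case None
    let ?c = "strand_sign e"
    have nv: "\<not> is_virt D e" by (rule l(2)[OF None])
    show ?thesis
    proof (cases "is_over D e")
      case True
      then show ?thesis unfolding r_def using l(1) None st_units_basic
        by (intro exI[of _ "-1"]) (simp add: label_rel_over label_rel_under)
    next
      case False
      then have ov: "is_over D ?e'" using is_over_opp[OF nv] by simp
      have 1: "label_rel l D e = (vpow Vt (- ?c), 1 - vpow Vs (- ?c) * vpow Vt (- ?c))"
        using label_rel_under[of l ?e' D] ov None by simp
      have 2: "label_rel l D ?e' = (vpow Vs (- ?c), 0)"
        using label_rel_over[of l ?e' D] ov None l(1) by simp
      \<comment> \<open>A strand that passes under first gives the pivot \<open>- A\<close>, with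
        inverse \<open>- B\<close>. This is the source of the factors s^a t^b; all other moves
        change the determinant at most by a sign.\<close>
      define A where "A = vpow Vs (- ?c) * vpow Vt (- ?c)"
      define B where "B = vpow Vs ?c * vpow Vt ?c"
      have AB: "A * B = 1" unfolding A_def B_def using vpow_inverse_pair[of Vs "- ?c" Vt "- ?c"] by simp
      have "vpow Vs (- ?c) * (- B) * vpow Vt (- ?c) = - (A * B)"
        unfolding A_def by (simp only: mult_minus_right mult_minus_left ac_simps)
      then have 3: "0 - vpow Vs (- ?c) * (- B) * vpow Vt (- ?c) = 1" using AB by simp
      have 4: "(1 - A - 1) * (- B) = 1" using AB by simp
      have 5: "- (1 - A - 1) \<in> st_units" using st_units_basic(3) by (simp add: A_def)
      show ?thesis unfolding r_def 1 2 fst_conv snd_conv A_def[symmetric] using 3 4 5 by blast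
    qed
  qed
  then obtain v where v: "(snd (r e) - 1) * v = 1" "snd (r ?e') - fst (r ?e') * v * fst (r e) = 1"
    "- (snd (r e) - 1) \<in> st_units" by blast
  have r'e: "r' e = (1, 0)" "r' ?e' = (1, 0)" using r' by simp_all
  have "sdet ?S (\<lambda>x y. arcmat r D x y - of_bool (x = y)) = (snd (r e) - 1) *
      sdet (?S - {e}) (\<lambda>x y. (if x = ?e' then of_bool (y = prv D e) else arcmat r D x y) - of_bool (x = y))"
    by (rule key[OF v(1,2)])
  also have "sdet (?S - {e}) (\<lambda>x y. (if x = ?e' then of_bool (y = prv D e) else arcmat r D x y) - of_bool (x = y))
    = sdet (?S - {e}) (\<lambda>x y. (if x = ?e' then of_bool (y = prv D e) else arcmat r' D x y) - of_bool (x = y))"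
  proof (rule sdet_cong)
    fix x y assume "x \<in> ?S - {e}"
    then have "x \<noteq> ?e' \<Longrightarrow> r' x = r x" using r' by (auto simp: same_crossing r_def)
    then show "(if x = ?e' then of_bool (y = prv D e) else arcmat r D x y) - of_bool (x = y) =
      (if x = ?e' then of_bool (y = prv D e) else arcmat r' D x y) - of_bool (x = y)"
      by (simp add: arcmat_def)
  qed simp
  also have "(snd (r e) - 1) * \<dots> = - (snd (r e) - 1) * sdet ?S (\<lambda>x y. arcmat r' D x y - of_bool (x = y))"
    by (subst key[of r' "-1"]) (simp_all add: r'e algebra_simps)
  finally show ?thesis using v(3) False unfolding r_def arc_det_def by auto
qed

text \<open>The over-strand has opposite strand types at the two crossings, so its factors are
  inverse to each other, and the two mixed terms of the under-strand cancel, whether the strands are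
  parallel or antiparallel. With a variable as label only the first reason is needed, for each
  strand.\<close>

lemma arc_det_bigon:
  assumes D: "well_formed D" and pq: "{p, q, p', q'} \<subseteq> passages D" "nxt D p = q" "nxt D p' = q'"
    and ne: "fst p \<noteq> fst q"
    and o: "if c then p' = opp p \<and> q' = opp q else p' = opp q \<and> q' = opp p"
    and sn: "snd p \<noteq> snd q"
    and l: "l (opp p) = l p" "l (opp q) = l q" "l p = l q"
      "l p = None \<Longrightarrow> is_over D p \<and> is_over D q"
    and r': "\<And>x. r' x = (if fst x \<in> {fst p, fst q} then (1, 0) else label_rel l D x)"
  shows "arc_det (label_rel l D) D = arc_det r' D"
proof (cases "[] \<in> set (comps D)")
  case True
  then show ?thesis by (simp add: arc_det_def)
next
  case False
  let ?S = "passages D" and ?V = "{p, q, p', q'}"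
  define r where "r = label_rel l D"
  have s: "simple D" by (rule well_formedD(1)[OF D])
  have V: "x \<in> ?V \<longleftrightarrow> fst x \<in> {fst p, fst q}" for x
    using o by (cases c) (auto simp: same_crossing opp_eq_iff)
  have d: "distinct [p, q, p', q']" using o ne by (cases c) auto
  have pr: "prv D q = p" "prv D q' = p'" using prv_nxt[OF s, of p] prv_nxt[OF s, of p'] pq by simp_all
  have pr': "x = q" if "x \<in> ?S" "prv D x = p" for x using nxt_prv[OF s that(1)] that(2) pq(2) by simp
  have pr'': "x = q'" if "x \<in> ?S" "prv D x = p'" for x using nxt_prv[OF s that(1)] that(2) pq(3) by simp
  have oth: "opp x \<in> ?S - ?V" if "x \<in> ?S - ?V" for x
    using that well_formedD(2)[OF D, of x] unfolding Diff_iff V fst_opp by blast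
  have o': "if c then opp p' = p \<and> opp q' = q else opp p' = q \<and> opp q' = p"
    using o by (cases c) auto
  define R where "R = (\<lambda>\<rho> :: passage \<Rightarrow> relation. \<lambda>x y.
    (if x = q then of_bool (y = prv D p) else if x = q' then of_bool (y = prv D p')
     else arcmat \<rho> D x y) - of_bool (x = y))"
  have key: "sdet ?S (\<lambda>x y. arcmat \<rho> D x y - of_bool (x = y)) = sdet (?S - {p, p'}) (R \<rho>)"
    if "fst (\<rho> p) * fst (\<rho> q) = 1" "fst (\<rho> p') * fst (\<rho> q') = 1" "snd (\<rho> p) = 0" "snd (\<rho> q) = 0"
      "(if c then snd (\<rho> p') * fst (\<rho> q') + snd (\<rho> q') * fst (\<rho> p)
        else snd (\<rho> p') * fst (\<rho> p) * fst (\<rho> q') + snd (\<rho> q')) = 0" for \<rho>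
  proof -
    have "sdet ?S (\<lambda>x y. arcmat \<rho> D x y - of_bool (x = y)) = sdet (?S - {p, p'}) (\<lambda>x y.
      (if x = q then fst (\<rho> p) * fst (\<rho> q) * of_bool (y = prv D p)
       else if x = q' then fst (\<rho> p') * fst (\<rho> q') * of_bool (y = prv D p') +
         (if c then snd (\<rho> p') * fst (\<rho> q') + snd (\<rho> q') * fst (\<rho> p)
          else snd (\<rho> p') * fst (\<rho> p) * fst (\<rho> q') + snd (\<rho> q')) * of_bool (y = prv D p)
       else arcmat \<rho> D x y) - of_bool (x = y))"
      unfolding arcmat_def
      by (rule bigon_core[where op = opp and a = "\<lambda>x. fst (\<rho> x)" and b = "\<lambda>x. snd (\<rho> x)"
            and pr = "prv D" and S = "passages D"])
        (fact finite_passages pq(1) d pr pr' pr'' o' that(3,4) prv_passages[OF s] disjI2[OF oth])+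
    then show ?thesis unfolding that R_def by (simp only: mult_1_left mult_zero_left add_0_right)
  qed
  have "fst (r p) * fst (r q) = 1 \<and> fst (r p') * fst (r q') = 1 \<and> snd (r p) = 0 \<and> snd (r q) = 0 \<and>
      (if c then snd (r p') * fst (r q') + snd (r q') * fst (r p)
        else snd (r p') * fst (r p) * fst (r q') + snd (r q')) = 0"
  proof -
    define \<epsilon> where "\<epsilon> = strand_sign p"
    have sg: "strand_sign p = \<epsilon>" "strand_sign q = - \<epsilon>" using sn
      by (cases "snd p"; cases "snd q"; simp add: \<epsilon>_def strand_sign_def)+
    show ?thesis
    proof (cases "l p")
      case (Some y)
      then have "label_rel l D p = (vpow y \<epsilon>, 0)" "label_rel l D q = (vpow y (- \<epsilon>), 0)"
        "label_rel l D (opp p) = (vpow y (- \<epsilon>), 0)" "label_rel l D (opp q) = (vpow y \<epsilon>, 0)"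
        using l sg by (simp_all add: label_rel_Some)
      then show ?thesis using o unfolding r_def by (cases c) simp_all
    next
      case None
      then have ov: "is_over D p" "is_over D q" using l(4) by auto
      have "label_rel l D p = (vpow Vs \<epsilon>, 0)" "label_rel l D q = (vpow Vs (- \<epsilon>), 0)"
        "label_rel l D (opp p) = (vpow Vt \<epsilon>, 1 - vpow Vs \<epsilon> * vpow Vt \<epsilon>)"
        "label_rel l D (opp q) = (vpow Vt (- \<epsilon>), 1 - vpow Vs (- \<epsilon>) * vpow Vt (- \<epsilon>))"
        using l None ov sg label_rel_over[of l p D] label_rel_over[of l q D] label_rel_under[of l p D] label_rel_under[of l q D]
        by simp_all
      then show ?thesis using o unfolding r_def by (cases c) (simp_all add: algebra_simps)
    qed
  qed
  then have 1: "sdet ?S (\<lambda>x y. arcmat r D x y - of_bool (x = y)) = sdet (?S - {p, p'}) (R r)"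
    by (intro key) auto
  have "r' x = (1, 0)" if "x \<in> ?V" for x using that r'[of x] unfolding V by simp
  then have 2: "sdet ?S (\<lambda>x y. arcmat r' D x y - of_bool (x = y)) = sdet (?S - {p, p'}) (R r')"
    by (intro key) auto
  have "sdet (?S - {p, p'}) (R r) = sdet (?S - {p, p'}) (R r')"
  proof (rule sdet_cong)
    fix x y assume "x \<in> ?S - {p, p'}"
    then have "x \<noteq> q \<Longrightarrow> x \<noteq> q' \<Longrightarrow> r' x = r x"
      using r'[of x] V[of x] unfolding r_def by auto
    then show "R r x y = R r' x y" by (simp add: R_def arcmat_def)
  qed simp
  then show ?thesis using 1 2 False unfolding r_def arc_det_def by simp
qed

section \<open>Triangles\<close>

lemma transports_map:
  assumes s: "simple D" and inj: "inj_on f (passages D)" and c: "comps D' = map (map f) (comps D)"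
  shows "transports f D D'"
proof -
  have "concat (comps D') = map f (concat (comps D))" by (simp add: c map_concat)
  then have "simple D'" using s inj by (simp add: simple_def distinct_map passages_def)
  moreover have "succs D' = map_prod f f ` succs D"
    by (simp add: succs_def c cpairs_map image_UN)
  moreover have "[] \<in> set (comps D') \<longleftrightarrow> [] \<in> set (comps D)" by (auto simp: c)
  ultimately show ?thesis using s inj by (simp add: transports_def)
qed

text \<open>The letter map inside \<open>swap_along\<close>. It is an involution if no arc of
  \<open>P\<close> starts at a passage where one of them ends; then the move is a renaming of
  passages.\<close>

definition swap_ends :: "passage set \<Rightarrow> diagram \<Rightarrow> passage \<Rightarrow> passage" where
  "swap_ends P D p = (if p \<in> P then nxt D p else if p \<in> nxt D ` P then prv D p else p)"

lemma swap_ends_simps: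
  assumes "simple D" "P \<subseteq> passages D" "P \<inter> nxt D ` P = {}"
  shows "p \<in> P \<Longrightarrow> swap_ends P D p = nxt D p" "p \<in> P \<Longrightarrow> swap_ends P D (nxt D p) = p"
    "p \<notin> P \<Longrightarrow> p \<notin> nxt D ` P \<Longrightarrow> swap_ends P D p = p"
    "swap_ends P D (swap_ends P D p) = p"
proof -
  show 1: "swap_ends P D p = nxt D p" if "p \<in> P" for p using that by (simp add: swap_ends_def)
  show 2: "swap_ends P D (nxt D p) = p" if "p \<in> P" for p
    using that assms(3) prv_nxt[OF assms(1), of p] assms(2) by (auto simp: swap_ends_def)
  show 3: "swap_ends P D p = p" if "p \<notin> P" "p \<notin> nxt D ` P" for p using that by (simp add: swap_ends_def)
  show "swap_ends P D (swap_ends P D p) = p"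
  proof (cases "p \<in> P")
    case True
    then show ?thesis by (simp add: 1 2)
  next
    case np: False
    show ?thesis
    proof (cases "p \<in> nxt D ` P")
      case True
      then obtain q where "q \<in> P" "p = nxt D q" by blast
      then show ?thesis by (simp add: 1 2)
    next
      case False
      then show ?thesis using np by (simp add: 3)
    qed
  qed
qed

lemma swap_ends_transports:
  assumes "simple D" "P \<subseteq> passages D" "P \<inter> nxt D ` P = {}"
  shows "transports (swap_ends P D) D (swap_along P D)"
proof (rule transports_map[OF assms(1)])
  show "inj_on (swap_ends P D) (passages D)"
    by (rule inj_on_inverseI[where g = "swap_ends P D"]) (rule swap_ends_simps(4)[OF assms])
  show "comps (swap_along P D) = map (map (swap_ends P D)) (comps D)"
    by (simp add: swap_along_def swap_ends_def[abs_def])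
qed

text \<open>
  A triangle with strands \<open>t\<close>, \<open>m\<close>, \<open>b\<close>: the strand \<open>t\<close> runs through the passages
  \<open>X\<close> (crossing \<open>m\<close>) and \<open>Y\<close> (crossing \<open>b\<close>), and \<open>Z\<close> is the passage of \<open>m\<close> that crosses \<open>b\<close>.
  The flags tell whether \<open>t\<close>, \<open>m\<close>, \<open>b\<close> meet first the strand \<open>m\<close>, \<open>t\<close>, \<open>t\<close>.  The last two
  conditions relate the directions of the three strands in the plane.
\<close>

definition triangle_at :: "diagram \<Rightarrow> passage set \<Rightarrow> passage \<Rightarrow> passage \<Rightarrow> passage \<Rightarrow> bool \<Rightarrow> bool \<Rightarrow> bool \<Rightarrow> bool" where
  "triangle_at D P X Y Z f f' f'' \<longleftrightarrow>
     {X, Y, Z} \<subseteq> passages D \<and> distinct [fst X, fst Y, fst Z] \<and>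
     P = {if f then X else Y, if f' then opp X else Z, if f'' then opp Y else opp Z} \<and>
     (if f then nxt D X = Y else nxt D Y = X) \<and>
     (if f' then nxt D (opp X) = Z else nxt D Z = opp X) \<and>
     (if f'' then nxt D (opp Y) = opp Z else nxt D (opp Z) = opp Y) \<and>
     (snd X = snd Y \<longleftrightarrow> f' = f'') \<and> (snd Y = snd Z \<longleftrightarrow> f = f')"

lemma triangle_atD:
  assumes "well_formed D" "triangle_at D P X Y Z f f' f''"
  shows "P \<subseteq> passages D" "nxt D ` P = {if f then Y else X, if f' then Z else opp X, if f'' then opp Z else opp Y}"
    "P \<union> nxt D ` P = {X, Y, opp X, Z, opp Y, opp Z}" "P \<inter> nxt D ` P = {}"
    "distinct [X, Y, opp X, Z, opp Y, opp Z]"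
proof -
  have P: "P = {if f then X else Y, if f' then opp X else Z, if f'' then opp Y else opp Z}"
    using assms(2) by (simp add: triangle_at_def)
  show d: "distinct [X, Y, opp X, Z, opp Y, opp Z]"
    using assms(2) unfolding triangle_at_def by (auto dest: arg_cong[where f = fst])
  show "P \<subseteq> passages D"
    using assms well_formedD(2)[OF assms(1)] unfolding P triangle_at_def by auto
  show n: "nxt D ` P = {if f then Y else X, if f' then Z else opp X, if f'' then opp Z else opp Y}"
    using assms(2) unfolding P triangle_at_def by auto
  show "P \<union> nxt D ` P = {X, Y, opp X, Z, opp Y, opp Z}"
    unfolding n unfolding P by auto
  show "P \<inter> nxt D ` P = {}" unfolding n unfolding P using d by auto
qed

text \<open>The three coefficients that \<open>triangle_core\<close> produces do not change when all
  three flags are negated. Here \<open>e1\<close>, \<open>e2\<close>, \<open>e3\<close> stand for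
  the signs of the crossings; their relations \<open>e\<close> with the flags, which express that
  the triangle lies in the plane, leave 16 of the 64 combinations.\<close>

lemma braid_algebra:
  fixes s s' t t' :: "'a::comm_ring_1"
  assumes s: "s * s' = 1" and t: "t * t' = 1"
    and e: "e2 = (e1 = (f' = f''))" "e3 = (e2 = (f = f'))"
  defines "o1 \<equiv> if e1 then s else s'" and "o2 \<equiv> if e2 then s else s'" and "o3 \<equiv> if e3 then s else s'"
    and "u1 \<equiv> if e1 then t else t'" and "u2 \<equiv> if e2 then t else t'" and "u3 \<equiv> if e3 then t else t'"
  defines "k1 \<equiv> 1 - o1 * u1" and "k2 \<equiv> 1 - o2 * u2" and "k3 \<equiv> 1 - o3 * u3"
  shows "k1 * (if f then 1 else o2) * (if f' then o3 else 1) = k1 * (if f then o2 else 1) * (if f' then 1 else o3)"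
    "k3 * (if f' then u1 else 1) * (if f'' then 1 else u2) = k3 * (if f' then 1 else u1) * (if f'' then u2 else 1)"
    "k2 * (if f then o1 else 1) * (if f'' then u3 else 1) +
      k3 * (if f' then k1 * (if f then 1 else o2) else 0) * (if f'' then 1 else u2) =
     k2 * (if f then 1 else o1) * (if f'' then 1 else u3) +
      k3 * (if f' then 0 else k1 * (if f then o2 else 1)) * (if f'' then u2 else 1)"
proof -
  have s2: "s' * s = 1" "s * (s' * x) = x" "s' * (s * x) = x" for x
    using s by (simp_all add: mult.assoc[symmetric] mult.commute)
  have t2: "t' * t = 1" "t * (t' * x) = x" "t' * (t * x) = x" for x
    using t by (simp_all add: mult.assoc[symmetric] mult.commute)
  note defs = o1_def o2_def o3_def u1_def u2_def u3_def k1_def k2_def k3_def e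
  note st = s t s2 t2
  show "k1 * (if f then 1 else o2) * (if f' then o3 else 1) = k1 * (if f then o2 else 1) * (if f' then 1 else o3)"
    by (cases f; cases f'; cases f''; cases e1; simp add: defs algebra_simps st)
  show "k3 * (if f' then u1 else 1) * (if f'' then 1 else u2) = k3 * (if f' then 1 else u1) * (if f'' then u2 else 1)"
    by (cases f; cases f'; cases f''; cases e1; simp add: defs algebra_simps st)
  show "k2 * (if f then o1 else 1) * (if f'' then u3 else 1) +
      k3 * (if f' then k1 * (if f then 1 else o2) else 0) * (if f'' then 1 else u2) =
     k2 * (if f then 1 else o1) * (if f'' then 1 else u3) +
      k3 * (if f' then 0 else k1 * (if f then o2 else 1)) * (if f'' then u2 else 1)"
    by (cases f; cases f'; cases f''; cases e1; simp add: defs algebra_simps st)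
qed

lemma swap_ends_triangle:
  assumes D: "well_formed D" and T: "triangle_at D P X Y Z f f' f''"
  shows "swap_ends P D X = Y" "swap_ends P D Y = X" "swap_ends P D (opp X) = Z" "swap_ends P D Z = opp X"
    "swap_ends P D (opp Y) = opp Z" "swap_ends P D (opp Z) = opp Y"
proof -
  note TD = triangle_atD[OF D T]
  note sw = swap_ends_simps[OF well_formedD(1)[OF D] TD(1,4)]
  have P: "P = {if f then X else Y, if f' then opp X else Z, if f'' then opp Y else opp Z}" and
    n: "if f then nxt D X = Y else nxt D Y = X" "if f' then nxt D (opp X) = Z else nxt D Z = opp X"
      "if f'' then nxt D (opp Y) = opp Z else nxt D (opp Z) = opp Y"
    using T by (simp_all add: triangle_at_def)
  have m: "(if f then X else Y) \<in> P" "(if f' then opp X else Z) \<in> P" "(if f'' then opp Y else opp Z) \<in> P"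
    unfolding P by simp_all
  show "swap_ends P D X = Y" "swap_ends P D Y = X"
    using sw(1,2)[OF m(1)] n(1) by (cases f; simp)+
  show "swap_ends P D (opp X) = Z" "swap_ends P D Z = opp X"
    using sw(1,2)[OF m(2)] n(2) by (cases f'; simp)+
  show "swap_ends P D (opp Y) = opp Z" "swap_ends P D (opp Z) = opp Y"
    using sw(1,2)[OF m(3)] n(3) by (cases f''; simp)+
qed

text \<open>Both determinants are reduced by \<open>triangle_core\<close> over the passages of
  \<open>D\<close>: the old one with \<open>opp\<close>, the new one with the conjugated pairing and
  negated flags. Then \<open>A\<close>, \<open>B\<close>, \<open>C\<close> match the coefficients of
  the reduced rows.\<close>

lemma arc_det_triangle_coeffs:
  assumes D: "well_formed D" and T: "triangle_at D P X Y Z f f' f''"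
    and r: "r X = (o1, 0)" "r (opp X) = (u1, k1)" "r Y = (o2, 0)" "r (opp Y) = (u2, k2)"
      "r Z = (o3, 0)" "r (opp Z) = (u3, k3)"
    and A: "k1 * (if f then 1 else o2) * (if f' then o3 else 1) = k1 * (if f then o2 else 1) * (if f' then 1 else o3)"
    and B: "k3 * (if f' then u1 else 1) * (if f'' then 1 else u2) = k3 * (if f' then 1 else u1) * (if f'' then u2 else 1)"
    and C: "k2 * (if f then o1 else 1) * (if f'' then u3 else 1) +
      k3 * (if f' then k1 * (if f then 1 else o2) else 0) * (if f'' then 1 else u2) =
     k2 * (if f then 1 else o1) * (if f'' then 1 else u3) +
      k3 * (if f' then 0 else k1 * (if f then o2 else 1)) * (if f'' then u2 else 1)"
  shows "arc_det r (swap_along P D) = arc_det r D"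
proof (cases "[] \<in> set (comps D)")
  case True
  then have "[] \<in> set (comps (swap_along P D))" by (force simp: swap_along_def)
  with True show ?thesis by (simp add: arc_det_def)
next
  case False
  let ?S = "passages D" and ?W = "{X, Y, opp X, Z, opp Y, opp Z}"
  let ?\<sigma> = "swap_ends P D"
  have s: "simple D" by (rule well_formedD(1)[OF D])
  note TD = triangle_atD[OF D T]
  note sw = swap_ends_simps[OF s TD(1,4)]
  have t: "transports ?\<sigma> D (swap_along P D)" by (rule swap_ends_transports[OF s TD(1,4)])
  have W: "?W \<subseteq> ?S" using T well_formedD(2)[OF D] by (auto simp: triangle_at_def)
  have dW: "distinct [X, Y, opp X, Z, opp Y, opp Z]" by (rule TD(5))
  have \<sigma>: "?\<sigma> X = Y" "?\<sigma> Y = X" "?\<sigma> (opp X) = Z" "?\<sigma> Z = opp X" "?\<sigma> (opp Y) = opp Z" "?\<sigma> (opp Z) = opp Y"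
    by (rule swap_ends_triangle[OF D T])+
  have \<sigma>_id: "?\<sigma> x = x" if "x \<notin> ?W" for x
    using that sw(3)[of x] TD(3) by blast
  have opp_W: "opp x \<in> ?S - ?W" if "x \<in> ?S - ?W" for x
    using that well_formedD(2)[OF D, of x] by (auto simp: opp_eq_iff)
  \<comment> \<open>The crossing partner in the new diagram, expressed by the old positions.\<close>
  define o' where "o' = (\<lambda>x. ?\<sigma> (opp (?\<sigma> x)))"
  have \<sigma>S: "?\<sigma> x \<in> ?S" if "x \<in> ?S" for x
    using that \<sigma> \<sigma>_id[of x] W by (cases "x \<in> ?W") auto
  have o'_S: "o' x \<in> ?S \<and> ?\<sigma> (o' x) = opp (?\<sigma> x)" if "x \<in> ?S" for x
    unfolding o'_def using that \<sigma>S well_formedD(2)[OF D] sw(4) by auto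
  have o'_W: "o' x \<in> ?S - ?W" if "x \<in> ?S - ?W" for x
    using that \<sigma>_id[of x] \<sigma>_id[of "opp x"] opp_W[OF that] by (simp add: o'_def)
  define p where "p = (if f then X else Y)"
  define q where "q = (if f then Y else X)"
  define p' where "p' = (if f' then opp X else Z)"
  define q' where "q' = (if f' then Z else opp X)"
  define p'' where "p'' = (if f'' then opp Y else opp Z)"
  define q'' where "q'' = (if f'' then opp Z else opp Y)"
  note pq = p_def q_def p'_def q'_def p''_def q''_def
  have V: "{p, q, p', q', p'', q''} = ?W" unfolding pq by auto
  have d: "distinct [p, q, p', q', p'', q'']"
    using dW unfolding pq by (cases f; cases f'; cases f''; simp; blast)
  have nx: "nxt D p = q" "nxt D p' = q'" "nxt D p'' = q''"
    using T unfolding triangle_at_def pq by auto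
  have inS: "p \<in> ?S" "p' \<in> ?S" "p'' \<in> ?S" using W V by blast+
  have pr: "prv D q = p" "prv D q' = p'" "prv D q'' = p''"
    using prv_nxt[OF s inS(1)] prv_nxt[OF s inS(2)] prv_nxt[OF s inS(3)] nx by simp_all
  have pr': "x = q" if "x \<in> ?S" "prv D x = p" for x using nxt_prv[OF s that(1)] that(2) nx by simp
  have pr'': "x = q'" if "x \<in> ?S" "prv D x = p'" for x using nxt_prv[OF s that(1)] that(2) nx by simp
  have pr''': "x = q''" if "x \<in> ?S" "prv D x = p''" for x using nxt_prv[OF s that(1)] that(2) nx by simp
  have sel: "(if f then p else q) = X" "(if f then q else p) = Y"
    "(if f' then p' else q') = opp X" "(if f' then q' else p') = Z"
    "(if f'' then p'' else q'') = opp Y" "(if f'' then q'' else p'') = opp Z"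
    "(if \<not> f then p else q) = Y" "(if \<not> f then q else p) = X"
    "(if \<not> f' then p' else q') = Z" "(if \<not> f' then q' else p') = opp X"
    "(if \<not> f'' then p'' else q'') = opp Z" "(if \<not> f'' then q'' else p'') = opp Y"
    by (simp_all add: pq)
  have pq_cases: "p = X \<or> p = Y" "q = X \<or> q = Y" by (simp_all add: pq)
  define R where "R = (\<lambda>x y.
    (if x = q then o1 * o2 * of_bool (y = prv D p)
     else if x = q' then u1 * o3 * of_bool (y = prv D p') +
       k1 * (if f then 1 else o2) * (if f' then o3 else 1) * of_bool (y = prv D p)
     else if x = q'' then u2 * u3 * of_bool (y = prv D p'') +
       k3 * (if f' then u1 else 1) * (if f'' then 1 else u2) * of_bool (y = prv D p') +
       (k2 * (if f then o1 else 1) * (if f'' then u3 else 1) +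
        k3 * (if f' then k1 * (if f then 1 else o2) else 0) * (if f'' then 1 else u2))
         * of_bool (y = prv D p)
     else arcmat r D x y) - of_bool (x = y))"
  have "sdet ?S (\<lambda>x y. arcmat r D x y - of_bool (x = y)) = - sdet (?S - {p, p', p''}) R"
    unfolding arcmat_def R_def
  proof (rule triangle_core[where op = opp and a = "\<lambda>x. fst (r x)" and b = "\<lambda>x. snd (r x)" and pr = "prv D"],
      unfold V sel)
    show "distinct [p, q, p', q', p'', q'']" by (rule d)
    show "snd (r p) = 0" "snd (r q) = 0" using pq_cases r by auto
    show "snd (r x) = 0 \<or> opp x \<in> ?S - ?W" if "x \<in> ?S - ?W" for x using opp_W[OF that] ..
  qed (fact finite_passages W pr pr' pr'' pr''' | simp add: r)+
  also have "sdet (?S - {p, p', p''}) R = sdet (?S - {p, p', p''}) (\<lambda>x y.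
    (if x = q then o1 * o2 * of_bool (y = prv D p)
     else if x = q' then u1 * o3 * of_bool (y = prv D p') +
       k1 * (if \<not> f then 1 else o2) * (if \<not> f' then o3 else 1) * of_bool (y = prv D p)
     else if x = q'' then u2 * u3 * of_bool (y = prv D p'') +
       k3 * (if \<not> f' then u1 else 1) * (if \<not> f'' then 1 else u2) * of_bool (y = prv D p') +
       (k2 * (if \<not> f then o1 else 1) * (if \<not> f'' then u3 else 1) +
        k3 * (if \<not> f' then k1 * (if \<not> f then 1 else o2) else 0) * (if \<not> f'' then 1 else u2))
         * of_bool (y = prv D p)
     else fst (r (?\<sigma> x)) * of_bool (y = prv D x) + snd (r (?\<sigma> x)) * of_bool (y = prv D (o' x))) - of_bool (x = y))"
  proof (rule sdet_cong)
    fix x y assume xy: "x \<in> ?S - {p, p', p''}"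
    have neg: "(if \<not> c then a else b) = (if c then b else a)" for c and a b :: laurent by simp
    have ite: "(if x = q then a else if x = q' then b else if x = q'' then c else d)
        = (if x = q then a else if x = q' then b else if x = q'' then c else d')"
      if "x \<noteq> q \<Longrightarrow> x \<noteq> q' \<Longrightarrow> x \<noteq> q'' \<Longrightarrow> d = d'" for a b c d d' :: laurent
      using that by simp
    have "arcmat r D x y = fst (r (?\<sigma> x)) * of_bool (y = prv D x) + snd (r (?\<sigma> x)) * of_bool (y = prv D (o' x))"
      if "x \<noteq> q" "x \<noteq> q'" "x \<noteq> q''"
    proof -
      have xW: "x \<in> ?S - ?W" using that xy V by auto
      have "opp x \<notin> ?W" using opp_W[OF xW] by simp
      then show ?thesis using \<sigma>_id[of x] \<sigma>_id[of "opp x"] xW by (simp add: arcmat_def o'_def)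
    qed
    then show "R x y =
    (if x = q then o1 * o2 * of_bool (y = prv D p)
     else if x = q' then u1 * o3 * of_bool (y = prv D p') +
       k1 * (if \<not> f then 1 else o2) * (if \<not> f' then o3 else 1) * of_bool (y = prv D p)
     else if x = q'' then u2 * u3 * of_bool (y = prv D p'') +
       k3 * (if \<not> f' then u1 else 1) * (if \<not> f'' then 1 else u2) * of_bool (y = prv D p') +
       (k2 * (if \<not> f then o1 else 1) * (if \<not> f'' then u3 else 1) +
        k3 * (if \<not> f' then k1 * (if \<not> f then 1 else o2) else 0) * (if \<not> f'' then 1 else u2))
         * of_bool (y = prv D p)
     else fst (r (?\<sigma> x)) * of_bool (y = prv D x) + snd (r (?\<sigma> x)) * of_bool (y = prv D (o' x))) - of_bool (x = y)"
      unfolding R_def A B C neg by (intro arg_cong[where f = "\<lambda>z. z - of_bool (x = y)"] ite)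
  qed simp
  also have "- \<dots> = sdet ?S (\<lambda>x y. fst (r (?\<sigma> x)) * of_bool (y = prv D x) +
      snd (r (?\<sigma> x)) * of_bool (y = prv D (o' x)) - of_bool (x = y))"
  proof (rule sym, rule triangle_core[where op = o' and a = "\<lambda>x. fst (r (?\<sigma> x))" and b = "\<lambda>x. snd (r (?\<sigma> x))"
      and pr = "prv D"], unfold V sel)
    show "distinct [p, q, p', q', p'', q'']" by (rule d)
    show "snd (r (?\<sigma> p)) = 0" "snd (r (?\<sigma> q)) = 0" using pq_cases r \<sigma> by auto
    show "snd (r (?\<sigma> x)) = 0 \<or> o' x \<in> ?S - ?W" if "x \<in> ?S - ?W" for x using o'_W[OF that] ..
  qed (fact finite_passages W pr pr' pr'' pr''' | simp add: r \<sigma> o'_def)+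
  finally show ?thesis using False transports_arc_det[OF t o'_S, of r] by (simp add: arc_det_def)
qed

lemma strand_eq_iff: "a = b \<longleftrightarrow> (a = SW \<longleftrightarrow> b = SW)" for a b :: strand
  by (cases a; cases b) auto

text \<open>\<open>triangle_at\<close> knows nothing of heights, so its strands may be named in any
  order. This exchange and that of \<open>t\<close> and \<open>m\<close> generate all six
  orders.\<close>

lemma triangle_at_swap_mb:
  assumes T: "triangle_at D P X Y Z f f' f''" and D: "well_formed D"
  shows "triangle_at D P Y X (opp Z) (\<not> f) f'' f'"
proof -
  note T' = T[unfolded triangle_at_def]
  have sn: "(snd X = SW) = (snd Y = SW) \<longleftrightarrow> f' = f''" "(snd Y = SW) = (snd Z = SW) \<longleftrightarrow> f = f'"
    using T' strand_eq_iff[of "snd X" "snd Y"] strand_eq_iff[of "snd Y" "snd Z"] by argo+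
  show ?thesis unfolding triangle_at_def
  proof (intro conjI)
    show "{Y, X, opp Z} \<subseteq> passages D" using T' well_formedD(2)[OF D, of Z] by simp
    show "distinct [fst Y, fst X, fst (opp Z)]" using T' by auto
    show "P = {if \<not> f then Y else X, if f'' then opp Y else opp Z, if f' then opp X else opp (opp Z)}"
      using T' by (auto simp: insert_commute)
    show "if \<not> f then nxt D Y = X else nxt D X = Y"
      "if f'' then nxt D (opp Y) = opp Z else nxt D (opp Z) = opp Y"
      "if f' then nxt D (opp X) = opp (opp Z) else nxt D (opp (opp Z)) = opp X"
      using T' by simp_all
    show "(snd Y = snd X) = (f'' = f')" using T' by auto
    have "snd (opp Z) = SW \<longleftrightarrow> snd Z \<noteq> SW" by simp
    then show "(snd X = snd (opp Z)) = ((\<not> f) = f'')" using sn strand_eq_iff[of "snd X" "snd (opp Z)"] by argo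
  qed
qed

lemma triangle_at_swap_tm:
  assumes T: "triangle_at D P X Y Z f f' f''" and D: "well_formed D"
  shows "triangle_at D P (opp X) Z Y f' f (\<not> f'')"
proof -
  note T' = T[unfolded triangle_at_def]
  have sn: "(snd X = SW) = (snd Y = SW) \<longleftrightarrow> f' = f''" "(snd Y = SW) = (snd Z = SW) \<longleftrightarrow> f = f'"
    using T' strand_eq_iff[of "snd X" "snd Y"] strand_eq_iff[of "snd Y" "snd Z"] by argo+
  show ?thesis unfolding triangle_at_def
  proof (intro conjI)
    show "{opp X, Z, Y} \<subseteq> passages D" using T' well_formedD(2)[OF D, of X] by simp
    show "distinct [fst (opp X), fst Z, fst Y]" using T' by auto
    show "P = {if f' then opp X else Z, if f then opp (opp X) else Y, if \<not> f'' then opp Z else opp Y}"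
      using T' by (auto simp: insert_commute)
    show "if f' then nxt D (opp X) = Z else nxt D Z = opp X"
      "if f then nxt D (opp (opp X)) = Y else nxt D Y = opp (opp X)"
      "if \<not> f'' then nxt D (opp Z) = opp Y else nxt D (opp Y) = opp Z"
      using T' by simp_all
    show "(snd Z = snd Y) = (f' = f)" using T' by auto
    have "snd (opp X) = SW \<longleftrightarrow> snd X \<noteq> SW" by simp
    then show "(snd (opp X) = snd Z) = (f = (\<not> f''))" using sn strand_eq_iff[of "snd (opp X)" "snd Z"] by argo
  qed
qed

text \<open>Three cases: no relation has a mixed term, and the identities hold at once; (B) holds at
  all crossings with \<open>t\<close> above \<open>m\<close> above \<open>b\<close>, which is
  \<open>braid_algebra\<close>; or (B) holds only between \<open>m\<close> and \<open>b\<close>,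
  while \<open>t\<close> meets both of them with the same variable.\<close>

lemma arc_det_triangle:
  assumes D: "well_formed D" and T: "triangle_at D P X Y Z f f' f''"
    and l: "l (opp X) = l X" "l (opp Y) = l Y" "l (opp Z) = l Z"
    and lab: "l X \<noteq> None \<and> l Y \<noteq> None \<and> l Z \<noteq> None
      \<or> l X = None \<and> l Y = None \<and> l Z = None \<and> is_over D X \<and> is_over D Y \<and> is_over D Z
      \<or> l Z = None \<and> is_over D Z \<and> l X \<noteq> None \<and> l Y = l X"
  shows "arc_det (label_rel l D) (swap_along P D) = arc_det (label_rel l D) D"
proof -
  have sg: "strand_sign X = strand_sign Y \<longleftrightarrow> f' = f''" "strand_sign Y = strand_sign Z \<longleftrightarrow> f = f'"
    using T unfolding triangle_at_def strand_sign_def by (cases "snd X"; cases "snd Y"; cases "snd Z"; simp)+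
  have pm: "strand_sign x = 1 \<or> strand_sign x = - 1" for x by (simp add: strand_sign_def)
  consider y1 y2 y3 where "l X = Some y1" "l Y = Some y2" "l Z = Some y3"
    | "l X = None" "l Y = None" "l Z = None" "is_over D X" "is_over D Y" "is_over D Z"
    | y where "l Z = None" "is_over D Z" "l X = Some y" "l Y = Some y"
    using lab by fastforce
  then show ?thesis
  proof cases
    case 1
    show ?thesis
      by (rule arc_det_triangle_coeffs[OF D T], (rule label_rel_Some; simp add: 1 l)+) simp_all
  next
    case 2
    define e1 where "e1 \<longleftrightarrow> strand_sign X = 1"
    define e2 where "e2 \<longleftrightarrow> strand_sign Y = 1"
    define e3 where "e3 \<longleftrightarrow> strand_sign Z = 1"
    have "e2 = (e1 = (f' = f''))" "e3 = (e2 = (f = f'))"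
      using sg pm[of X] pm[of Y] pm[of Z] unfolding e1_def e2_def e3_def by auto
    note B = braid_algebra[OF vpow_inverse(1)[of Vs 1] vpow_inverse(1)[of Vt 1] this]
    have v: "vpow v (strand_sign X) = (if e1 then vpow v 1 else vpow v (- 1))"
      "vpow v (strand_sign Y) = (if e2 then vpow v 1 else vpow v (- 1))"
      "vpow v (strand_sign Z) = (if e3 then vpow v 1 else vpow v (- 1))" for v
      using pm[of X] pm[of Y] pm[of Z] unfolding e1_def e2_def e3_def by auto
    have o: "label_rel l D X = (vpow Vs (strand_sign X), 0)" "label_rel l D Y = (vpow Vs (strand_sign Y), 0)"
      "label_rel l D Z = (vpow Vs (strand_sign Z), 0)"
      by (rule label_rel_over; simp add: 2)+
    have u: "label_rel l D (opp X) = (vpow Vt (strand_sign X), 1 - vpow Vs (strand_sign X) * vpow Vt (strand_sign X))"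
      "label_rel l D (opp Y) = (vpow Vt (strand_sign Y), 1 - vpow Vs (strand_sign Y) * vpow Vt (strand_sign Y))"
      "label_rel l D (opp Z) = (vpow Vt (strand_sign Z), 1 - vpow Vs (strand_sign Z) * vpow Vt (strand_sign Z))"
      by (rule label_rel_under; simp add: 2 l)+
    show ?thesis
      by (rule arc_det_triangle_coeffs[OF D T o(1) u(1) o(2) u(2) o(3) u(3)]; unfold v; fact B)
  next
    case 3
    have o: "label_rel l D X = (vpow y (strand_sign X), 0)" "label_rel l D Y = (vpow y (strand_sign Y), 0)"
      "label_rel l D (opp X) = (vpow y (strand_sign (opp X)), 0)" "label_rel l D (opp Y) = (vpow y (strand_sign (opp Y)), 0)"
      by (rule label_rel_Some; simp add: 3 l)+
    have z: "label_rel l D Z = (vpow Vs (strand_sign Z), 0)"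
      by (rule label_rel_over) (simp_all add: 3)
    have z': "label_rel l D (opp Z) = (vpow Vt (strand_sign Z), 1 - vpow Vs (strand_sign Z) * vpow Vt (strand_sign Z))"
      by (rule label_rel_under) (simp_all add: 3 l)
    \<comment> \<open>The factors which \<open>t\<close> causes on \<open>m\<close> and
      \<open>b\<close> have to be equal if \<open>f' = f''\<close> and inverse to each other
      otherwise; the planar condition on the strands provides exactly this.\<close>
    have YX: "strand_sign Y = (if f' = f'' then strand_sign X else - strand_sign X)"
      using sg(1) pm[of X] pm[of Y] by auto
    show ?thesis
      by (rule arc_det_triangle_coeffs[OF D T o(1,3,2,4) z z']) (auto simp: YX mult.assoc)
  qed
qed

text \<open>Renames the strands to fit \<open>arc_det_triangle\<close>. If all labels are
  \<open>None\<close>, the strand that is over twice becomes \<open>t\<close>; if just one is, its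
  crossing is moved to \<open>Z\<close>. In either case \<open>m\<close> and \<open>b\<close> are
  exchanged when \<open>Z\<close> passes under.\<close>

lemma arc_det_triangle_labels:
  assumes D: "well_formed D" and T: "triangle_at D P X Y Z f f' f''"
    and l: "\<And>p. p \<in> passages D \<Longrightarrow> l (opp p) = l p"
    and classical: "\<And>p. p \<in> passages D \<Longrightarrow> l p = None \<Longrightarrow> \<not> is_virt D p"
    and lab: "l X = None \<Longrightarrow> l Y = l Z" "l Y = None \<Longrightarrow> l X = l Z" "l Z = None \<Longrightarrow> l X = l Y"
    and over: "l X = None \<Longrightarrow> l Y = None \<Longrightarrow> l Z = None \<Longrightarrow> \<exists>p \<in> P. is_over D p \<and> is_over D (nxt D p)"
  shows "arc_det (label_rel l D) (swap_along P D) = arc_det (label_rel l D) D"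
proof -
  have inS: "{X, Y, Z} \<subseteq> passages D" if "triangle_at D P X Y Z f f' f''" for X Y Z f f' f''
    using that by (simp add: triangle_at_def)
  have over': "is_over D (opp p)" if "p \<in> passages D" "l p = None" "\<not> is_over D p" for p
    using is_over_opp[OF classical[OF that(1,2)]] that(3) by simp
  have aux: ?thesis
    if T: "triangle_at D P X Y Z f f' f''" and "l X \<noteq> None \<and> l Y \<noteq> None \<and> l Z \<noteq> None
      \<or> l X = None \<and> l Y = None \<and> l Z = None \<and> is_over D X \<and> is_over D Y
      \<or> l Z = None \<and> l X \<noteq> None \<and> l Y = l X" for X Y Z f f' f''
  proof (cases "l Z = None \<and> \<not> is_over D Z")
    case False
    show ?thesis
      by (rule arc_det_triangle[OF D T]) (use inS[OF T] l that(2) False in auto)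
  next
    case True
    then have "is_over D (opp Z)" using over' inS[OF T] by simp
    then show ?thesis
      by (intro arc_det_triangle[OF D triangle_at_swap_mb[OF T D]]) (use inS[OF T] l that(2) True in auto)
  qed
  have T1: "triangle_at D P Y X (opp Z) (\<not> f) f'' f'" by (rule triangle_at_swap_mb[OF T D])
  have T2: "triangle_at D P (opp X) Z Y f' f (\<not> f'')" by (rule triangle_at_swap_tm[OF T D])
  have T3: "triangle_at D P (opp Y) (opp Z) X f'' (\<not> f) (\<not> f')" by (rule triangle_at_swap_tm[OF T1 D])
  have lo: "l (opp X) = l X" "l (opp Y) = l Y" "l (opp Z) = l Z" using l inS[OF T] by simp_all
  consider "l X \<noteq> None" "l Y \<noteq> None" "l Z \<noteq> None" | "l X = None" "l Y = None" "l Z = None"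
    | "l X = None" "l Y \<noteq> None" | "l Y = None" "l X \<noteq> None" | "l Z = None" "l X \<noteq> None"
    using lab by metis
  then show ?thesis
  proof cases
    case 1
    then show ?thesis by (intro aux[OF T]) simp
  next
    case 2
    then obtain p where p: "p \<in> P" "is_over D p" "is_over D (nxt D p)" using over by blast
    then have "is_over D X \<and> is_over D Y \<or> is_over D (opp X) \<and> is_over D Z \<or>
        is_over D (opp Y) \<and> is_over D (opp Z)"
      using T unfolding triangle_at_def by (cases f; cases f'; cases f'') auto
    then show ?thesis using 2 lo aux[OF T] aux[OF T2] aux[OF T3] by auto
  next
    case 3
    then show ?thesis using lab(1) lo by (intro aux[OF T3]) auto
  next
    case 4
    then show ?thesis using lab(2) lo by (intro aux[OF T2]) auto
  next
    case 5
    then show ?thesis using lab(3) by (intro aux[OF T]) auto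
  qed
qed

text \<open>
  Along the boundary of a face, \<open>(p, b)\<close> reaches its final crossing by the passage
  \<open>exit\<close> and starts from its initial one by the passage \<open>entry\<close>.
\<close>

definition exit :: "diagram \<Rightarrow> dart \<Rightarrow> passage" where
  "exit D d = (if snd d then nxt D (fst d) else fst d)"

definition entry :: "diagram \<Rightarrow> dart \<Rightarrow> passage" where
  "entry D d = (if snd d then fst d else nxt D (fst d))"

text \<open>The turning rule in usable form: a face boundary leaves a crossing by the other strand,
  and it keeps its direction exactly if it arrives on \<open>SW\<close>. The facts about strand
  types in bigons and triangles are derived from this.\<close>

lemma face_step_passages:
  assumes "well_formed D" "fst d \<in> passages D"
  shows "fst (face_step D d) \<in> passages D"
    "entry D (face_step D d) = opp (exit D d)"
    "snd (exit D d) = SW \<longleftrightarrow> snd d = snd (face_step D d)"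
proof -
  obtain p b where d: "d = (p, b)" by (cases d)
  have p: "p \<in> passages D" using assms(2) d by simp
  have s: "simple D" by (rule well_formedD(1)[OF assms(1)])
  obtain c st where n: "nxt D p = (c, st)" by (cases "nxt D p")
  have "(c, st) \<in> passages D" using nxt_passages[OF s p] n by simp
  then have o: "opp (c, st) \<in> passages D" by (rule well_formedD(2)[OF assms(1)])
  obtain c' st' where p': "p = (c', st')" by (cases p)
  have o': "opp (c', st') \<in> passages D" using well_formedD(2)[OF assms(1) p] p' by simp
  have *: "fst (face_step D d) \<in> passages D \<and> entry D (face_step D d) = opp (exit D d) \<and>
      (snd (exit D d) = SW \<longleftrightarrow> snd d = snd (face_step D d))"
  proof (cases b)
    case True
    then show ?thesis using o prv_passages[OF s o] nxt_prv[OF s o]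
      by (cases st) (simp_all add: d n exit_def entry_def)
  next
    case False
    then show ?thesis using o' prv_passages[OF s o'] nxt_prv[OF s o'] 
      by (cases st') (simp_all add: d p' exit_def entry_def)
  qed
  then show "fst (face_step D d) \<in> passages D" "entry D (face_step D d) = opp (exit D d)"
    "snd (exit D d) = SW \<longleftrightarrow> snd d = snd (face_step D d)" by blast+
qed

lemma entry_exit:
  "snd d \<Longrightarrow> entry D d = fst d \<and> exit D d = nxt D (fst d)"
  "\<not> snd d \<Longrightarrow> exit D d = fst d \<and> entry D d = nxt D (fst d)"
  by (simp_all add: entry_def exit_def)

lemma monogon_face:
  assumes "well_formed D" "d \<in> darts D" "face_step D d = d"
  shows "nxt D (fst d) = opp (fst d)"
proof -
  have "fst d \<in> passages D" using assms(2) by (auto simp: darts_def)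
  from face_step_passages(2)[OF assms(1) this] have "entry D d = opp (exit D d)"
    unfolding assms(3) .
  then show ?thesis by (cases "snd d") (simp_all add: entry_def exit_def opp_eq_iff[symmetric])
qed

text \<open>Around a bigon the direction is kept at both corners or reversed at both, so both are
  reached on the same strand type. As \<open>entry\<close> is \<open>opp\<close> of the preceding
  \<open>exit\<close>, the two ends of an edge then have different types.\<close>

lemma bigon_face:
  assumes "well_formed D" "d \<in> darts D" "face_step D (face_step D d) = d"
  defines "p \<equiv> fst d" and "q \<equiv> nxt D (fst d)"
  shows "snd p \<noteq> snd q" "nxt D (opp p) = opp q \<or> nxt D (opp q) = opp p"
proof -
  define d2 where "d2 = face_step D d"
  have 1: "fst d \<in> passages D" using assms(2) by (auto simp: darts_def)
  have 2: "fst d2 \<in> passages D" unfolding d2_def by (rule face_step_passages(1)[OF assms(1) 1])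
  note s1 = face_step_passages(2,3)[OF assms(1) 1, folded d2_def]
  have cyc: "face_step D d2 = d" using assms(3) by (simp add: d2_def)
  note s2 = face_step_passages(2,3)[OF assms(1) 2, unfolded cyc]
  show "snd p \<noteq> snd q"
  proof -
    have "snd (entry D d) \<noteq> snd (exit D d)"
      using s1 s2 by (cases "snd (exit D d)"; cases "snd (exit D d2)") auto
    then show ?thesis unfolding p_def q_def by (cases "snd d") (auto simp: entry_def exit_def)
  qed
  show "nxt D (opp p) = opp q \<or> nxt D (opp q) = opp p"
    using s1(1) s2(1) unfolding p_def q_def
    by (cases "snd d"; cases "snd d2"; simp add: entry_exit; metis opp_opp)
qed

lemma triangle_face:
  assumes D: "well_formed D" and d: "d \<in> darts D" "face_step D (face_step D (face_step D d)) = d"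
    and P: "P = {fst d, fst (face_step D d), fst (face_step D (face_step D d))}"
    and card: "card (fst ` (P \<union> nxt D ` P)) = 3"
  shows "\<exists>X Y Z f f' f''. triangle_at D P X Y Z f f' f''"
proof -
  define d2 where "d2 = face_step D d"
  define d3 where "d3 = face_step D d2"
  have in1: "fst d \<in> passages D" using d(1) by (auto simp: darts_def)
  have in2: "fst d2 \<in> passages D" unfolding d2_def by (rule face_step_passages(1)[OF D in1])
  have in3: "fst d3 \<in> passages D" unfolding d3_def by (rule face_step_passages(1)[OF D in2])
  have cyc: "face_step D d3 = d" using d(2) by (simp add: d2_def d3_def)
  note s1 = face_step_passages(2,3)[OF D in1, folded d2_def]
  note s2 = face_step_passages(2,3)[OF D in2, folded d3_def]
  note s3 = face_step_passages(2,3)[OF D in3, unfolded cyc]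
  \<comment> \<open>The edges \<open>d\<close>, \<open>d2\<close>, \<open>d3\<close> become the
    strands \<open>t\<close>, \<open>m\<close>, \<open>b\<close>. A positively traversed
    \<open>d\<close> ends at \<open>X\<close>, so \<open>t\<close> meets \<open>X\<close> first
    exactly when \<open>d\<close> is traversed backwards; the other flags arise in the same
    way.\<close>
  define X where "X = exit D d"
  define Y where "Y = entry D d"
  define Z where "Z = exit D d2"
  have ee: "entry D d2 = opp X" "exit D d3 = opp Y" "entry D d3 = opp Z"
    using s1(1) s2(1) s3(1) by (simp_all add: X_def Y_def Z_def)
  have P': "P = {fst d, fst d2, fst d3}" by (simp add: P d2_def d3_def)
  have nP: "nxt D ` P = {nxt D (fst d), nxt D (fst d2), nxt D (fst d3)}" by (simp add: P')
  have pass: "{X, Y, Z} \<subseteq> passages D"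
    using in1 in2 nxt_passages[OF well_formedD(1)[OF D]] by (auto simp: X_def Y_def Z_def entry_def exit_def)
  have st: "{fst d, nxt D (fst d)} = {X, Y}" "{fst d2, nxt D (fst d2)} = {opp X, Z}"
    "{fst d3, nxt D (fst d3)} = {opp Y, opp Z}"
    using ee unfolding X_def Y_def Z_def
    by (cases "snd d"; cases "snd d2"; cases "snd d3"; auto simp: entry_exit)+
  have "P \<union> nxt D ` P = {X, Y} \<union> {opp X, Z} \<union> {opp Y, opp Z}"
    unfolding st[symmetric] nP P' by auto
  then have "fst ` (P \<union> nxt D ` P) = {fst X, fst Y, fst Z}" by auto
  then have "card {fst X, fst Y, fst Z} = 3" using card by simp
  then have dist: "distinct [fst X, fst Y, fst Z]"
    by (auto simp: card_insert_if split: if_splits)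
  have sY: "snd Y = SW \<longleftrightarrow> snd d3 \<noteq> snd d"
    using s3(2) ee(2) by auto
  have sX: "snd X = SW \<longleftrightarrow> snd d = snd d2" using s1(2) by (simp add: X_def)
  have sZ: "snd Z = SW \<longleftrightarrow> snd d2 = snd d3" using s2(2) by (simp add: Z_def)
  have "triangle_at D P X Y Z (\<not> snd d) (snd d2) (\<not> snd d3)"
    unfolding triangle_at_def
  proof (intro conjI)
    show "P = {if \<not> snd d then X else Y, if snd d2 then opp X else Z, if \<not> snd d3 then opp Y else opp Z}"
    proof -
      have "fst d = (if \<not> snd d then X else Y)"
        by (simp add: X_def Y_def entry_exit)
      moreover have "fst d2 = (if snd d2 then opp X else Z)"
        by (simp add: ee(1)[symmetric] Z_def entry_exit)
      moreover have "fst d3 = (if \<not> snd d3 then opp Y else opp Z)"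
        by (simp add: ee(2,3)[symmetric] entry_exit)
      ultimately show ?thesis unfolding P' by (simp only:)
    qed
    show "if \<not> snd d then nxt D X = Y else nxt D Y = X"
      by (simp add: X_def Y_def entry_def exit_def)
    show "if snd d2 then nxt D (opp X) = Z else nxt D Z = opp X"
      using ee(1)[symmetric] by (simp add: Z_def entry_def exit_def)
    show "if \<not> snd d3 then nxt D (opp Y) = opp Z else nxt D (opp Z) = opp Y"
      using ee(2,3)[symmetric] by (simp add: entry_def exit_def)
    show "(snd X = snd Y) = (snd d2 = (\<not> snd d3))" using strand_eq_iff[of "snd X" "snd Y"] sX sY by argo
    show "(snd Y = snd Z) = ((\<not> snd d) = snd d2)" using strand_eq_iff[of "snd Y" "snd Z"] sY sZ by argo
  qed (fact pass dist)+
  then show ?thesis by blast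
qed

section \<open>Invariance under the moves\<close>

lemma snd_opp_eq_iff: "snd (opp p) = snd (opp q) \<longleftrightarrow> snd p = snd q"
  by (cases p; cases q; cases "snd p"; cases "snd q") auto

lemma label_rel_kind: "kind_of D = kind_of D' \<Longrightarrow> label_rel l D = label_rel l D'"
  by (simp add: fun_eq_iff label_rel_def rel_B_def sign_of_def is_over_def split: option.split)

lemma kind_of_simps [simp]:
  "kind_of (delete_crossings C D) = kind_of D" "kind_of (swap_along P D) = kind_of D"
  by (simp_all add: delete_crossings_def swap_along_def)

lemma passages_delete_crossings: "passages (delete_crossings C D) = {p \<in> passages D. fst p \<notin> C}"
  unfolding delete_crossings_delete_passages by auto

lemma simple_delete_crossings: "simple D \<Longrightarrow> simple (delete_crossings C D)"
  unfolding delete_crossings_delete_passages by (rule simple_delete_passages)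

definition isotopic_by :: "(nat \<Rightarrow> nat) \<Rightarrow> diagram \<Rightarrow> diagram \<Rightarrow> bool" where
  "isotopic_by f D D' \<longleftrightarrow> length (comps D') = length (comps D) \<and> inj_on f (crossings D) \<and>
     (\<forall>c \<in> crossings D. kind_of D' (f c) = kind_of D c) \<and>
     (\<forall>i < length (comps D). \<exists>n. comps D' ! i = rotate n (map (map_prod f id) (comps D ! i)))"

lemma isotopic_transports:
  assumes "well_formed D" "well_formed D'" and i: "isotopic_by f D D'"
  shows "transports (map_prod f id) D D'"
proof -
  have len: "length (comps D') = length (comps D)" using i by (simp add: isotopic_by_def)
  have cp: "cpairs (comps D' ! k) = map_prod (map_prod f id) (map_prod f id) ` cpairs (comps D ! k)"
    if "k < length (comps D)" for k
    using i that cpairs_rotate cpairs_map unfolding isotopic_by_def by metis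
  have succs_nth: "succs E = (\<Union>k < length (comps E). cpairs (comps E ! k))" for E
    unfolding succs_def by (force simp: in_set_conv_nth)
  have "succs D' = map_prod (map_prod f id) (map_prod f id) ` succs D"
    unfolding succs_nth len image_UN using cp by simp
  moreover have "inj_on (map_prod f id) (passages D)"
    using i unfolding isotopic_by_def inj_on_def crossings_def by fastforce
  moreover have "[] \<in> set (comps D') \<longleftrightarrow> [] \<in> set (comps D)"
  proof -
    have "comps D' ! k = [] \<longleftrightarrow> comps D ! k = []" if k: "k < length (comps D)" for k
    proof -
      obtain n where "comps D' ! k = rotate n (map (map_prod f id) (comps D ! k))"
        using i k unfolding isotopic_by_def by blast
      then show ?thesis by simp
    qed
    then show ?thesis using len by (auto simp: in_set_conv_nth)
  qed
  ultimately show ?thesis using well_formedD(1)[OF assms(1)] well_formedD(1)[OF assms(2)] by (simp add: transports_def)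
qed

text \<open>The condition on a triangle move without the heights, which have no influence on
  labels.\<close>

definition triangle_kinds :: "diagram \<Rightarrow> passage set \<Rightarrow> bool" where
  "triangle_kinds D P \<longleftrightarrow> (\<forall>p \<in> P \<union> nxt D ` P. \<not> is_virt D p) \<or> (\<exists>p \<in> P. is_virt D p \<and> is_virt D (nxt D p))"

text \<open>A strand with two virtual passages cannot run through the classical crossing of
  \<open>X\<close>, so it is \<open>b\<close>, which meets \<open>Y\<close> and
  \<open>Z\<close>.\<close>

lemma triangle_kinds_virt:
  assumes "well_formed D" "triangle_at D P X Y Z f f' f''" "triangle_kinds D P" "\<not> is_virt D X"
  shows "is_virt D Y \<longleftrightarrow> is_virt D Z"
proof (cases "\<forall>p \<in> P \<union> nxt D ` P. \<not> is_virt D p")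
  case True
  then show ?thesis unfolding triangle_atD(3)[OF assms(1,2)] by simp
next
  case False
  then obtain p where p: "p \<in> P" "is_virt D p" "is_virt D (nxt D p)"
    using assms(3) unfolding triangle_kinds_def by blast
  then show ?thesis using assms(2,4) unfolding triangle_at_def by (cases f; cases f'; cases f'') auto
qed

section \<open>Equality up to units, and invariance for an arbitrary labelling\<close>

definition associated :: "laurent \<Rightarrow> laurent \<Rightarrow> bool" where
  "associated g h \<longleftrightarrow> (\<exists>u \<in> st_units. g = u * h)"

lemma associated_refl: "associated g g"
  unfolding associated_def using st_units_basic(1) by (intro bexI[of _ 1]) auto

lemma associated_sym:
  assumes "associated g h"
  shows "associated h g"
proof -
  obtain u where u: "u \<in> st_units" "g = u * h" using assms by (auto simp: associated_def)
  obtain v where v: "v \<in> st_units" "u * v = 1" using st_units_inverse[OF u(1)] .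
  have "h = (u * v) * h" by (simp add: v(2))
  also have "\<dots> = v * g" unfolding u(2) by (simp only: ac_simps)
  finally show ?thesis unfolding associated_def using v(1) by blast
qed

lemma associated_trans:
  assumes "associated g h" "associated h k"
  shows "associated g k"
proof -
  obtain u where u: "u \<in> st_units" "g = u * h" using assms(1) by (auto simp: associated_def)
  obtain v where v: "v \<in> st_units" "h = v * k" using assms(2) by (auto simp: associated_def)
  have "g = (u * v) * k" unfolding u(2) v(2) by (simp only: ac_simps)
  then show ?thesis unfolding associated_def using st_units_mult[OF u(1) v(1)] by blast
qed

text \<open>What invariance requires of the labels: crossings outside a deleted face, and all
  crossings of a triangle move, keep theirs; the two crossings of a bigon agree; and if one crossing
  of a triangle carries (B), the other two agree.\<close>

locale labelling =
  fixes L :: "diagram \<Rightarrow> passage \<Rightarrow> lvar option"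
  assumes L_opp: "well_formed D \<Longrightarrow> p \<in> passages D \<Longrightarrow> L D (opp p) = L D p"
    and L_classical: "L D p = None \<Longrightarrow> \<not> is_virt D p"
    and L_isotopic: "well_formed D \<Longrightarrow> well_formed D' \<Longrightarrow> isotopic_by h D D' \<Longrightarrow> p \<in> passages D \<Longrightarrow>
      L D' (map_prod h id p) = L D p"
    and L_monogon: "well_formed D \<Longrightarrow> p \<in> passages D \<Longrightarrow> nxt D p = opp p \<Longrightarrow>
      well_formed (delete_crossings {fst p} D) \<Longrightarrow> x \<in> passages D \<Longrightarrow> fst x \<noteq> fst p \<Longrightarrow>
      L (delete_crossings {fst p} D) x = L D x"
    and L_bigon: "well_formed D \<Longrightarrow> p \<in> passages D \<Longrightarrow> q = nxt D p \<Longrightarrow> fst p \<noteq> fst q \<Longrightarrow>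
      nxt D (opp p) = opp q \<or> nxt D (opp q) = opp p \<Longrightarrow> is_virt D p \<longleftrightarrow> is_virt D q \<Longrightarrow>
      well_formed (delete_crossings {fst p, fst q} D) \<Longrightarrow>
      L D p = L D q \<and> (\<forall>x \<in> passages D. fst x \<notin> {fst p, fst q} \<longrightarrow>
        L (delete_crossings {fst p, fst q} D) x = L D x)"
    and L_triangle: "well_formed D \<Longrightarrow> triangle_at D P X Y Z f f' f'' \<Longrightarrow> triangle_kinds D P \<Longrightarrow>
      well_formed (swap_along P D) \<Longrightarrow> x \<in> passages D \<Longrightarrow> L (swap_along P D) x = L D x"
    and L_triangle_None: "well_formed D \<Longrightarrow> triangle_at D P X Y Z f f' f'' \<Longrightarrow> triangle_kinds D P \<Longrightarrow>
      L D X = None \<Longrightarrow> L D Y = L D Z"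
begin

abbreviation label_poly :: "diagram \<Rightarrow> laurent" where
  "label_poly D \<equiv> arc_det (label_rel (L D) D) D"

lemma poly_isotopic:
  assumes "well_formed D" "well_formed D'" "isotopic_by f D D'"
  shows "label_poly D' = label_poly D"
proof -
  let ?f = "map_prod f id :: passage \<Rightarrow> passage"
  have t: "transports ?f D D'" by (rule isotopic_transports[OF assms])
  have opp: "?f (opp x) = opp (?f x)" for x by (cases x; cases "snd x") auto
  have rel: "label_rel (L D') D' (?f x) = label_rel (L D) D x" if x: "x \<in> passages D" for x
  proof -
    have "kind_of D' (f (fst x)) = kind_of D (fst x)"
      using assms(3) x unfolding isotopic_by_def crossings_def by blast
    then have "rel_B D' (?f x) = rel_B D x"
      by (simp add: rel_B_def sign_of_def is_over_def map_prod_def case_prod_beta)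
    moreover have "strand_sign (?f x) = strand_sign x"
      by (simp add: strand_sign_def map_prod_def case_prod_beta)
    ultimately show ?thesis
      unfolding label_rel_def L_isotopic[OF assms x] by (simp split: option.split)
  qed
  have "arc_det (label_rel (L D') D') D' = (if [] \<in> set (comps D) then 0 else sdet (passages D)
    (\<lambda>x y. fst (label_rel (L D') D' (?f x)) * of_bool (y = prv D x) +
      snd (label_rel (L D') D' (?f x)) * of_bool (y = prv D (opp x)) - of_bool (x = y)))"
    by (rule transports_arc_det[OF t]) (use opp well_formedD(2)[OF assms(1)] in auto)
  also have "\<dots> = label_poly D"
    unfolding arc_det_def arcmat_def by (intro if_cong refl sdet_cong finite_passages) (simp only: rel)
  finally show ?thesis .
qed

text \<open>The second half of moves I and II: once the crossings in \<open>C\<close> carry identity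
  relations, their passages can be taken out, and only a sign appears.\<close>

lemma arc_det_delete:
  assumes D: "well_formed D" and C: "C \<subseteq> crossings D"
    and L: "\<And>x. x \<in> passages D \<Longrightarrow> fst x \<notin> C \<Longrightarrow> L (delete_crossings C D) x = L D x"
    and r': "\<And>x. r' x = (if fst x \<in> C then (1, 0) else label_rel (L D) D x)"
  shows "associated (arc_det r' D) (label_poly (delete_crossings C D))"
proof -
  let ?E = "{p \<in> passages D. fst p \<in> C}"
  have "\<exists>u \<in> {1, - 1}. arc_det r' D = u * arc_det r' (delete_passages ?E D)"
    by (rule arc_det_delete_passages) (use well_formedD[OF D] r' in auto)
  then obtain u where u: "u \<in> {1, - 1}" "arc_det r' D = u * arc_det r' (delete_passages ?E D)" by blast
  have del: "arc_det r' (delete_passages ?E D) = label_poly (delete_crossings C D)"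
  proof -
    have "arc_det r' (delete_passages ?E D) = arc_det (label_rel (L (delete_crossings C D)) (delete_crossings C D)) (delete_passages ?E D)"
    proof (rule arc_det_cong)
      fix x assume "x \<in> passages (delete_passages ?E D)"
      then have x: "x \<in> passages D" "fst x \<notin> C" by auto
      have "label_rel (L (delete_crossings C D)) (delete_crossings C D) x = label_rel (L D) D x"
        using L[OF x] label_rel_kind[of D "delete_crossings C D"] by (simp add: label_rel_def)
      then show "r' x = label_rel (L (delete_crossings C D)) (delete_crossings C D) x"
        using r'[of x] x(2) by simp
    qed
    then show ?thesis by (simp only: delete_crossings_delete_passages)
  qed
  have "u \<in> st_units" using u(1) st_units_basic by blast
  with u(2) show ?thesis unfolding associated_def del by blast
qed

lemma poly_reidemeister:
  assumes D: "well_formed D" and D': "well_formed D'" and R: "reidemeister D D'"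
  shows "associated (label_poly D) (label_poly D')"
  using R
proof cases
  case (monogon d)
  let ?p = "fst d"
  have p: "?p \<in> passages D" using monogon(2) by (auto simp: darts_def)
  have n: "nxt D ?p = opp ?p" by (rule monogon_face[OF D monogon(2,3)])
  define r' where "r' = (\<lambda>x. if fst x = fst ?p then (1, 0) else label_rel (L D) D x)"
  have "\<exists>u \<in> st_units. label_poly D = u * arc_det r' D"
    by (rule arc_det_monogon[OF D p n]) (simp_all add: L_opp[OF D p] L_classical r'_def)
  then have "associated (label_poly D) (arc_det r' D)" unfolding associated_def .
  moreover have "associated (arc_det r' D) (label_poly (delete_crossings {fst ?p} D))"
    by (rule arc_det_delete[OF D])
       (use p L_monogon[OF D p n] D' monogon(1) in \<open>auto simp: crossings_def r'_def\<close>)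
  ultimately show ?thesis unfolding monogon(1) by (rule associated_trans)
next
  case (bigon d p q)
  have p: "p \<in> passages D" using bigon(2,4) by (auto simp: darts_def)
  have s: "simple D" by (rule well_formedD(1)[OF D])
  have q: "q \<in> passages D" using nxt_passages[OF s p] bigon(5) by simp
  note bf = bigon_face[OF D bigon(2,3), folded bigon(4), folded bigon(5)]
  note o = well_formedD(2)[OF D p] well_formedD(2)[OF D q]
  have LB: "L D p = L D q" "\<And>x. x \<in> passages D \<Longrightarrow> fst x \<notin> {fst p, fst q} \<Longrightarrow>
      L (delete_crossings {fst p, fst q} D) x = L D x"
    using L_bigon[OF D p bigon(5,6) bf(2) bigon(7)] D' bigon(1) by auto
  define r' where "r' = (\<lambda>x. if fst x \<in> {fst p, fst q} then (1, 0) else label_rel (L D) D x)"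
  note Lo = L_opp[OF D p] L_opp[OF D q]
  have nx: "nxt D p = q" using bigon(5) by simp
  have ov: "is_over D (opp p) \<and> is_over D (opp q)" if "L D p = None" "\<not> is_over D p"
    using that L_classical[of D p] L_classical[of D q] LB(1) bigon(8) is_over_opp by auto
  \<comment> \<open>For (B) the elimination needs the over-strand in first place. If
    \<open>p\<close> passes under there, the opposite strand takes its role; in either case the
    strands may be parallel or antiparallel.\<close>
  have "label_poly D = arc_det r' D"
  proof (cases "L D p = None \<and> \<not> is_over D p")
    case False
    have over: "L D p = None \<Longrightarrow> is_over D p \<and> is_over D q" using False bigon(8) by simp
    show ?thesis
    proof (cases "nxt D (opp p) = opp q")
      case True
      show ?thesis
        by (rule arc_det_bigon[OF D _ nx True, where c = True])
           (use p q o bigon(6) bf(1) Lo LB(1) over in \<open>auto simp: r'_def\<close>)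
    next
      case F: False
      then have n: "nxt D (opp q) = opp p" using bf(2) by simp
      show ?thesis
        by (rule arc_det_bigon[OF D _ nx n, where c = False])
           (use p q o bigon(6) bf(1) Lo LB(1) over in \<open>auto simp: r'_def\<close>)
    qed
  next
    case True
    have sn: "snd (opp p) \<noteq> snd (opp q)" using bf(1) by (simp add: snd_opp_eq_iff)
    show ?thesis
    proof (cases "nxt D (opp p) = opp q")
      case c: True
      show ?thesis
        by (rule arc_det_bigon[OF D _ c nx, where c = True])
           (use p q o bigon(6) sn Lo LB(1) ov True in \<open>auto simp: r'_def\<close>)
    next
      case F: False
      then have n: "nxt D (opp q) = opp p" using bf(2) by simp
      show ?thesis
        by (rule arc_det_bigon[OF D _ n nx, where c = False])
           (use p q o bigon(6) sn Lo LB(1) ov True in \<open>auto simp: r'_def\<close>)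
    qed
  qed
  moreover have "associated (arc_det r' D) (label_poly (delete_crossings {fst p, fst q} D))"
    by (rule arc_det_delete[OF D]) (use p q LB(2) in \<open>auto simp: crossings_def r'_def\<close>)
  ultimately show ?thesis unfolding bigon(1) by simp
next
  case (triangle d P)
  obtain X Y Z f f' f'' where T: "triangle_at D P X Y Z f f' f''"
    using triangle_face[OF D triangle(2-5)] by blast
  have tk: "triangle_kinds D P" using triangle(6) unfolding triangle_kinds_def by blast
  have cl: "well_formed (swap_along P D)" using D' triangle(1) by simp
  have pass: "{X, Y, Z} \<subseteq> passages D" using T by (simp add: triangle_at_def)
  have s: "simple D" by (rule well_formedD(1)[OF D])
  have t: "transports (swap_ends P D) D (swap_along P D)"
    by (rule swap_ends_transports[OF s triangle_atD(1,4)[OF D T]])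
  have o: "L D (opp p) = L D p" if "p \<in> {X, Y, Z}" for p using that pass L_opp[OF D] by blast
  \<comment> \<open>Renaming the strands brings \<open>Y\<close> or \<open>Z\<close> into the
    position of \<open>X\<close>, which is why the locale states the condition on
    \<open>None\<close> for \<open>X\<close> only.\<close>
  note T1 = triangle_at_swap_mb[OF T D]
  note T2 = triangle_at_swap_mb[OF triangle_at_swap_tm[OF T D] D]
  have "arc_det (label_rel (L D) D) (swap_along P D) = label_poly D"
  proof (rule arc_det_triangle_labels[OF D T])
    show "L D X = None \<Longrightarrow> L D Y = L D Z" by (rule L_triangle_None[OF D T tk])
    show "L D Y = None \<Longrightarrow> L D X = L D Z" using L_triangle_None[OF D T1 tk] o by simp
    show "L D Z = None \<Longrightarrow> L D X = L D Y" using L_triangle_None[OF D T2 tk] o by simp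
    show "\<exists>p\<in>P. is_over D p \<and> is_over D (nxt D p)" if "L D X = None" "L D Y = None" "L D Z = None"
    proof (rule ccontr)
      assume "\<not> ?thesis"
      then obtain p where p: "p \<in> P" "is_virt D p" using triangle(6) by blast
      then have "p \<in> {X, Y, opp X, Z, opp Y, opp Z}" using triangle_atD(3)[OF D T] by blast
      then show False using p(2) L_classical[OF that(1)] L_classical[OF that(2)] L_classical[OF that(3)] by auto
    qed
  qed (use L_opp[OF D] L_classical in auto)
  moreover have "label_poly (swap_along P D) = arc_det (label_rel (L D) D) (swap_along P D)"
  proof (rule arc_det_cong)
    fix x assume x: "x \<in> passages (swap_along P D)"
    have "passages (swap_along P D) \<subseteq> passages D"
    proof -
      have "swap_ends P D y \<in> passages D" if "y \<in> passages D" for y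
        using that nxt_passages[OF s] prv_passages[OF s] by (simp add: swap_ends_def)
      then show ?thesis unfolding transports_passages[OF t] by blast
    qed
    then have "L (swap_along P D) x = L D x" using L_triangle[OF D T tk cl, of x] x by blast
    then show "label_rel (L (swap_along P D)) (swap_along P D) x = label_rel (L D) D x"
      using label_rel_kind[of D "swap_along P D"] by (simp add: label_rel_def)
  qed
  ultimately show ?thesis unfolding triangle(1) by (simp add: associated_refl)
qed

lemma poly_moves:
  assumes "(D, D') \<in> moves"
  shows "associated (label_poly D) (label_poly D')"
proof -
  have c: "well_formed D" "well_formed D'" and "isotopic D D' \<or> reidemeister D D'"
    using assms virtual_diagram_well_formed by (auto simp: moves_def)
  from this(3) show ?thesis
  proof
    assume "isotopic D D'"
    then obtain f where "isotopic_by f D D'" unfolding isotopic_def isotopic_by_def by blast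
    from poly_isotopic[OF c this] show ?thesis by (simp add: associated_refl)
  next
    assume "reidemeister D D'"
    then show ?thesis by (rule poly_reidemeister[OF c])
  qed
qed

lemma poly_virtual_equiv:
  assumes "(D, D') \<in> virtual_equiv"
  shows "associated (label_poly D) (label_poly D')"
  using assms unfolding virtual_equiv_def
proof (induction rule: rtrancl_induct)
  case base
  show ?case by (rule associated_refl)
next
  case (step D1 D2)
  then have "associated (label_poly D1) (label_poly D2)" using poly_moves associated_sym by blast
  with step.IH show ?case by (rule associated_trans)
qed

end

section \<open>Parity of self-crossings\<close>

definition sawollek_label :: "diagram \<Rightarrow> passage \<Rightarrow> lvar option" where
  "sawollek_label D p = (if is_virt D p then Some Valpha else None)"

lemma sawollek_rel_label_rel: "sawollek_rel D p = label_rel (sawollek_label D) D p"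
  by (simp add: sawollek_rel_def label_rel_def sawollek_label_def rel_V_vpow)

lemma is_virt_isotopic:
  assumes "isotopic_by h D D'" "p \<in> passages D"
  shows "is_virt D' (map_prod h id p) = is_virt D p"
  using assms unfolding isotopic_by_def is_virt_def crossings_def by (simp add: map_prod_def case_prod_beta)

interpretation sawollek: labelling sawollek_label
proof
  fix D D' :: diagram and h p assume "isotopic_by h D D'" "p \<in> passages D"
  then show "sawollek_label D' (map_prod h id p) = sawollek_label D p" by (simp add: sawollek_label_def is_virt_isotopic)
next
  fix D P X Y Z f f' f'' assume "well_formed D" "triangle_at D P X Y Z f f' f''" "triangle_kinds D P" "sawollek_label D X = None"
  then show "sawollek_label D Y = sawollek_label D Z" using triangle_kinds_virt by (auto simp: sawollek_label_def split: if_splits)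
qed (auto simp: sawollek_label_def is_virt_def split: if_splits)

text \<open>
  A two-colouring \<open>\<pi>\<close> of the passages that changes its value exactly after the passages in \<open>s\<close>.  When
  \<open>s\<close> consists of the classical self-passages, a self-crossing is even iff its two passages have different colours.
\<close>

definition colouring :: "diagram \<Rightarrow> (passage \<Rightarrow> bool) \<Rightarrow> (passage \<Rightarrow> bool) \<Rightarrow> bool" where
  "colouring D s \<pi> \<longleftrightarrow> (\<forall>x y. (x, y) \<in> succs D \<longrightarrow> (\<pi> y \<longleftrightarrow> \<pi> x \<noteq> s x))"

definition self_passage :: "diagram \<Rightarrow> passage \<Rightarrow> bool" where
  "self_passage D p \<longleftrightarrow> \<not> is_virt D p \<and> comp_of D (opp p) = comp_of D p"

lemma self_passage_opp [simp]: "self_passage D (opp p) = self_passage D p"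
  by (auto simp: self_passage_def)

lemma colouringD: "colouring D s \<pi> \<Longrightarrow> (x, y) \<in> succs D \<Longrightarrow> \<pi> y \<longleftrightarrow> \<pi> x \<noteq> s x"
  unfolding colouring_def by blast

lemma colouring_cong:
  "colouring D s \<pi> \<Longrightarrow> (\<And>x. x \<in> passages D \<Longrightarrow> s x = s' x) \<Longrightarrow> colouring D s' \<pi>"
  unfolding colouring_def using succs_passages(1) by metis

lemma cpairs_consecutive: "(x, y) \<in> cpairs (us @ x # y # zs)"
  unfolding cpairs_append_commute[of us] using cpairs_Cons[of "y # zs @ us" x] by simp

lemma consecutive_zip: "(x, y) \<in> set (zip w (tl w)) \<Longrightarrow> \<exists>us zs. w = us @ x # y # zs"
proof (induction w)
  case (Cons a w)
  then show ?case
  proof (cases w)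
    case (Cons b v)
    with Cons.prems consider "x = a" "y = b" | "(x, y) \<in> set (zip w (tl w))" by auto
    then show ?thesis
    proof cases
      case 1
      then show ?thesis using Cons by (intro exI[of _ "[]"] exI[of _ v]) simp
    next
      case 2
      then obtain us zs where "w = us @ x # y # zs" using Cons.IH by blast
      then have "a # w = (a # us) @ x # y # zs" by simp
      then show ?thesis by blast
    qed
  qed simp
qed simp

lemma cpairs_cases:
  assumes "(x, y) \<in> cpairs w"
  shows "(\<exists>us zs. w = us @ x # y # zs) \<or> w \<noteq> [] \<and> x = last w \<and> y = hd w"
proof -
  have "w \<noteq> []" using assms by auto
  then show ?thesis using assms consecutive_zip[of x y w] cpairs_conv[of w] by auto
qed

lemma colouring_walk:
  assumes c: "colouring D s \<pi>" and w: "us @ x # vs @ y # zs \<in> set (comps D)"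
  shows "\<pi> y \<longleftrightarrow> \<pi> x \<noteq> odd (length (filter s (x # vs)))"
  using w
proof (induction vs arbitrary: us x)
  case Nil
  have "(x, y) \<in> succs D" unfolding succs_def using Nil cpairs_consecutive[of x y us zs] by auto
  from colouringD[OF c this] show ?case by auto
next
  case (Cons v vs)
  have "(x, v) \<in> succs D"
    unfolding succs_def using Cons.prems cpairs_consecutive[of x v us "vs @ y # zs"] by auto
  from colouringD[OF c this] have "\<pi> v \<longleftrightarrow> \<pi> x \<noteq> s x" .
  moreover have "\<pi> y \<longleftrightarrow> \<pi> v \<noteq> odd (length (filter s (v # vs)))"
    by (rule Cons.IH[of "us @ [x]"]) (use Cons.prems in simp)
  ultimately show ?case by auto
qed

text \<open>Self-passages of a component come in pairs \<open>p\<close>, \<open>opp p\<close>. This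
  is what lets a two-colouring close up around the cyclic word.\<close>

lemma even_self_passages:
  assumes D: "well_formed D" and i: "i < length (comps D)"
  shows "even (length (filter (self_passage D) (comps D ! i)))"
proof -
  let ?w = "comps D ! i"
  let ?A = "{x \<in> set ?w. self_passage D x}"
  have s: "simple D" by (rule well_formedD(1)[OF D])
  have w: "?w \<in> set (comps D)" using i by simp
  have len: "length (filter (self_passage D) ?w) = card ?A"
    using distinct_card[OF distinct_filter[OF simple_word[OF s w]], of "self_passage D"] by simp
  have A: "?A = fst ` ?A \<times> {SW, SE}"
  proof (intro equalityI subsetI)
    fix x assume "x \<in> fst ` ?A \<times> {SW, SE}"
    then obtain y where y: "y \<in> ?A" "fst x = fst y" by auto
    have yp: "y \<in> passages D" using y(1) w by (auto simp: passages_UN)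
    have "opp y \<in> set ?w"
      using y(1) comp_of_iff[OF s yp i] comp_of_iff[OF s well_formedD(2)[OF D yp] i] by (auto simp: self_passage_def)
    then show "x \<in> ?A" using y by (auto simp: same_crossing)
  next
    fix x assume "x \<in> ?A"
    then show "x \<in> fst ` ?A \<times> {SW, SE}" by (cases x; cases "snd x") force+
  qed
  have ev: "even (card (B \<times> {SW, SE}))" for B :: "nat set"
    by (simp add: card_cartesian_product)
  show ?thesis unfolding len by (subst A) (rule ev)
qed

lemma colouring_exists:
  assumes D: "well_formed D"
  shows "\<exists>\<pi>. colouring D (self_passage D) \<pi>"
proof -
  have s: "simple D" by (rule well_formedD(1)[OF D])
  let ?s = "self_passage D"
  define \<pi> where "\<pi> = (\<lambda>p. odd (length (filter ?s (takeWhile (\<lambda>q. q \<noteq> p) (comps D ! comp_of D p)))))"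
  have \<pi>: "\<pi> p \<longleftrightarrow> odd (length (filter ?s us))"
    if "i < length (comps D)" "comps D ! i = us @ p # zs" for i us p zs
  proof -
    have "comp_of D p = i" by (rule comp_of_eqI[OF s that(1)]) (simp add: that(2))
    moreover have "distinct (us @ p # zs)" using simple_word[OF s nth_mem[OF that(1)]] that(2) by simp
    then have "takeWhile (\<lambda>q. q \<noteq> p) (us @ p # zs) = us" by (auto simp: takeWhile_tail)
    ultimately show ?thesis by (simp add: \<pi>_def that(2))
  qed
  have "\<pi> y \<longleftrightarrow> \<pi> x \<noteq> ?s x" if "(x, y) \<in> succs D" for x y
  proof -
    from that obtain w where w: "w \<in> set (comps D)" "(x, y) \<in> cpairs w"
      unfolding succs_def by (rule UN_E)
    from w(1) obtain i where "i < length (comps D)" "comps D ! i = w"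
      unfolding in_set_conv_nth by blast
    with w(2) have i: "i < length (comps D)" "(x, y) \<in> cpairs (comps D ! i)" by simp_all
    from cpairs_cases[OF i(2)] show ?thesis
    proof
      assume "\<exists>us zs. comps D ! i = us @ x # y # zs"
      then obtain us zs where w: "comps D ! i = us @ x # y # zs" by blast
      then have "\<pi> y \<longleftrightarrow> odd (length (filter ?s (us @ [x])))"
        by (intro \<pi>[OF i(1), where zs = zs]) simp
      then show ?thesis using \<pi>[OF i(1) w] by auto
    next
      \<comment> \<open>At the base point the prefix count restarts at \<open>0\<close>; since the
        total is even, the parity is still correct there.\<close>
      assume w: "comps D ! i \<noteq> [] \<and> x = last (comps D ! i) \<and> y = hd (comps D ! i)"
      then have 1: "comps D ! i = [] @ y # tl (comps D ! i)" "comps D ! i = butlast (comps D ! i) @ x # []"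
        by simp_all
      have "even (length (filter ?s (butlast (comps D ! i) @ [x])))"
        using even_self_passages[OF D i(1)] 1(2) by simp
      then show ?thesis using \<pi>[OF i(1) 1(1)] \<pi>[OF i(1) 1(2)] by auto
    qed
  qed
  then show ?thesis unfolding colouring_def by blast
qed

lemma filter_eq_appendD:
  "filter P zs = xs @ ys \<Longrightarrow> \<exists>us vs. zs = us @ vs \<and> filter P us = xs \<and> filter P vs = ys"
proof (induction xs arbitrary: zs)
  case Nil
  then show ?case by (intro exI[of _ "[]"] exI[of _ zs]) simp
next
  case (Cons x xs)
  then obtain us vs where 1: "zs = us @ x # vs" "\<forall>u\<in>set us. \<not> P u" "P x" "filter P vs = xs @ ys"
    by (auto dest!: filter_eq_ConsD)
  from Cons.IH[OF 1(4)] obtain us' vs' where "vs = us' @ vs'" "filter P us' = xs" "filter P vs' = ys" by blast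
  with 1 show ?case by (intro exI[of _ "us @ x # us'"] exI[of _ vs']) simp
qed

text \<open>Between the two occurrences of a crossing the colour changes once for each letter in
  between and once more at the first occurrence itself. So an even number of letters in between
  means different colours.\<close>

lemma even_self_crossing_colouring:
  assumes D: "well_formed D" and c: "colouring D (self_passage D) \<pi>"
    and p: "p \<in> passages D" "self_passage D p"
  shows "even_self_crossing D (comp_of D p) (fst p) \<longleftrightarrow> \<pi> p \<noteq> \<pi> (opp p)"
proof -
  have s: "simple D" by (rule well_formedD(1)[OF D])
  let ?s = "self_passage D" and ?i = "comp_of D p"
  let ?w = "comps D ! ?i"
  have i: "?i < length (comps D)" "p \<in> set ?w" using comp_of[OF s p(1)] by simp_all
  have op: "opp p \<in> set ?w"
    using comp_of_iff[OF s well_formedD(2)[OF D p(1)] i(1)] p(2) by (simp add: self_passage_def)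
  have w: "?w \<in> set (comps D)" using i(1) by simp
  have sw: "self_word D ?i = filter ?s ?w"
    unfolding self_word_def
  proof (rule filter_cong)
    fix x assume "x \<in> set ?w"
    then have x: "x \<in> passages D" "comp_of D x = ?i"
      using w comp_of_eqI[OF s i(1)] by (auto simp: passages_UN)
    then show "(\<not> is_virt D x \<and> opp x \<in> set ?w) = ?s x"
      using comp_of_iff[OF s well_formedD(2)[OF D x(1)] i(1)] by (simp add: self_passage_def)
  qed simp
  have key: "even (length ys) \<longleftrightarrow> \<pi> p' \<noteq> \<pi> (opp p')"
    if "self_word D ?i = xs @ p' # ys @ opp p' # zs" for xs p' ys zs
  proof -
    from that[unfolded sw] obtain us v where u: "?w = us @ v" "filter ?s v = p' # ys @ opp p' # zs"
      using filter_eq_appendD by blast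
    from u(2) obtain u1 v1 where v: "v = u1 @ p' # v1" "?s p'" "filter ?s v1 = ys @ opp p' # zs"
      using filter_eq_ConsD by metis
    from v(3) obtain v2 v3 where v2: "v1 = v2 @ v3" "filter ?s v2 = ys" "filter ?s v3 = opp p' # zs"
      using filter_eq_appendD by blast
    from v2(3) obtain u4 v4 where v4: "v3 = u4 @ opp p' # v4" "\<forall>u \<in> set u4. \<not> ?s u"
      using filter_eq_ConsD by metis
    have "(us @ u1) @ p' # (v2 @ u4) @ opp p' # v4 \<in> set (comps D)"
      using w by (simp add: u v v2 v4)
    from colouring_walk[OF c this] have "\<pi> (opp p') \<longleftrightarrow> \<pi> p' \<noteq> odd (length (filter ?s (p' # v2 @ u4)))" .
    moreover have "filter ?s (p' # v2 @ u4) = p' # ys" using v(2) v2(2) v4(2) by simp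
    ultimately show ?thesis by auto
  qed
  have "\<exists>xs p' ys zs. fst p' = fst p \<and> self_word D ?i = xs @ p' # ys @ opp p' # zs"
  proof -
    obtain us vs where 1: "?w = us @ p # vs" using i(2) by (meson split_list)
    have "opp p \<in> set us \<or> opp p \<in> set vs" using op 1 by auto
    then show ?thesis
    proof
      assume "opp p \<in> set us"
      then obtain u1 u2 where "us = u1 @ opp p # u2" by (meson split_list)
      then have "self_word D ?i = filter ?s u1 @ opp p # filter ?s u2 @ opp (opp p) # filter ?s vs"
        using p(2) unfolding sw 1 by simp
      then show ?thesis by (metis fst_opp)
    next
      assume "opp p \<in> set vs"
      then obtain u1 u2 where "vs = u1 @ opp p # u2" by (meson split_list)
      then have "self_word D ?i = filter ?s us @ p # filter ?s u1 @ opp p # filter ?s u2"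
        using p(2) unfolding sw 1 by simp
      then show ?thesis by blast
    qed
  qed
  then obtain xs p' ys zs where e: "fst p' = fst p" "self_word D ?i = xs @ p' # ys @ opp p' # zs" by blast
  have sym: "\<pi> q \<noteq> \<pi> (opp q) \<longleftrightarrow> \<pi> p \<noteq> \<pi> (opp p)" if "fst q = fst p" for q
    using that by (auto simp: same_crossing)
  show ?thesis
  proof
    assume "even_self_crossing D ?i (fst p)"
    then obtain q xs ys zs where "fst q = fst p" "self_word D ?i = xs @ q # ys @ opp q # zs" "even (length ys)"
      unfolding even_self_crossing_def by blast
    then show "\<pi> p \<noteq> \<pi> (opp p)" using key sym by blast
  next
    assume "\<pi> p \<noteq> \<pi> (opp p)"
    then have "even (length ys)" using key[OF e(2)] sym[OF e(1)] by simp
    then show "even_self_crossing D ?i (fst p)" unfolding even_self_crossing_def using e by blast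
  qed
qed

section \<open>The parity labelling and its behaviour under the moves\<close>

definition parity_label :: "diagram \<Rightarrow> passage \<Rightarrow> lvar option" where
  "parity_label D p = (if is_virt D p then Some Valpha
     else if comp_of D p \<noteq> comp_of D (opp p) then Some (Vw {comp_of D p, comp_of D (opp p)})
     else if even_self_crossing D (comp_of D p) (fst p) then None
     else Some (Vz (comp_of D p)))"

lemma parity_rel_label_rel: "parity_rel D p = label_rel (parity_label D) D p"
  by (simp add: parity_rel_def Let_def parity_label_def label_rel_def rel_V_vpow rel_C_vpow)

lemma parity_label_colouring:
  assumes "well_formed D" "colouring D (self_passage D) \<pi>" "p \<in> passages D"
  shows "parity_label D p = (if is_virt D p then Some Valpha
     else if comp_of D p \<noteq> comp_of D (opp p) then Some (Vw {comp_of D p, comp_of D (opp p)})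
     else if \<pi> p \<noteq> \<pi> (opp p) then None else Some (Vz (comp_of D p)))"
proof (cases "self_passage D p")
  case True
  from even_self_crossing_colouring[OF assms this] True show ?thesis
    by (simp add: parity_label_def self_passage_def)
next
  case False
  then show ?thesis by (auto simp: parity_label_def self_passage_def)
qed

text \<open>Every colouring of a diagram computes the same parities, so the one for the new diagram
  may be chosen to suit the move and need not come from the construction in
  \<open>colouring_exists\<close>.\<close>

lemma parity_label_eqI:
  assumes "well_formed D" "well_formed D'" "p \<in> passages D" "p' \<in> passages D'"
    and "is_virt D' p' = is_virt D p" "comp_of D' p' = comp_of D p" "comp_of D' (opp p') = comp_of D (opp p)"
    and "colouring D (self_passage D) \<pi>" "colouring D' (self_passage D') \<pi>'"
    and "self_passage D p \<Longrightarrow> (\<pi>' p' \<noteq> \<pi>' (opp p')) = (\<pi> p \<noteq> \<pi> (opp p))"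
  shows "parity_label D' p' = parity_label D p"
  unfolding parity_label_colouring[OF assms(1,8,3)] parity_label_colouring[OF assms(2,9,4)]
  using assms(5-7,10) by (auto simp: self_passage_def)

lemma parity_label_opp:
  assumes "well_formed D" "p \<in> passages D"
  shows "parity_label D (opp p) = parity_label D p"
proof -
  obtain \<pi> where \<pi>: "colouring D (self_passage D) \<pi>" using colouring_exists[OF assms(1)] by blast
  show ?thesis
    unfolding parity_label_colouring[OF assms(1) \<pi> assms(2)]
      parity_label_colouring[OF assms(1) \<pi> well_formedD(2)[OF assms]]
    by (auto simp: insert_commute)
qed

lemma parity_label_isotopic:
  assumes D: "well_formed D" "well_formed D'" and i: "isotopic_by h D D'" and p: "p \<in> passages D"
  shows "parity_label D' (map_prod h id p) = parity_label D p"
proof -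
  let ?h = "map_prod h id :: passage \<Rightarrow> passage"
  have s: "simple D" "simple D'" using well_formedD(1) D by auto
  have t: "transports ?h D D'" by (rule isotopic_transports[OF D i])
  have opp: "opp (?h x) = ?h (opp x)" for x by (cases x; cases "snd x") auto
  have comp: "comp_of D' (?h x) = comp_of D x" if "x \<in> passages D" for x
  proof -
    have "comp_of D x < length (comps D)" "x \<in> set (comps D ! comp_of D x)" using comp_of[OF s(1) that] by auto
    moreover from this obtain n where "comps D' ! comp_of D x = rotate n (map ?h (comps D ! comp_of D x))"
      using i unfolding isotopic_by_def by blast
    ultimately show ?thesis using i by (intro comp_of_eqI[OF s(2)]) (auto simp: isotopic_by_def)
  qed
  have self: "self_passage D' (?h x) = self_passage D x" if "x \<in> passages D" for x
    unfolding self_passage_def is_virt_isotopic[OF i that] opp comp[OF that] comp[OF well_formedD(2)[OF D(1) that]] ..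
  obtain \<pi> where \<pi>: "colouring D (self_passage D) \<pi>" using colouring_exists[OF D(1)] by blast
  define \<pi>' where "\<pi>' = (\<lambda>y. \<pi> (inv_into (passages D) ?h y))"
  have inj: "inj_on ?h (passages D)" using t by (simp add: transports_def)
  have \<pi>'h: "\<pi>' (?h x) = \<pi> x" if "x \<in> passages D" for x
    using inv_into_f_f[OF inj that] by (simp add: \<pi>'_def)
  have col: "colouring D' (self_passage D') \<pi>'"
    unfolding colouring_def
  proof (intro allI impI)
    fix x y assume "(x, y) \<in> succs D'"
    then obtain a b where ab: "(a, b) \<in> succs D" "x = ?h a" "y = ?h b"
      using t unfolding transports_def by (auto simp: map_prod_def)
    have "\<pi> b \<longleftrightarrow> \<pi> a \<noteq> self_passage D a" by (rule colouringD[OF \<pi> ab(1)])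
    then show "\<pi>' y \<longleftrightarrow> \<pi>' x \<noteq> self_passage D' x"
      using succs_passages[OF ab(1)] by (simp add: ab \<pi>'h self)
  qed
  show ?thesis
    by (rule parity_label_eqI[OF D p _ is_virt_isotopic[OF i p] comp[OF p] _ \<pi> col])
       (use p well_formedD(2)[OF D(1) p] transports_passages[OF t] in \<open>simp_all add: opp comp \<pi>'h\<close>)
qed

lemma colouring_delete_passages1:
  assumes "simple D" "e \<in> passages D" "colouring D s \<pi>" "\<not> s e"
  shows "colouring (delete_passages {e} D) s \<pi>"
  unfolding colouring_def succs_delete_passages1[OF assms(1,2)]
  using colouringD[OF assms(3)] assms(4) by blast

lemma colouring_delete_passages:
  assumes "finite E" "simple D" "E \<subseteq> passages D" "colouring D s \<pi>" "\<And>e. e \<in> E \<Longrightarrow> \<not> s e"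
  shows "colouring (delete_passages E D) s \<pi>"
  using assms
proof (induction E arbitrary: D rule: finite_induct)
  case empty
  then show ?case by (simp add: delete_passages_empty)
next
  case (insert e E)
  have "colouring (delete_passages {e} D) s \<pi>" by (rule colouring_delete_passages1) (use insert.prems in auto)
  then show ?case
    unfolding delete_passages_insert[of e E]
    by (intro insert.IH) (use insert.prems insert.hyps in \<open>auto simp: simple_delete_passages\<close>)
qed

text \<open>Equal consecutive changes at \<open>e\<close> and \<open>e'\<close> undo each other, and
  \<open>e'\<close> is the only passage coloured between them. Switching both off therefore affects
  the colour of \<open>e'\<close> alone.\<close>

lemma colouring_cancel:
  assumes s: "simple D" and c: "colouring D s \<pi>" and e: "(e, e') \<in> succs D" "e \<noteq> e'" "s e = s e'"
  shows "colouring D (s(e := False, e' := False)) (\<pi>(e' := \<pi> e))"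
  unfolding colouring_def
proof (intro allI impI)
  fix x y assume xy: "(x, y) \<in> succs D"
  have 1: "y = e' \<longleftrightarrow> x = e"
    using xy e(1) nxt_eqI[OF s] prv_eqI[OF s] by metis
  have 2: "\<pi> y \<longleftrightarrow> \<pi> x \<noteq> s x" by (rule colouringD[OF c xy])
  have 3: "\<pi> e' \<longleftrightarrow> \<pi> e \<noteq> s e" by (rule colouringD[OF c e(1)])
  show "(\<pi>(e' := \<pi> e)) y \<longleftrightarrow> (\<pi>(e' := \<pi> e)) x \<noteq> (s(e := False, e' := False)) x"
    using 1 2 3 e(2,3) by (cases "x = e"; cases "x = e'") auto
qed

lemma comp_of_delete:
  assumes "simple D" "x \<in> passages D" "fst x \<notin> C"
  shows "comp_of (delete_crossings C D) x = comp_of D x"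
proof (rule comp_of_eqI[OF simple_delete_crossings[OF assms(1)]])
  show "comp_of D x < length (comps (delete_crossings C D))"
    using comp_of(1)[OF assms(1,2)] by (simp add: delete_crossings_def)
  then show "x \<in> set (comps (delete_crossings C D) ! comp_of D x)"
    using comp_of[OF assms(1,2)] assms(3) by (simp add: delete_crossings_def)
qed

text \<open>A colouring without changes at the passages to be deleted restricts to the smaller
  diagram; if it agrees with \<pi> on the remaining passages, parities are preserved.\<close>

lemma parity_label_delete:
  assumes D: "well_formed D" "well_formed (delete_crossings C D)"
    and c: "colouring D (self_passage D) \<pi>"
    and c': "colouring D s \<pi>'" "\<And>x. x \<in> passages D \<Longrightarrow> fst x \<in> C \<Longrightarrow> \<not> s x"
      "\<And>x. x \<in> passages D \<Longrightarrow> fst x \<notin> C \<Longrightarrow> s x = self_passage D x \<and> \<pi>' x = \<pi> x"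
    and x: "x \<in> passages D" "fst x \<notin> C"
  shows "parity_label (delete_crossings C D) x = parity_label D x"
proof -
  let ?D' = "delete_crossings C D" and ?E = "{p \<in> passages D. fst p \<in> C}"
  have s: "simple D" by (rule well_formedD(1)[OF D(1)])
  have virt: "is_virt ?D' y = is_virt D y" for y by (simp add: is_virt_def)
  note comp = comp_of_delete[OF s]
  have "colouring (delete_passages ?E D) s \<pi>'"
    by (rule colouring_delete_passages) (use s c' in auto)
  then have "colouring ?D' s \<pi>'" by (simp only: delete_crossings_delete_passages)
  then have col: "colouring ?D' (self_passage ?D') \<pi>'"
  proof (rule colouring_cong)
    fix y assume "y \<in> passages ?D'"
    then have y: "y \<in> passages D" "fst y \<notin> C" by (auto simp: passages_delete_crossings)
    then have "self_passage ?D' y = self_passage D y"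
      using comp[of y] comp[of "opp y"] well_formedD(2)[OF D(1)] by (simp add: self_passage_def virt)
    then show "s y = self_passage ?D' y" using c'(3)[OF y] by simp
  qed
  note ox = well_formedD(2)[OF D(1) x(1)]
  show ?thesis
    by (rule parity_label_eqI[OF D x(1) _ virt comp[OF x] _ c col])
       (use x ox comp[OF ox] c'(3) in \<open>auto simp: passages_delete_crossings\<close>)
qed

lemma parity_label_monogon:
  assumes D: "well_formed D" and p: "p \<in> passages D" "nxt D p = opp p"
    and D': "well_formed (delete_crossings {fst p} D)"
    and x: "x \<in> passages D" "fst x \<noteq> fst p"
  shows "parity_label (delete_crossings {fst p} D) x = parity_label D x"
proof -
  have s: "simple D" by (rule well_formedD(1)[OF D])
  obtain \<pi> where \<pi>: "colouring D (self_passage D) \<pi>" using colouring_exists[OF D] by blast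
  have "(p, opp p) \<in> succs D" using succs_nxt[OF s p(1)] p(2) by simp
  from colouring_cancel[OF s \<pi> this] have
    "colouring D ((self_passage D)(p := False, opp p := False)) (\<pi>(opp p := \<pi> p))" by simp
  then show ?thesis
    by (rule parity_label_delete[OF D D' \<pi>]) (use x in \<open>auto simp: same_crossing\<close>)
qed

text \<open>The two strands stay in their components, and from one crossing to the other either both
  change colour or neither does. Hence the two crossings have the same type, components and
  parity.\<close>

lemma parity_label_bigon:
  assumes D: "well_formed D" and p: "p \<in> passages D" and q: "q = nxt D p" and pq: "fst p \<noteq> fst q"
    and o: "nxt D (opp p) = opp q \<or> nxt D (opp q) = opp p" and v: "is_virt D p \<longleftrightarrow> is_virt D q"
    and D': "well_formed (delete_crossings {fst p, fst q} D)"
  shows "parity_label D p = parity_label D q \<and> (\<forall>x \<in> passages D. fst x \<notin> {fst p, fst q} \<longrightarrow>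
    parity_label (delete_crossings {fst p, fst q} D) x = parity_label D x)"
proof -
  have s: "simple D" by (rule well_formedD(1)[OF D])
  have pass: "q \<in> passages D" "opp p \<in> passages D" "opp q \<in> passages D"
    using p q nxt_passages[OF s] well_formedD(2)[OF D] by auto
  obtain \<pi> where \<pi>: "colouring D (self_passage D) \<pi>" using colouring_exists[OF D] by blast
  let ?s = "self_passage D"
  have 1: "(p, q) \<in> succs D" using succs_nxt[OF s p] q by simp
  obtain a b where ab: "(a, b) \<in> succs D" "a = opp p \<and> b = opp q \<or> a = opp q \<and> b = opp p"
    using o succs_nxt[OF s pass(2)] succs_nxt[OF s pass(3)] by metis
  have comp: "comp_of D p = comp_of D q" "comp_of D (opp p) = comp_of D (opp q)"
    using comp_of_succs[OF s 1] comp_of_succs[OF s ab(1)] ab(2) by auto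
  have self: "?s p = ?s q" using comp v by (simp add: self_passage_def)
  have d: "p \<noteq> q" "p \<noteq> a" "p \<noteq> b" "q \<noteq> a" "q \<noteq> b" "a \<noteq> b" using pq ab(2) by auto
  have sab: "?s a = ?s p" "?s b = ?s p" using ab(2) self by auto
  have "parity_label D p = parity_label D q"
  proof -
    have \<pi>q: "\<pi> q \<longleftrightarrow> \<pi> p \<noteq> ?s p" by (rule colouringD[OF \<pi> 1])
    have \<pi>b: "\<pi> b \<longleftrightarrow> \<pi> a \<noteq> ?s p" using colouringD[OF \<pi> ab(1)] sab by simp
    have "(\<pi> p \<noteq> \<pi> (opp p)) = (\<pi> q \<noteq> \<pi> (opp q))" using \<pi>q \<pi>b ab(2) by auto
    then show ?thesis
      unfolding parity_label_colouring[OF D \<pi> p] parity_label_colouring[OF D \<pi> pass(1)] by (simp add: comp v)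
  qed
  moreover have "parity_label (delete_crossings {fst p, fst q} D) x = parity_label D x"
    if x: "x \<in> passages D" "fst x \<notin> {fst p, fst q}" for x
  proof -
    \<comment> \<open>The changes are cancelled along one strand and then along the other.\<close>
    have c1: "colouring D (?s(p := False, q := False)) (\<pi>(q := \<pi> p))"
      by (rule colouring_cancel[OF s \<pi> 1 d(1) self])
    have "colouring D (?s(p := False, q := False, a := False, b := False))
        ((\<pi>(q := \<pi> p))(b := (\<pi>(q := \<pi> p)) a))"
      by (rule colouring_cancel[OF s c1 ab(1) d(6)]) (use d sab in auto)
    then show ?thesis
    proof (rule parity_label_delete[OF D D' \<pi>])
      fix y :: passage assume "fst y \<in> {fst p, fst q}"
      then have "y \<in> {p, q, a, b}" using ab(2) by (auto simp: same_crossing)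
      then show "\<not> (?s(p := False, q := False, a := False, b := False)) y" by auto
    next
      fix y :: passage assume "fst y \<notin> {fst p, fst q}"
      then have "y \<notin> {p, q, a, b}" using ab(2) by auto
      then show "(?s(p := False, q := False, a := False, b := False)) y = ?s y \<and>
          ((\<pi>(q := \<pi> p))(b := (\<pi>(q := \<pi> p)) a)) y = \<pi> y" by auto
    qed (use x in auto)
  qed
  ultimately show ?thesis by blast
qed

lemma triangle_at_comp_of:
  assumes D: "well_formed D" and T: "triangle_at D P X Y Z f f' f''"
  shows "comp_of D X = comp_of D Y" "comp_of D (opp X) = comp_of D Z" "comp_of D (opp Y) = comp_of D (opp Z)"
proof -
  have s: "simple D" by (rule well_formedD(1)[OF D])
  have pass: "{X, Y, opp X, Z, opp Y, opp Z} \<subseteq> passages D"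
    using T well_formedD(2)[OF D] by (auto simp: triangle_at_def)
  have n: "comp_of D (nxt D x) = comp_of D x" if "x \<in> passages D" for x
    using comp_of_succs[OF s succs_nxt[OF s that]] by simp
  show "comp_of D X = comp_of D Y" using T n[of X] n[of Y] pass unfolding triangle_at_def by (cases f) auto
  show "comp_of D (opp X) = comp_of D Z" using T n[of "opp X"] n[of Z] pass unfolding triangle_at_def by (cases f') auto
  show "comp_of D (opp Y) = comp_of D (opp Z)"
    using T n[of "opp Y"] n[of "opp Z"] pass unfolding triangle_at_def by (cases f'') auto
qed

lemma triangle_at_self_passage:
  assumes D: "well_formed D" and T: "triangle_at D P X Y Z f f' f''" and tk: "triangle_kinds D P" and X: "self_passage D X"
  shows "self_passage D Y = self_passage D Z"
  using triangle_kinds_virt[OF D T tk] X triangle_at_comp_of[OF D T] by (auto simp: self_passage_def)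

text \<open>If all three are self-crossings, each strand changes colour once, so the colour
  differences at the three crossings add up to an odd number: the number of even crossings is odd,
  and if \<open>X\<close> is even, \<open>Y\<close> and \<open>Z\<close> have equal parity.
  Otherwise \<open>Y\<close> and \<open>Z\<close> are both virtual or join the same two
  components.\<close>

lemma parity_label_triangle_None:
  assumes D: "well_formed D" and T: "triangle_at D P X Y Z f f' f''" and tk: "triangle_kinds D P" and X: "parity_label D X = None"
  shows "parity_label D Y = parity_label D Z"
proof -
  have s: "simple D" by (rule well_formedD(1)[OF D])
  have pass: "X \<in> passages D" "Y \<in> passages D" "Z \<in> passages D" using T by (simp_all add: triangle_at_def)
  note opass = pass[THEN well_formedD(2)[OF D]]
  obtain \<pi> where \<pi>: "colouring D (self_passage D) \<pi>" using colouring_exists[OF D] by blast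
  note lab = parity_label_colouring[OF D \<pi>]
  note comp = triangle_at_comp_of[OF D T]
  have X': "\<not> is_virt D X" "comp_of D X = comp_of D (opp X)" "\<pi> X \<noteq> \<pi> (opp X)"
    using X unfolding lab[OF pass(1)] by (simp_all split: if_splits)
  have virt: "is_virt D Y = is_virt D Z" by (rule triangle_kinds_virt[OF D T tk X'(1)])
  show ?thesis
  proof (cases "is_virt D Y \<or> comp_of D Y \<noteq> comp_of D (opp Y)")
    case True
    then show ?thesis unfolding lab[OF pass(2)] lab[OF pass(3)] using virt comp X' by auto
  next
    case False
    then have self: "self_passage D X" "self_passage D Y" "self_passage D Z"
      using virt comp X' by (auto simp: self_passage_def)
    have nx: "\<pi> (nxt D x) \<longleftrightarrow> \<not> \<pi> x" if "x \<in> passages D" "self_passage D x" for x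
      using colouringD[OF \<pi> succs_nxt[OF s that(1)]] that(2) by simp
    have "\<pi> X \<noteq> \<pi> Y" using T nx[of X] nx[of Y] pass self unfolding triangle_at_def by (cases f) auto
    moreover have "\<pi> (opp X) \<noteq> \<pi> Z"
      using T nx[of "opp X"] nx[of Z] pass opass self unfolding triangle_at_def by (cases f') auto
    moreover have "\<pi> (opp Y) \<noteq> \<pi> (opp Z)"
      using T nx[of "opp Y"] nx[of "opp Z"] opass self unfolding triangle_at_def by (cases f'') auto
    ultimately have "(\<pi> Y \<noteq> \<pi> (opp Y)) = (\<pi> Z \<noteq> \<pi> (opp Z))" using X'(3) by auto
    then show ?thesis unfolding lab[OF pass(2)] lab[OF pass(3)] using virt comp False X' by auto
  qed
qed

text \<open>Only passages of the triangle are recoloured. At a self-crossing both passages are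
  recoloured or neither is, because the other two crossings of the triangle are both self-crossings
  or both not.\<close>

lemma parity_label_triangle:
  assumes D: "well_formed D" and T: "triangle_at D P X Y Z f f' f''" and tk: "triangle_kinds D P"
    and D': "well_formed (swap_along P D)" and x: "x \<in> passages D"
  shows "parity_label (swap_along P D) x = parity_label D x"
proof -
  let ?D' = "swap_along P D" and ?\<sigma> = "swap_ends P D"
  let ?W = "{X, Y, opp X, Z, opp Y, opp Z}"
  have s: "simple D" by (rule well_formedD(1)[OF D])
  have s': "simple ?D'" by (rule well_formedD(1)[OF D'])
  note TD = triangle_atD[OF D T]
  note sw = swap_ends_simps[OF s TD(1,4)]
  have t: "transports ?\<sigma> D ?D'" by (rule swap_ends_transports[OF s TD(1,4)])
  have \<sigma>S: "?\<sigma> y \<in> passages D" if "y \<in> passages D" for y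
    using that nxt_passages[OF s] prv_passages[OF s] by (simp add: swap_ends_def)
  have pass': "passages ?D' = passages D"
  proof -
    have "?\<sigma> ` passages D \<subseteq> passages D" using \<sigma>S by blast
    moreover have "passages D \<subseteq> ?\<sigma> ` passages D" using \<sigma>S sw(4) by (metis image_iff subsetI)
    ultimately show ?thesis unfolding transports_passages[OF t] by blast
  qed
  have virt: "is_virt ?D' y = is_virt D y" for y by (simp add: is_virt_def)
  have comp_nxt: "comp_of D (nxt D y) = comp_of D y" if "y \<in> passages D" for y
    using comp_of_succs[OF s succs_nxt[OF s that]] by simp
  have comp_\<sigma>: "comp_of D (?\<sigma> y) = comp_of D y" if "y \<in> passages D" for y
  proof -
    consider "y \<in> P" | z where "z \<in> P" "y = nxt D z" | "y \<notin> P" "y \<notin> nxt D ` P" by blast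
    then show ?thesis
    proof cases
      case 1
      then show ?thesis using sw(1) comp_nxt[OF that] by simp
    next
      case 2
      then show ?thesis using sw(2) comp_nxt[of z] TD(1) by auto
    next
      case 3
      then show ?thesis by (simp add: sw(3))
    qed
  qed
  have comp: "comp_of ?D' y = comp_of D y" if y: "y \<in> passages D" for y
  proof (rule comp_of_eqI[OF s'])
    have "?\<sigma> y \<in> set (comps D ! comp_of D y)"
      using comp_of(2)[OF s \<sigma>S[OF y]] comp_\<sigma>[OF y] by simp
    then have "?\<sigma> (?\<sigma> y) \<in> ?\<sigma> ` set (comps D ! comp_of D y)" by blast
    then have "y \<in> ?\<sigma> ` set (comps D ! comp_of D y)" by (simp add: sw(4))
    moreover have "comps ?D' = map (map ?\<sigma>) (comps D)" by (simp add: swap_along_def swap_ends_def[abs_def])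
    ultimately show "comp_of D y < length (comps ?D')" "y \<in> set (comps ?D' ! comp_of D y)"
      using comp_of(1)[OF s y] by simp_all
  qed
  have self: "self_passage ?D' y = self_passage D y" if "y \<in> passages D" for y
    by (simp add: self_passage_def virt comp that well_formedD(2)[OF D])
  obtain \<pi> where \<pi>: "colouring D (self_passage D) \<pi>" using colouring_exists[OF D] by blast
  \<comment> \<open>When two consecutive passages trade places, the earlier one moves behind a
    change at the later one, and the later one moves in front of a change at the earlier one. So
    each is recoloured according to its partner \<open>swap_ends P D y\<close>, and colours outside
    the arc stay.\<close>
  define \<pi>' where "\<pi>' = (\<lambda>y. if y \<in> P \<union> nxt D ` P then \<pi> y \<noteq> self_passage D (?\<sigma> y) else \<pi> y)"
  have tail: "\<pi>' (?\<sigma> y) \<longleftrightarrow> \<pi> y" if "y \<in> P" for y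
    using that sw(1,2)[OF that] colouringD[OF \<pi> succs_nxt[OF s, of y]] TD(1) by (auto simp: \<pi>'_def)
  have head: "\<pi>' (?\<sigma> (nxt D y)) \<longleftrightarrow> \<pi> y \<noteq> self_passage D (nxt D y)" if "y \<in> P" for y
    using that sw(1,2)[OF that] by (auto simp: \<pi>'_def)
  have other: "\<pi>' (?\<sigma> y) \<longleftrightarrow> \<pi> y" if "y \<notin> nxt D ` P" for y
    using that tail[of y] sw(3)[of y] by (cases "y \<in> P") (auto simp: \<pi>'_def)
  have col: "colouring ?D' (self_passage ?D') \<pi>'"
    unfolding colouring_def
  proof (intro allI impI)
    fix u v assume "(u, v) \<in> succs ?D'"
    then obtain a b where ab: "(a, b) \<in> succs D" "u = ?\<sigma> a" "v = ?\<sigma> b"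
      using t unfolding transports_def by (auto simp: map_prod_def)
    have a: "a \<in> passages D" and b: "b = nxt D a" using ab(1) succs_iff[OF s] by auto
    have \<pi>b: "\<pi> b \<longleftrightarrow> \<pi> a \<noteq> self_passage D a" by (rule colouringD[OF \<pi> ab(1)])
    have su: "self_passage ?D' u = self_passage D (?\<sigma> a)" unfolding ab(2) by (rule self[OF \<sigma>S[OF a]])
    show "\<pi>' v \<longleftrightarrow> \<pi>' u \<noteq> self_passage ?D' u"
    proof (cases "a \<in> P")
      case True
      then show ?thesis using head[OF True] tail[OF True] sw(1)[OF True] su unfolding ab(2,3) b by simp
    next
      case aP: False
      have "b \<notin> nxt D ` P"
      proof
        assume "b \<in> nxt D ` P"
        then obtain z where z: "b = nxt D z" "z \<in> P" by (rule imageE)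
        have "z \<in> passages D" using TD(1) z(2) by (rule subsetD)
        then have "a = z" using nxt_inj[OF s a, of z] b z(1) by simp
        then show False using aP z(2) by simp
      qed
      then have v: "\<pi>' v \<longleftrightarrow> \<pi> b" unfolding ab(3) by (rule other)
      show ?thesis
      proof (cases "a \<in> nxt D ` P")
        case True
        then obtain z where z: "a = nxt D z" "z \<in> P" by (rule imageE)
        have "z \<in> passages D" using TD(1) z(2) by (rule subsetD)
        then have "\<pi> a \<longleftrightarrow> \<pi> z \<noteq> self_passage D z"
          unfolding z(1) by (rule colouringD[OF \<pi> succs_nxt[OF s]])
        then show ?thesis using v \<pi>b head[OF z(2)] su sw(2)[OF z(2)] unfolding ab(2) z(1) by auto
      next
        case False
        then show ?thesis using v \<pi>b other[OF False] su sw(3)[OF aP False] unfolding ab(2) by simp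
      qed
    qed
  qed
  have W: "P \<union> nxt D ` P = ?W" by (rule TD(3))
  have \<pi>'W: "\<pi>' y \<longleftrightarrow> \<pi> y \<noteq> self_passage D (?\<sigma> y)" if "y \<in> ?W" for y
    using that unfolding \<pi>'_def W by simp
  have \<sigma>: "?\<sigma> X = Y" "?\<sigma> Y = X" "?\<sigma> (opp X) = Z" "?\<sigma> Z = opp X" "?\<sigma> (opp Y) = opp Z" "?\<sigma> (opp Z) = opp Y"
    by (rule swap_ends_triangle[OF D T])+
  have "(\<pi>' x \<noteq> \<pi>' (opp x)) = (\<pi> x \<noteq> \<pi> (opp x))" if self_x: "self_passage D x"
  proof (cases "x \<in> ?W")
    case False
    then have "opp x \<notin> ?W" by (auto simp: opp_eq_iff)
    then show ?thesis using False by (simp add: \<pi>'_def W)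
  next
    case True
    have "self_passage D (?\<sigma> x) = self_passage D (?\<sigma> (opp x))"
    proof -
      have "self_passage D X \<Longrightarrow> self_passage D Y = self_passage D Z"
        by (rule triangle_at_self_passage[OF D T tk])
      moreover have "self_passage D Y \<Longrightarrow> self_passage D X = self_passage D Z"
        using triangle_at_self_passage[OF D triangle_at_swap_mb[OF T D] tk] by simp
      moreover have "self_passage D Z \<Longrightarrow> self_passage D X = self_passage D Y"
        using triangle_at_self_passage[OF D triangle_at_swap_mb[OF triangle_at_swap_tm[OF T D] D] tk] by simp
      moreover have "x = X \<or> x = Y \<or> x = opp X \<or> x = Z \<or> x = opp Y \<or> x = opp Z" using True by simp
      ultimately show ?thesis
        by (elim disjE) (use self_x in \<open>simp_all add: \<sigma>\<close>)
    qed
    moreover have "opp x \<in> ?W" using True by auto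
    ultimately show ?thesis using \<pi>'W[OF True] \<pi>'W[of "opp x"] by auto
  qed
  then show ?thesis
    by (intro parity_label_eqI[OF D D' x _ virt comp[OF x] comp[OF well_formedD(2)[OF D x]] \<pi> col])
       (use x pass' in simp_all)
qed

interpretation parity: labelling parity_label
proof
  show "parity_label D p = None \<Longrightarrow> \<not> is_virt D p" for D p by (auto simp: parity_label_def)
qed (fact parity_label_opp parity_label_isotopic parity_label_monogon parity_label_bigon parity_label_triangle parity_label_triangle_None)+

section \<open>Exponents of \<open>\<alpha>\<close>\<close>

text \<open>Intervals of exponents add under multiplication, and the zero polynomial lies in every
  range, so neither sums nor cancellation need a case distinction.\<close>

definition alpha_range :: "int \<Rightarrow> int \<Rightarrow> laurent set" where
  "alpha_range a b = {f. alpha_exponents f \<subseteq> {a..b}}"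

lemma alpha_range_iff:
  "f \<in> alpha_range a b \<longleftrightarrow> (\<forall>m \<in> Poly_Mapping.keys f. a \<le> Poly_Mapping.lookup m Valpha \<and> Poly_Mapping.lookup m Valpha \<le> b)"
  by (auto simp: alpha_range_def alpha_exponents_def)

lemma alpha_range_mono: "f \<in> alpha_range a b \<Longrightarrow> a' \<le> a \<Longrightarrow> b \<le> b' \<Longrightarrow> f \<in> alpha_range a' b'"
  by (force simp: alpha_range_iff)

lemma alpha_range_0: "0 \<in> alpha_range a b"
  by (simp add: alpha_range_iff)

lemma alpha_range_add: "f \<in> alpha_range a b \<Longrightarrow> g \<in> alpha_range a b \<Longrightarrow> f + g \<in> alpha_range a b"
  using keys_add[of f g] by (auto simp: alpha_range_iff)

lemma alpha_range_minus: "f \<in> alpha_range a b \<Longrightarrow> - f \<in> alpha_range a b"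
  by (simp add: alpha_range_iff)

lemma alpha_range_diff: "f \<in> alpha_range a b \<Longrightarrow> g \<in> alpha_range a b \<Longrightarrow> f - g \<in> alpha_range a b"
  using alpha_range_add[of f a b "- g"] alpha_range_minus by simp

lemma alpha_range_mult:
  assumes "f \<in> alpha_range a b" "g \<in> alpha_range c d"
  shows "f * g \<in> alpha_range (a + c) (b + d)"
  unfolding alpha_range_iff
proof
  fix m assume "m \<in> Poly_Mapping.keys (f * g)"
  then obtain k l where "m = k + l" "k \<in> Poly_Mapping.keys f" "l \<in> Poly_Mapping.keys g"
    using keys_mult[of f g] by blast
  then show "a + c \<le> Poly_Mapping.lookup m Valpha \<and> Poly_Mapping.lookup m Valpha \<le> b + d"
    using assms by (force simp: alpha_range_iff lookup_add)
qed

lemma alpha_range_vpow: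
  "vpow Valpha k \<in> alpha_range k k" "v \<noteq> Valpha \<Longrightarrow> vpow v k \<in> alpha_range 0 0"
  by (auto simp: alpha_range_iff vpow_def lookup_single split: if_splits)

lemma alpha_range_1: "1 \<in> alpha_range 0 0"
  using alpha_range_vpow(1)[of 0] by simp

lemma alpha_range_sum:
  "(\<And>x. x \<in> A \<Longrightarrow> f x \<in> alpha_range a b) \<Longrightarrow> sum f A \<in> alpha_range a b"
  by (induction A rule: infinite_finite_induct) (auto simp: alpha_range_0 alpha_range_add)

lemma alpha_range_prod:
  "(\<And>x. x \<in> A \<Longrightarrow> f x \<in> alpha_range (a x) (b x)) \<Longrightarrow> prod f A \<in> alpha_range (sum a A) (sum b A)"
  by (induction A rule: infinite_finite_induct) (auto simp: alpha_range_1 alpha_range_mult)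

text \<open>Every term of the Leibniz formula takes one entry from each row, so bounds that hold
  throughout a row add up.\<close>

lemma sdet_alpha_range:
  assumes "finite S" "\<And>x y. x \<in> S \<Longrightarrow> y \<in> S \<Longrightarrow> A x y \<in> alpha_range (a x) (b x)"
  shows "sdet S A \<in> alpha_range (sum a S) (sum b S)"
proof -
  obtain xs where xs: "distinct xs" "set xs = S" using finite_distinct_list[OF assms(1)] by blast
  let ?n = "length xs"
  let ?M = "mat ?n ?n (\<lambda>(i, j). A (xs ! i) (xs ! j))"
  have sums: "(\<Sum>i = 0..<?n. c (xs ! i)) = sum c S" for c :: "'a \<Rightarrow> int"
    using sum.distinct_set_conv_list[OF xs(1), of c] xs(2) by (simp add: sum_list_sum_nth)
  have "(\<Prod>i = 0..<?n. ?M $$ (i, p i)) \<in> alpha_range (sum a S) (sum b S)" if p: "p permutes {0..<?n}" for p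
    unfolding sums[symmetric]
  proof (rule alpha_range_prod)
    fix i assume i: "i \<in> {0..<?n}"
    then have "p i < ?n" using permutes_in_image[OF p, of i] by simp
    then show "?M $$ (i, p i) \<in> alpha_range (a (xs ! i)) (b (xs ! i))"
      using i assms(2)[of "xs ! i" "xs ! p i"] xs(2) by auto
  qed
  then have "signof p * (\<Prod>i = 0..<?n. ?M $$ (i, p i)) \<in> alpha_range (sum a S) (sum b S)"
    if "p permutes {0..<?n}" for p
    using that alpha_range_minus by (simp add: sign_def)
  then have "ldet xs A \<in> alpha_range (sum a S) (sum b S)"
    unfolding ldet_def by (subst det_def'[of _ ?n]) (auto intro!: alpha_range_sum)
  then show ?thesis using sdet_list[OF xs(1), of A] xs(2) by simp
qed

lemma arc_det_alpha_range:
  assumes l: "\<And>p. l p = Some Valpha \<Longrightarrow> is_virt D p"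
  shows "arc_det (label_rel l D) D \<in> alpha_range (- int (num_virtual D)) (int (num_virtual D))"
proof -
  let ?S = "passages D"
  \<comment> \<open>At a virtual crossing the row of \<open>SE\<close> contributes the exponent
    \<open>-1\<close> and the row of \<open>SW\<close> the exponent \<open>1\<close>. Counting the
    two types separately bounds each side by the number of virtual crossings, not by twice that
    number.\<close>
  define a where "a = (\<lambda>x. if is_virt D x \<and> snd x = SE then - 1 else (0::int))"
  define b where "b = (\<lambda>x. if is_virt D x \<and> snd x = SW then 1 else (0::int))"
  have count: "card {x \<in> ?S. is_virt D x \<and> snd x = st} \<le> num_virtual D" for st
    unfolding num_virtual_def
  proof (rule card_inj_on_le[where f = fst])
    show "inj_on fst {x \<in> ?S. is_virt D x \<and> snd x = st}" by (auto simp: inj_on_def)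
    show "fst ` {x \<in> ?S. is_virt D x \<and> snd x = st} \<subseteq> {c \<in> crossings D. kind_of D c = Virt}"
      by (auto simp: crossings_def is_virt_def)
  qed (simp add: crossings_def)
  have "sum a ?S = - int (card {x \<in> ?S. is_virt D x \<and> snd x = SE})"
    by (simp add: a_def sum.If_cases Int_def)
  then have sa: "- int (num_virtual D) \<le> sum a ?S" using count[of SE] by linarith
  have "sum b ?S = int (card {x \<in> ?S. is_virt D x \<and> snd x = SW})"
    by (simp add: b_def sum.If_cases Int_def)
  then have sb: "sum b ?S \<le> int (num_virtual D)" using count[of SW] by linarith
  \<comment> \<open>Each row interval contains \<open>0\<close>, which makes room for the zero
    entries and for the \<open>1\<close> subtracted on the diagonal.\<close>
  have ab: "a x \<le> 0" "0 \<le> b x" for x by (simp_all add: a_def b_def)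
  have zero: "f \<in> alpha_range (a x) (b x)" if "f \<in> alpha_range 0 0" for f x
    by (rule alpha_range_mono[OF that ab])
  have row: "fst (label_rel l D x) \<in> alpha_range (a x) (b x) \<and> snd (label_rel l D x) \<in> alpha_range 0 0" for x
  proof (cases "l x")
    case None
    have "fst (rel_B D x) \<in> alpha_range 0 0" "snd (rel_B D x) \<in> alpha_range 0 0"
      using alpha_range_mult[OF alpha_range_vpow(2) alpha_range_vpow(2), of Vs Vt]
      by (simp_all add: rel_B_def Let_def alpha_range_vpow alpha_range_0 alpha_range_1 alpha_range_diff)
    then show ?thesis using None zero by (simp add: label_rel_def)
  next
    case (Some y)
    have "vpow y (strand_sign x) \<in> alpha_range (a x) (b x)"
    proof (cases "y = Valpha")
      case True
      then have "is_virt D x" using l Some by simp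
      then have "a x \<le> strand_sign x" "strand_sign x \<le> b x"
        by (cases "snd x"; simp add: a_def b_def strand_sign_def)+
      then show ?thesis unfolding True by (rule alpha_range_mono[OF alpha_range_vpow(1)])
    next
      case False
      then show ?thesis by (intro zero alpha_range_vpow(2))
    qed
    then show ?thesis using Some by (simp add: label_rel_Some alpha_range_0)
  qed
  have "arcmat (label_rel l D) D x y - of_bool (x = y) \<in> alpha_range (a x) (b x)" for x y
    unfolding arcmat_def using row[of x]
    by (intro alpha_range_diff alpha_range_add) (auto simp: of_bool_def alpha_range_0 zero alpha_range_1)
  then have "sdet ?S (\<lambda>x y. arcmat (label_rel l D) D x y - of_bool (x = y)) \<in> alpha_range (sum a ?S) (sum b ?S)"
    by (intro sdet_alpha_range) simp_all
  then show ?thesis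
    using sa sb by (auto simp: arc_det_def alpha_range_0 intro: alpha_range_mono)
qed

lemma st_units_alpha_range: "u \<in> st_units \<Longrightarrow> u \<in> alpha_range 0 0"
proof -
  have 1: "vpow Vs a * vpow Vt b \<in> alpha_range 0 0" for a b
    using alpha_range_mult[OF alpha_range_vpow(2) alpha_range_vpow(2), of Vs Vt] by simp
  assume "u \<in> st_units"
  then obtain e a b where "u = e * (vpow Vs a * vpow Vt b)" "e \<in> {1, - 1}"
    unfolding st_units_def by (auto simp: mult.assoc)
  then show ?thesis using 1[of a b] alpha_range_minus[OF 1[of a b]] by auto
qed

lemma alpha_range_e_max_e_min:
  assumes "f \<in> alpha_range (- n) n" "0 \<le> n"
  shows "max \<bar>e_max f\<bar> \<bar>e_min f\<bar> \<le> n"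
proof (cases "f = 0")
  case True
  then show ?thesis using assms(2) by (simp add: e_max_def e_min_def)
next
  case False
  then have "alpha_exponents f \<noteq> {}" "finite (alpha_exponents f)"
    by (auto simp: alpha_exponents_def)
  then have "Max (alpha_exponents f) \<in> {- n..n}" "Min (alpha_exponents f) \<in> {- n..n}"
    using assms(1) Max_in Min_in unfolding alpha_range_def by blast+
  then show ?thesis using False by (auto simp: e_max_def e_min_def)
qed

section \<open>From diagrams to links\<close>

context labelling
begin

lemma link_poly_bound:
  assumes rel: "\<And>D p. rel D p = label_rel (L D) D p" and l: "\<And>D p. L D p = Some Valpha \<Longrightarrow> is_virt D p"
    and K: "K \<in> virtual_links" and f: "f \<in> link_poly rel K"
  shows "max \<bar>e_max f\<bar> \<bar>e_min f\<bar> \<le> int (virtual_number K)"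
proof -
  obtain D1 where D1: "virtual_diagram D1" "K = virtual_equiv `` {D1}"
    using K by (auto simp: virtual_links_def quotient_def)
  have "D1 \<in> K" unfolding D1(2) virtual_equiv_def by blast
  then have "\<exists>n. \<exists>D \<in> K. num_virtual D = n" by blast
  then have "\<exists>D \<in> K. num_virtual D = virtual_number K"
    unfolding virtual_number_def by (rule LeastI_ex)
  then obtain D0 where D0: "D0 \<in> K" "num_virtual D0 = virtual_number K" by blast
  obtain u a b D where D: "f = u * vpow Vs a * vpow Vt b * diagram_poly rel D" "u \<in> {1, - 1}" "D \<in> K"
    using f unfolding link_poly_def by blast
  \<comment> \<open>\<open>moves\<close> relates virtual diagrams only, so nothing else is reached
    from the virtual diagram \<open>D1\<close>.\<close>
  have "virtual_diagram D" if "(D1, D) \<in> virtual_equiv" for D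
    using that unfolding virtual_equiv_def
    by (induction rule: rtrancl_induct) (auto simp: D1(1) moves_def)
  then have "simple D" using D(3) D1(2) virtual_diagram_well_formed well_formedD(1) by blast
  moreover have "rel D = label_rel (L D) D" using rel by blast
  ultimately have dp: "diagram_poly rel D = label_poly D" using diagram_poly_arc_det by simp
  have "associated (label_poly D1) (label_poly D)" "associated (label_poly D1) (label_poly D0)"
    using D(3) D0(1) D1(2) poly_virtual_equiv by blast+
  then have "associated (label_poly D) (label_poly D0)"
    using associated_sym associated_trans by blast
  then obtain v where v: "v \<in> st_units" "label_poly D = v * label_poly D0" by (auto simp: associated_def)
  have "u * vpow Vs a * vpow Vt b * v \<in> st_units" by (intro st_units_mult st_unitsI D(2) v(1))
  then have "(u * vpow Vs a * vpow Vt b * v) * label_poly D0 \<in>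
      alpha_range (0 + - int (num_virtual D0)) (0 + int (num_virtual D0))"
    by (intro alpha_range_mult st_units_alpha_range arc_det_alpha_range l)
  then have "f \<in> alpha_range (- int (virtual_number K)) (int (virtual_number K))"
    unfolding D(1) dp v(2) D0(2) by (simp add: mult.assoc)
  then show ?thesis by (rule alpha_range_e_max_e_min) simp
qed

end

theorem theorem2p10:
  fixes K :: "diagram set"
  assumes "K \<in> virtual_links"
  shows "(\<forall>f \<in> alpha_sawollek K.
            max \<bar>e_max f\<bar> \<bar>e_min f\<bar> \<le> int (virtual_number K))
       \<and> (\<forall>f \<in> alpha_parity_alexander K.
            max \<bar>e_max f\<bar> \<bar>e_min f\<bar> \<le> int (virtual_number K))"
proof (intro conjI ballI)
  fix f assume "f \<in> alpha_sawollek K"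
  moreover have "is_virt D p" if "sawollek_label D p = Some Valpha" for D p
    using that by (simp add: sawollek_label_def split: if_splits)
  ultimately show "max \<bar>e_max f\<bar> \<bar>e_min f\<bar> \<le> int (virtual_number K)"
    using sawollek.link_poly_bound[OF sawollek_rel_label_rel _ assms] by (simp add: alpha_sawollek_def)
next
  fix f assume "f \<in> alpha_parity_alexander K"
  moreover have "is_virt D p" if "parity_label D p = Some Valpha" for D p
    using that by (simp add: parity_label_def split: if_splits)
  ultimately show "max \<bar>e_max f\<bar> \<bar>e_min f\<bar> \<le> int (virtual_number K)"
    using parity.link_poly_bound[OF parity_rel_label_rel _ assms] by (simp add: alpha_parity_alexander_def)
qed

end
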